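(* Let ${\bf N}=(\mathcal L,l_0,l_f,\Gamma,b,k,L,(Y_i)_{0\le i\le L},{\rm Stm}_N)$ be a generalized Turing machine such that $Y_i\in\{\Sigma^*,\Sigma^\omega\}$ for $0\le i\le L$, where all functions used in the machine (the functions $f$ occurring in its assignments and its tests) are (single-valued) partial functions. (1) If all the functions used in ${\bf N}$ are continuous, then $f_N:\subseteq Y_1\times\cdots\times Y_k\to Y_0$ is continuous. (2) If all the functions used in ${\bf N}$ are computable, then $f_N:\subseteq Y_1\times\cdots\times Y_k\to Y_0$ is computable.
   Context: **Notation.** $\Sigma$ is a fixed finite alphabet with $0,1\in\Sigma$; $\Sigma^*$ is the set of finite words and $\Sigma^\omega$ the set of infinite sequences over $\Sigma$. $f:\subseteq A\to B$ denotes a partial function. $\Sigma^*$ carries the discrete topology, $\Sigma^\omega$ the Cantor topology with basis $\{u\Sigma^\omega\mid u\in\Sigma^*\}$, products the product topology; a partial function is continuous if it is continuous on its domain with the subspace topology. **Computability.** For $Y_0,\ldots,Y_n\in\{\Sigma^*,\Sigma^\omega\}$, a Type-2 machine of type $(Y_1,\ldots,Y_n\to Y_0)$ is a multi-tape Turing machine with $n$ input tapes, finitely many work tapes and one one-way output tape. It computes $f:\subseteq Y_1\times\cdots\times Y_n\to Y_0$ where: if $Y_0=\Sigma^*$, $f(p)=w$ iff the machine on input $p$ halts with $w$ on the output tape; if $Y_0=\Sigma^\omega$, $f(p)=q$ iff the machine on input $p$ computes forever and writes $q\in\Sigma^\omega$ on the output tape. Functions so computed are called Turing computable; a partial function is called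 computable if it has a Turing computable extension. **Generalized Turing machine (GTM).** A GTM is a tuple $(\mathcal L,l_0,l_f,\Gamma,b,k,L,(Y_i)_{0\le i\le L},{\rm Stm})$ where $\mathcal L$ is a finite set (labels) with $l_0,l_f\in\mathcal L$ (initial, final label); $\Gamma$ is a finite set with $\Sigma\cap\Gamma=\emptyset$ and $b\in\Gamma$ (blank); $k,L\in\mathbb N$, $k\le L$ (tapes $0,\ldots,L$; input tapes $1,\ldots,k$; output tape $0$); each $Y_i$ is a set with $Y_i\cap\Gamma=\emptyset$; and ${\rm Stm}$ assigns to each $l\in\mathcal L\setminus\{l_f\}$ a statement of one of the forms (with $i,i_1,\ldots,i_n\in\{0,\ldots,L\}$, $l',l''\in\mathcal L$, $a\in\Gamma$): (a) $(i,{\rm right},l')$; (b) $(i,{\rm left},l')$; (c) $(i:=a,l')$; (d) $(i,{\rm if}\ a\ {\rm then}\ l',\ {\rm else}\ l'')$; (e) assignment $(i:=f(i_1,\ldots,i_n),l')$ with $f$ a (in general multi-valued, here single-valued partial) function from $Y_{i_1}\times\cdots\times Y_{i_n}$ to $Y_i$; (f) test $({\rm if}\ f(i_1,\ldots,i_n)\ {\rm then}\ l',\ {\rm else}\ l'')$ with $f:\subseteq Y_{i_1}\times\cdots\times Y_{i_n}\to\Sigma^*$, $\mathrm{range}(f)\subseteq\{0,1\}$. **Semantics.** A configuration is $\kappa=(l,(\alpha_0,m_0),\ldots,(\alpha_L,m_L))$ with $l\in\mathcal L$, $\alpha_i:\mathbb Z\to Y_i\cup\Gamma$ (tape inscription),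 $m_i\in\mathbb Z$ (head position). Let $x_j:=\alpha_j(m_j)$. The successor relation $\kappa\vdash\kappa'$ is determined by ${\rm Stm}(l)$ (no successor if $l=l_f$): in case (a)/(b), $\kappa'$ is $\kappa$ with $m_i$ replaced by $m_i+1$ / $m_i-1$ and label $l'$; (c) $\alpha_i(m_i)$ is replaced by $a$, label $l'$; (d) label $l'$ if $x_i=a$, label $l''$ if $x_i\ne a$; (e) $\alpha_i(m_i)$ is replaced by the value $f(x_{i_1},\ldots,x_{i_n})$, label $l'$ (no successor if this value does not exist, in particular if some $x_{i_j}\notin Y_{i_j}$); (f) label $l'$ if $f(x_{i_1},\ldots,x_{i_n})=0$, label $l''$ if $f(x_{i_1},\ldots,x_{i_n})=1$ (no successor otherwise). A computation is a finite or infinite sequence of configurations, each the $\vdash$-predecessor of the next; it is maximal if it is infinite or its last configuration has no successor. A configuration is accepting if $l=l_f$ and $\alpha_0(0)\in Y_0$; an accepting computation is a finite computation whose last configuration is accepting. The initial configuration ${\rm IC}(x_1,\ldots,x_k)$ has label $l_0$, all heads at position $0$, $\alpha_i(0)=x_i$ for $1\le i\le k$, and $b$ in all other cells. The function $f_N$ computed by the machine: $x_0=f_N(x_1,\ldots,x_k)$ iff every maximal computation starting with ${\rm IC}(x_1,\ldots,x_k)$ is accepting and there is an accepting computation starting with it whose last configuration has $\alpha_0(0)=x_0$ (the value is unique as all functions used are single-valued). *)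

theory Defs
  imports "HOL-Analysis.Analysis"
begin

section \<open>Words, sequences, and partial functions on products\<close>

text \<open>
  The alphabet is a type \<open>'s\<close> of sort \<open>{finite, zero_neq_one}\<close>; the class
  \<open>zero_neq_one\<close> only supplies two distinct letters \<open>0\<close> and \<open>1\<close>.
  Finite words and infinite sequences live in one type, so that the spaces
  \<open>Y\<^sub>i\<close> of a machine may differ from tape to tape.
\<close>

datatype 's val = Word "'s list" | Seq "nat \<Rightarrow> 's"

definition Words :: "'s val set" where
  "Words = range Word"

definition Seqs :: "'s val set" where
  "Seqs = range Seq"

definition cylinder :: "'s list \<Rightarrow> 's val set" where
  "cylinder u = {Seq p | p. \<forall>i < length u. p i = u ! i}"

text \<open>Meaningful only for the two arguments \<open>Words\<close> and \<open>Seqs\<close>.\<close>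

definition space_topology :: "'s val set \<Rightarrow> 's val topology" where
  "space_topology A =
     (if A = Words then discrete_topology Words
      else topology_generated_by (range cylinder))"

text \<open>
  An \<open>n\<close>-tuple is an extensional function on \<open>{1..n}\<close>, and the product
  \<open>D 1 \<times> \<dots> \<times> D n\<close> is \<open>PiE {1..n} D\<close>, which is also the carrier of
  the library's product topology.
\<close>

type_synonym 'y tuple = "nat \<Rightarrow> 'y"

definition continuous_pfun ::
    "nat \<Rightarrow> (nat \<Rightarrow> 's val set) \<Rightarrow> 's val set \<Rightarrow> ('s val tuple \<rightharpoonup> 's val) \<Rightarrow> bool" where
  "continuous_pfun n D R f \<longleftrightarrow>
     dom f \<subseteq> PiE {1..n} D \<and>
     continuous_map
       (subtopology (product_topology (\<lambda>j. space_topology (D j)) {1..n}) (dom f))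
       (space_topology R) (\<lambda>x. the (f x))"


section \<open>Type-2 machines\<close>

text \<open>
  A Type-2 machine is given as a flowchart, in the style also used for generalized
  machines: each label other than the final one carries one elementary statement.
  For a machine with \<open>n\<close> inputs the tapes \<open>1..n\<close> are the (read-only) input
  tapes and \<open>n+1..n+w\<close> the work tapes. The output tape is one-way: the only
  operation on it is to append a letter. Labels and auxiliary symbols are natural numbers,
  which is no restriction as there are finitely many of them.
\<close>

datatype 's symbol = Letter 's | Aux nat

abbreviation blank :: "'s symbol" where
  "blank \<equiv> Aux 0"

datatype 's t2_stm =
    T2_Right nat nat
  | T2_Left nat nat
  | T2_Write nat "'s symbol" nat
  | T2_If nat "'s symbol" nat nat
  | T2_Out 's nat

record 's t2_machine =
  t2_labels :: "nat set"
  t2_init :: nat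
  t2_final :: nat
  t2_aux :: "nat set"
  t2_work :: nat
  t2_stm :: "nat \<Rightarrow> 's t2_stm"

fun wf_t2_stm :: "'s t2_machine \<Rightarrow> nat \<Rightarrow> 's t2_stm \<Rightarrow> bool" where
  "wf_t2_stm M n (T2_Right i l') \<longleftrightarrow> i \<in> {1..n + t2_work M} \<and> l' \<in> t2_labels M"
| "wf_t2_stm M n (T2_Left i l') \<longleftrightarrow> i \<in> {1..n + t2_work M} \<and> l' \<in> t2_labels M"
| "wf_t2_stm M n (T2_Write i a l') \<longleftrightarrow>
     i \<in> {n + 1..n + t2_work M} \<and> a \<in> range Letter \<union> Aux ` t2_aux M \<and> l' \<in> t2_labels M"
| "wf_t2_stm M n (T2_If i a l' l'') \<longleftrightarrow>
     i \<in> {1..n + t2_work M} \<and> a \<in> range Letter \<union> Aux ` t2_aux M \<and>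
     l' \<in> t2_labels M \<and> l'' \<in> t2_labels M"
| "wf_t2_stm M n (T2_Out a l') \<longleftrightarrow> l' \<in> t2_labels M"

definition wf_t2 :: "nat \<Rightarrow> 's t2_machine \<Rightarrow> bool" where
  "wf_t2 n M \<longleftrightarrow>
     finite (t2_labels M) \<and> t2_init M \<in> t2_labels M \<and> t2_final M \<in> t2_labels M \<and>
     finite (t2_aux M) \<and> 0 \<in> t2_aux M \<and>
     (\<forall>l \<in> t2_labels M - {t2_final M}. wf_t2_stm M n (t2_stm M l))"

record 's t2_config =
  t2_label :: nat
  t2_tape :: "nat \<Rightarrow> int \<Rightarrow> 's symbol"
  t2_head :: "nat \<Rightarrow> int"
  t2_out :: "'s list"

definition t2_step :: "'s t2_machine \<Rightarrow> 's t2_config \<Rightarrow> 's t2_config" where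
  "t2_step M c =
     (if t2_label c = t2_final M then c
      else case t2_stm M (t2_label c) of
        T2_Right i l' \<Rightarrow>
          c\<lparr>t2_label := l', t2_head := (t2_head c)(i := t2_head c i + 1)\<rparr>
      | T2_Left i l' \<Rightarrow>
          c\<lparr>t2_label := l', t2_head := (t2_head c)(i := t2_head c i - 1)\<rparr>
      | T2_Write i a l' \<Rightarrow>
          c\<lparr>t2_label := l',
            t2_tape := (t2_tape c)(i := (t2_tape c i)(t2_head c i := a))\<rparr>
      | T2_If i a l' l'' \<Rightarrow>
          c\<lparr>t2_label := (if t2_tape c i (t2_head c i) = a then l' else l'')\<rparr>
      | T2_Out a l' \<Rightarrow>
          c\<lparr>t2_label := l', t2_out := t2_out c @ [a]\<rparr>)"

fun input_tape :: "'s val \<Rightarrow> int \<Rightarrow> 's symbol" where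
  "input_tape (Word w) z =
     (if 0 \<le> z \<and> nat z < length w then Letter (w ! nat z) else blank)"
| "input_tape (Seq p) z = (if 0 \<le> z then Letter (p (nat z)) else blank)"

definition t2_initial :: "'s t2_machine \<Rightarrow> nat \<Rightarrow> 's val tuple \<Rightarrow> 's t2_config" where
  "t2_initial M n x =
     \<lparr>t2_label = t2_init M,
      t2_tape = (\<lambda>i. if i \<in> {1..n} then input_tape (x i) else (\<lambda>_. blank)),
      t2_head = (\<lambda>_. 0),
      t2_out = []\<rparr>"

definition t2_run :: "'s t2_machine \<Rightarrow> nat \<Rightarrow> 's val tuple \<Rightarrow> nat \<Rightarrow> 's t2_config" where
  "t2_run M n x t = (t2_step M ^^ t) (t2_initial M n x)"

fun t2_yields :: "'s t2_machine \<Rightarrow> nat \<Rightarrow> 's val tuple \<Rightarrow> 's val \<Rightarrow> bool" where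
  "t2_yields M n x (Word w) \<longleftrightarrow>
     (\<exists>t. t2_label (t2_run M n x t) = t2_final M \<and> t2_out (t2_run M n x t) = w)"
| "t2_yields M n x (Seq q) \<longleftrightarrow>
     (\<forall>t. t2_label (t2_run M n x t) \<noteq> t2_final M) \<and>
     (\<forall>t. t2_out (t2_run M n x t) = map q [0..<length (t2_out (t2_run M n x t))]) \<and>
     (\<forall>m. \<exists>t. m \<le> length (t2_out (t2_run M n x t)))"

text \<open>\<open>f\<close> is the function computed by \<open>M\<close> as a machine of type \<open>(D 1, \<dots>, D n \<rightarrow> R)\<close>.\<close>

definition t2_computes ::
    "'s t2_machine \<Rightarrow> nat \<Rightarrow> (nat \<Rightarrow> 's val set) \<Rightarrow> 's val set \<Rightarrow>
     ('s val tuple \<rightharpoonup> 's val) \<Rightarrow> bool" where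
  "t2_computes M n D R f \<longleftrightarrow>
     (\<forall>x v. f x = Some v \<longleftrightarrow> x \<in> PiE {1..n} D \<and> v \<in> R \<and> t2_yields M n x v)"

definition turing_computable ::
    "nat \<Rightarrow> (nat \<Rightarrow> 's val set) \<Rightarrow> 's val set \<Rightarrow> ('s val tuple \<rightharpoonup> 's val) \<Rightarrow> bool" where
  "turing_computable n D R f \<longleftrightarrow> (\<exists>M. wf_t2 n M \<and> t2_computes M n D R f)"

definition computable_pfun ::
    "nat \<Rightarrow> (nat \<Rightarrow> 's val set) \<Rightarrow> 's val set \<Rightarrow> ('s val tuple \<rightharpoonup> 's val) \<Rightarrow> bool" where
  "computable_pfun n D R f \<longleftrightarrow> (\<exists>g. turing_computable n D R g \<and> f \<subseteq>\<^sub>m g)"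


section \<open>Generalized Turing machines\<close>

text \<open>
  \<open>'s\<close>: alphabet, \<open>'y\<close>: data that can stand in a single cell, \<open>'g\<close>: tape symbols,
  \<open>'l\<close>: labels; the fields \<open>symbols\<close>, \<open>inputs\<close>, \<open>maxtape\<close>, \<open>spaces\<close> are
  \<open>\<Gamma>\<close>, \<open>k\<close>, \<open>L\<close>, \<open>(Y\<^sub>i)\<close>. The disjointness of \<open>\<Gamma>\<close> from the \<open>Y\<^sub>i\<close> and from the alphabet
  is enforced by the types. In \<open>Assign i n ix f l'\<close> and \<open>Test n ix f l' l''\<close>
  the argument tapes are \<open>ix 1, \<dots>, ix n\<close>.
  All functions are single-valued partial functions.
\<close>

datatype ('y, 'g) cell = Data 'y | Sym 'g

datatype ('s, 'y, 'g, 'l) stm =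
    Right nat 'l
  | Left nat 'l
  | Write nat 'g 'l
  | IfSym nat 'g 'l 'l
  | Assign nat nat "nat \<Rightarrow> nat" "'y tuple \<rightharpoonup> 'y" 'l
  | Test nat "nat \<Rightarrow> nat" "'y tuple \<rightharpoonup> 's list" 'l 'l

record ('s, 'y, 'g, 'l) gtm =
  labels :: "'l set"
  init :: 'l
  final :: 'l
  symbols :: "'g set"
  blank_sym :: 'g
  inputs :: nat
  maxtape :: nat
  spaces :: "nat \<Rightarrow> 'y set"
  Stm :: "'l \<Rightarrow> ('s, 'y, 'g, 'l) stm"

fun wf_stm ::
    "('s::zero_neq_one, 'y, 'g, 'l) gtm \<Rightarrow> ('s, 'y, 'g, 'l) stm \<Rightarrow> bool" where
  "wf_stm N (Right i l') \<longleftrightarrow> i \<le> maxtape N \<and> l' \<in> labels N"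
| "wf_stm N (Left i l') \<longleftrightarrow> i \<le> maxtape N \<and> l' \<in> labels N"
| "wf_stm N (Write i a l') \<longleftrightarrow> i \<le> maxtape N \<and> a \<in> symbols N \<and> l' \<in> labels N"
| "wf_stm N (IfSym i a l' l'') \<longleftrightarrow>
     i \<le> maxtape N \<and> a \<in> symbols N \<and> l' \<in> labels N \<and> l'' \<in> labels N"
| "wf_stm N (Assign i n ix f l') \<longleftrightarrow>
     i \<le> maxtape N \<and> (\<forall>j \<in> {1..n}. ix j \<le> maxtape N) \<and>
     dom f \<subseteq> PiE {1..n} (\<lambda>j. spaces N (ix j)) \<and> ran f \<subseteq> spaces N i \<and> l' \<in> labels N"
| "wf_stm N (Test n ix f l' l'') \<longleftrightarrow>
     (\<forall>j \<in> {1..n}. ix j \<le> maxtape N) \<and>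
     dom f \<subseteq> PiE {1..n} (\<lambda>j. spaces N (ix j)) \<and> ran f \<subseteq> {[0], [1]} \<and>
     l' \<in> labels N \<and> l'' \<in> labels N"

definition wf_gtm :: "('s::zero_neq_one, 'y, 'g, 'l) gtm \<Rightarrow> bool" where
  "wf_gtm N \<longleftrightarrow>
     finite (labels N) \<and> init N \<in> labels N \<and> final N \<in> labels N \<and>
     finite (symbols N) \<and> blank_sym N \<in> symbols N \<and>
     inputs N \<le> maxtape N \<and>
     (\<forall>l \<in> labels N - {final N}. wf_stm N (Stm N l))"

record ('y, 'g, 'l) config =
  label :: 'l
  tape :: "nat \<Rightarrow> int \<Rightarrow> ('y, 'g) cell"
  head :: "nat \<Rightarrow> int"

definition scanned :: "('y, 'g, 'l) config \<Rightarrow> nat \<Rightarrow> ('y, 'g) cell" where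
  "scanned c i = tape c i (head c i)"

definition set_cell ::
    "('y, 'g, 'l) config \<Rightarrow> nat \<Rightarrow> ('y, 'g) cell \<Rightarrow> nat \<Rightarrow> int \<Rightarrow> ('y, 'g) cell" where
  "set_cell c i a = (tape c)(i := (tape c i)(head c i := a))"

text \<open>\<open>x\<close> is the tuple of data under the heads of the tapes \<open>ix 1, \<dots>, ix n\<close>.\<close>

definition scanned_args ::
    "('y, 'g, 'l) config \<Rightarrow> nat \<Rightarrow> (nat \<Rightarrow> nat) \<Rightarrow> 'y tuple \<Rightarrow> bool" where
  "scanned_args c n ix x \<longleftrightarrow>
     x \<in> extensional {1..n} \<and> (\<forall>j \<in> {1..n}. scanned c (ix j) = Data (x j))"

fun exec ::
    "('s::zero_neq_one, 'y, 'g, 'l) stm \<Rightarrow> ('y, 'g, 'l) config \<Rightarrow> ('y, 'g, 'l) config \<Rightarrow> bool"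
where
  "exec (Right i l') c c' \<longleftrightarrow>
     c' = c\<lparr>label := l', head := (head c)(i := head c i + 1)\<rparr>"
| "exec (Left i l') c c' \<longleftrightarrow>
     c' = c\<lparr>label := l', head := (head c)(i := head c i - 1)\<rparr>"
| "exec (Write i a l') c c' \<longleftrightarrow>
     c' = c\<lparr>label := l', tape := set_cell c i (Sym a)\<rparr>"
| "exec (IfSym i a l' l'') c c' \<longleftrightarrow>
     c' = c\<lparr>label := (if scanned c i = Sym a then l' else l'')\<rparr>"
| "exec (Assign i n ix f l') c c' \<longleftrightarrow>
     (\<exists>x y. scanned_args c n ix x \<and> f x = Some y \<and>
            c' = c\<lparr>label := l', tape := set_cell c i (Data y)\<rparr>)"
| "exec (Test n ix f l' l'') c c' \<longleftrightarrow>
     (\<exists>x. scanned_args c n ix x \<and>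
          (f x = Some [0] \<and> c' = c\<lparr>label := l'\<rparr> \<or>
           f x = Some [1] \<and> c' = c\<lparr>label := l''\<rparr>))"

definition succ ::
    "('s::zero_neq_one, 'y, 'g, 'l) gtm \<Rightarrow> ('y, 'g, 'l) config \<Rightarrow> ('y, 'g, 'l) config \<Rightarrow> bool"
where
  "succ N c c' \<longleftrightarrow> label c \<noteq> final N \<and> exec (Stm N (label c)) c c'"

datatype 'c computation = FinComp "'c list" | InfComp "nat \<Rightarrow> 'c"

fun computation_from ::
    "('s::zero_neq_one, 'y, 'g, 'l) gtm \<Rightarrow> ('y, 'g, 'l) config \<Rightarrow>
     ('y, 'g, 'l) config computation \<Rightarrow> bool" where
  "computation_from N c (FinComp cs) \<longleftrightarrow>
     cs \<noteq> [] \<and> hd cs = c \<and> (\<forall>i. Suc i < length cs \<longrightarrow> succ N (cs ! i) (cs ! Suc i))"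
| "computation_from N c (InfComp s) \<longleftrightarrow>
     s 0 = c \<and> (\<forall>i. succ N (s i) (s (Suc i)))"

fun maximal ::
    "('s::zero_neq_one, 'y, 'g, 'l) gtm \<Rightarrow> ('y, 'g, 'l) config computation \<Rightarrow> bool" where
  "maximal N (FinComp cs) \<longleftrightarrow> (\<nexists>c'. succ N (last cs) c')"
| "maximal N (InfComp s) \<longleftrightarrow> True"

text \<open>
  The result of an accepting configuration is read from cell \<open>0\<close> of the output
  tape, wherever its head stands.
\<close>

definition accepting_config ::
    "('s, 'y, 'g, 'l) gtm \<Rightarrow> ('y, 'g, 'l) config \<Rightarrow> 'y \<Rightarrow> bool" where
  "accepting_config N c y \<longleftrightarrow> label c = final N \<and> y \<in> spaces N 0 \<and> tape c 0 0 = Data y"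

fun accepting :: "('s, 'y, 'g, 'l) gtm \<Rightarrow> ('y, 'g, 'l) config computation \<Rightarrow> 'y \<Rightarrow> bool" where
  "accepting N (FinComp cs) y \<longleftrightarrow> accepting_config N (last cs) y"
| "accepting N (InfComp s) y \<longleftrightarrow> False"

definition IC :: "('s, 'y, 'g, 'l) gtm \<Rightarrow> 'y tuple \<Rightarrow> ('y, 'g, 'l) config" where
  "IC N x =
     \<lparr>label = init N,
      tape = (\<lambda>i z. if i \<in> {1..inputs N} \<and> z = 0 then Data (x i) else Sym (blank_sym N)),
      head = (\<lambda>_. 0)\<rparr>"

definition gtm_yields ::
    "('s::zero_neq_one, 'y, 'g, 'l) gtm \<Rightarrow> 'y tuple \<Rightarrow> 'y \<Rightarrow> bool" where
  "gtm_yields N x y \<longleftrightarrow>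
     x \<in> PiE {1..inputs N} (spaces N) \<and>
     (\<forall>C. computation_from N (IC N x) C \<and> maximal N C \<longrightarrow> (\<exists>y'. accepting N C y')) \<and>
     (\<exists>C. computation_from N (IC N x) C \<and> accepting N C y)"

text \<open>The partial function \<open>f\<^sub>N\<close>; see \<open>gtm_fun_eq_Some_iff\<close> below.\<close>

definition gtm_fun ::
    "('s::zero_neq_one, 'y, 'g, 'l) gtm \<Rightarrow> ('y tuple \<rightharpoonup> 'y)" where
  "gtm_fun N x = (if \<exists>y. gtm_yields N x y then Some (THE y. gtm_yields N x y) else None)"

lemma scanned_args_unique:
  assumes "scanned_args c n ix x" "scanned_args c n ix x'"
  shows "x = x'"
  using assms unfolding scanned_args_def
  by (intro extensionalityI[of x "{1..n}" x']) auto

lemma exec_deterministic: "exec s c c' \<Longrightarrow> exec s c c'' \<Longrightarrow> c' = c''"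
  by (cases s) (auto dest: scanned_args_unique)

lemma succ_deterministic: "succ N c c' \<Longrightarrow> succ N c c'' \<Longrightarrow> c' = c''"
  unfolding succ_def by (blast dest: exec_deterministic)

lemma computations_agree:
  assumes "computation_from N c (FinComp cs)" "computation_from N c (FinComp ds)"
    and "i < length cs" "i < length ds"
  shows "cs ! i = ds ! i"
  using assms(3,4)
proof (induction i)
  case 0
  then show ?case using assms(1,2) by (auto simp: hd_conv_nth)
next
  case (Suc i)
  then have "cs ! i = ds ! i" by simp
  moreover have "succ N (cs ! i) (cs ! Suc i)" "succ N (ds ! i) (ds ! Suc i)"
    using assms(1,2) Suc.prems by auto
  ultimately show ?case by (auto dest: succ_deterministic)
qed

lemma final_computations_length_le:
  assumes "computation_from N c (FinComp cs)" "computation_from N c (FinComp ds)"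
    and "label (last cs) = final N"
  shows "length ds \<le> length cs"
proof (rule ccontr)
  assume "\<not> length ds \<le> length cs"
  then have less: "length cs < length ds" by simp
  have "cs \<noteq> []" using assms(1) by simp
  then have eq: "Suc (length cs - 1) = length cs" by simp
  have "cs ! (length cs - 1) = ds ! (length cs - 1)"
    using computations_agree[OF assms(1,2)] less eq by simp
  then have "label (ds ! (length cs - 1)) = final N"
    using assms(3) \<open>cs \<noteq> []\<close> by (simp add: last_conv_nth)
  moreover have "succ N (ds ! (length cs - 1)) (ds ! length cs)"
    using assms(2) less eq by (metis computation_from.simps(1))
  ultimately show False by (simp add: succ_def)
qed

lemma gtm_yields_unique:
  assumes "gtm_yields N x y" "gtm_yields N x y'"
  shows "y = y'"
proof -
  from assms(1) obtain C where C: "computation_from N (IC N x) C" "accepting N C y"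
    unfolding gtm_yields_def by blast
  from assms(2) obtain D where D: "computation_from N (IC N x) D" "accepting N D y'"
    unfolding gtm_yields_def by blast
  obtain cs where cs: "C = FinComp cs" using C(2) by (cases C) auto
  obtain ds where ds: "D = FinComp ds" using D(2) by (cases D) auto
  have comp: "computation_from N (IC N x) (FinComp cs)" "computation_from N (IC N x) (FinComp ds)"
    using C D cs ds by auto
  have fin: "label (last cs) = final N" "label (last ds) = final N"
    using C D cs ds by (auto simp: accepting_config_def)
  have len: "length cs = length ds"
    using final_computations_length_le[OF comp fin(1)]
      final_computations_length_le[OF comp(2,1) fin(2)] by simp
  have "cs \<noteq> []" "ds \<noteq> []" using comp by auto
  then have "last cs = last ds"
    using computations_agree[OF comp, of "length cs - 1"] len by (simp add: last_conv_nth)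
  then show ?thesis using C D cs ds by (simp add: accepting_config_def)
qed

lemma gtm_fun_eq_Some_iff: "gtm_fun N x = Some y \<longleftrightarrow> gtm_yields N x y"
proof
  assume "gtm_fun N x = Some y"
  then show "gtm_yields N x y"
    unfolding gtm_fun_def by (auto split: if_splits intro: theI gtm_yields_unique)
next
  assume "gtm_yields N x y"
  then show "gtm_fun N x = Some y"
    unfolding gtm_fun_def by (auto intro!: the_equality intro: gtm_yields_unique)
qed

text \<open>
  The functions used in \<open>N\<close>, each with its arity, its argument spaces and its target
  space. A test is regarded as a partial function into the space of finite words.
\<close>

definition used_functions ::
    "('s, 's val, 'g, 'l) gtm \<Rightarrow>
     (nat \<times> (nat \<Rightarrow> 's val set) \<times> 's val set \<times> ('s val tuple \<rightharpoonup> 's val)) set" where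
  "used_functions N =
     {(n, \<lambda>j. spaces N (ix j), spaces N i, f) | n ix i f.
        \<exists>l \<in> labels N - {final N}. \<exists>l'. Stm N l = Assign i n ix f l'} \<union>
     {(n, \<lambda>j. spaces N (ix j), Words, \<lambda>x. map_option Word (f x)) | n ix f.
        \<exists>l \<in> labels N - {final N}. \<exists>l' l''. Stm N l = Test n ix f l' l''}"

end

theory Submission
  imports Defs
begin

text \<open>
  \<^bold>\<open>Continuity.\<close> An accepting computation is finite. Its control flow depends on the data only
  through the tests, and the result of a test is a point of a discrete space; hence all inputs
  close enough to a given one follow the same sequence of labels and head movements, and the
  content of each cell at a fixed time is a composition of continuous functions. This is an
  induction on the number of steps (\<open>near_step\<close>, \<open>continuous_gtm_fun\<close>).

  \<^bold>\<open>Computability.\<close> A cell may contain an infinite sequence, so a Type-2 machine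
  cannot carry out the steps of a generalized machine one after the other. Instead it works in
  stages. At stage \<open>T\<close> every value is replaced by a finite approximation: a list of its first
  letters together with a flag telling whether this is the whole value. With the input letters read
  so far, \<open>T\<close> steps of the generalized machine are evaluated from scratch, and each function used
  on the way is evaluated by running its Type-2 machine for \<open>T\<close> steps on approximate arguments,
  where that machine is halted as soon as it looks beyond the known part of an argument. A test that
  is not decided in this way holds up the stage. Two properties hold when \<open>N\<close> yields \<open>y\<close>: the
  approximation of the output obtained at any stage is a correct approximation of \<open>y\<close>
  (\<open>apx_run_sound\<close>, \<open>gresult_sound\<close>), and late stages are arbitrarily precise
  (\<open>apx_run_converges\<close>, \<open>gresult_converges\<close>), because the finitely many steps up to acceptance
  each use finitely much information. So the machine may write one further letter per stage whenever
  the stage knows one, and halt when a stage knows that the output is complete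
  (\<open>output_of_approximations\<close>).

  It remains to see that the map from the data of one stage to those of the next is performed by a
  Type-2 machine. Structured programs over four stacks of bits are compiled to flowcharts
  (\<open>reaches_runs\<close>). With binary trees written on a stack in prefix notation, they
  realize a class of functions on trees that is closed under composition, pairing, case distinction
  and bounded iteration (\<open>tree_rec_realizable\<close>). Coding numbers, pairs and lists as trees turns
  these closure properties into introduction rules for \<open>effective\<close> functions, by which the stage map
  is recognized as effective (\<open>effective_stage\<close>). The theorem \<open>online_machine\<close> wraps any effective
  map into a Type-2 machine that alternates between reading one letter of each input, applying the
  map, and writing at most one letter.
\<close>

section \<open>Continuity\<close>

text \<open>
  The accepting computation as a sequence of configurations indexed by time, the form used in the
  inductions on the number of steps.
\<close>

lemma gtm_yields_run:
  assumes "gtm_yields N x y"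
  obtains \<kappa> T where "\<kappa> 0 = IC N x" "\<And>t. t < T \<Longrightarrow> succ N (\<kappa> t) (\<kappa> (Suc t))"
    "accepting_config N (\<kappa> T) y"
proof -
  from assms obtain C where C: "computation_from N (IC N x) C" "accepting N C y"
    unfolding gtm_yields_def by blast
  then obtain cs where cs: "C = FinComp cs" by (cases C) auto
  show thesis
  proof (rule that[of "\<lambda>t. cs ! t" "length cs - 1"])
    show "cs ! 0 = IC N x" using C(1) cs by (auto simp: hd_conv_nth)
    show "succ N (cs ! t) (cs ! Suc t)" if "t < length cs - 1" for t
      using C(1) cs that by auto
    show "accepting_config N (cs ! (length cs - 1)) y"
      using C cs by (auto simp: last_conv_nth)
  qed
qed

lemma topspace_space_topology:
  assumes "A \<in> {Words, Seqs}"
  shows "topspace (space_topology A) = (A :: 's val set)"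
proof -
  have "Word [] \<in> (Words :: 's val set)" "Word [] \<notin> (Seqs :: 's val set)"
    by (auto simp: Words_def Seqs_def)
  then have "(Words :: 's val set) \<noteq> Seqs" by blast
  moreover have "(\<Union>u. cylinder u) = (Seqs :: 's val set)"
  proof
    have "cylinder [] = (Seqs :: 's val set)" by (auto simp: cylinder_def Seqs_def)
    then show "Seqs \<subseteq> (\<Union>u. cylinder u :: 's val set)" by blast
  qed (auto simp: cylinder_def Seqs_def)
  ultimately show ?thesis using assms by (auto simp: space_topology_def)
qed

text \<open>
  Continuity point by point, so that statements holding near a point can be combined by the rules
  for \<open>eventually\<close>.
\<close>

lemma continuous_map_eventually:
  assumes "\<And>x. x \<in> topspace X \<Longrightarrow> f x \<in> topspace Y"
    and "\<And>x V. x \<in> topspace X \<Longrightarrow> openin Y V \<Longrightarrow> f x \<in> V \<Longrightarrow> eventually (\<lambda>x'. f x' \<in> V) (nhdsin X x)"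
  shows "continuous_map X Y f"
  unfolding continuous_map_def
proof (intro conjI allI impI)
  show "f \<in> topspace X \<rightarrow> topspace Y" using assms(1) by blast
  fix V assume V: "openin Y V"
  show "openin X {x \<in> topspace X. f x \<in> V}"
  proof (subst openin_subopen, intro ballI)
    fix x assume x: "x \<in> {x \<in> topspace X. f x \<in> V}"
    then obtain U where U: "openin X U" "x \<in> U" "\<forall>x' \<in> U. f x' \<in> V"
      using assms(2)[OF _ V] by (auto simp: eventually_nhdsin)
    then show "\<exists>T. openin X T \<and> x \<in> T \<and> T \<subseteq> {x \<in> topspace X. f x \<in> V}"
      using openin_subset[OF U(1)] by blast
  qed
qed

text \<open>
  The arguments of a function come from different cells, each with its own neighbourhoods, so
  continuity is needed in terms of boxes. These suffice because the product is finite.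
\<close>

lemma continuous_pfun_box:
  assumes "continuous_pfun n D R f" "\<And>j. j \<in> {1..n} \<Longrightarrow> D j \<in> {Words, Seqs}" "f a = Some y" "openin (space_topology R) V" "y \<in> V"
  obtains U where "\<And>j. j \<in> {1..n} \<Longrightarrow> openin (space_topology (D j)) (U j) \<and> a j \<in> U j"
    "\<And>a' y'. f a' = Some y' \<Longrightarrow> (\<And>j. j \<in> {1..n} \<Longrightarrow> a' j \<in> U j) \<Longrightarrow> y' \<in> V"
proof -
  let ?X = "product_topology (\<lambda>j. space_topology (D j)) {1..n}"
  have dom: "dom f \<subseteq> PiE {1..n} D"
    and cont: "continuous_map (subtopology ?X (dom f)) (space_topology R) (\<lambda>x. the (f x))"
    using assms(1) by (auto simp: continuous_pfun_def)
  obtain W where W: "openin ?X W"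
    "{x \<in> topspace (subtopology ?X (dom f)). the (f x) \<in> V} = W \<inter> dom f"
    using openin_continuous_map_preimage[OF cont assms(4)] unfolding openin_subtopology by blast
  have a: "a \<in> dom f" "a \<in> PiE {1..n} D" using assms(3) dom by auto
  have "PiE {1..n} (\<lambda>j. topspace (space_topology (D j))) = PiE {1..n} D"
    using assms(2) by (intro PiE_cong topspace_space_topology) auto
  then have top: "topspace (subtopology ?X (dom f)) = dom f" using dom by auto
  have "a \<in> W" using W(2) a(1) assms(3,5) unfolding top by auto
  then obtain U where U: "\<forall>j \<in> {1..n}. openin (space_topology (D j)) (U j)" "a \<in> PiE {1..n} U"
    "PiE {1..n} U \<subseteq> W"
    using W(1) unfolding openin_product_topology_alt by blast
  show thesis
  proof (rule that[of U])
    show "openin (space_topology (D j)) (U j) \<and> a j \<in> U j" if "j \<in> {1..n}" for j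
      using U that by auto
    fix a' y' assume *: "f a' = Some y'" "\<And>j. j \<in> {1..n} \<Longrightarrow> a' j \<in> U j"
    then have "a' \<in> PiE {1..n} U" using dom by (auto simp: PiE_def)
    then have "a' \<in> W \<inter> dom f" using U(3) *(1) by auto
    then have "a' \<in> {x \<in> dom f. the (f x) \<in> V}" using W(2) unfolding top by blast
    then show "y' \<in> V" using *(1) by simp
  qed
qed

lemma exec_label_closed:
  "exec s c c' \<Longrightarrow> wf_stm N s \<Longrightarrow> label c' \<in> labels N"
  by (cases s) auto

text \<open>Everything of a configuration but its data.\<close>

definition same_control :: "('y, 'g, 'l) config \<Rightarrow> ('y, 'g, 'l) config \<Rightarrow> bool" where
  "same_control c d \<longleftrightarrow> label d = label c \<and> head d = head c \<and>
     (\<forall>i z g. tape d i z = Sym g \<longleftrightarrow> tape c i z = Sym g)"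

text \<open>
  In the application \<open>F\<close> is the neighbourhood filter of an input \<open>x\<^sub>0\<close>, and \<open>c\<close> and \<open>d x\<close> are the
  configurations reached from \<open>x\<^sub>0\<close> and from \<open>x\<close> after the same number of steps: the content of each
  cell is continuous at \<open>x\<^sub>0\<close>.
\<close>

definition data_near :: "('s::{finite,zero_neq_one}, 's val, 'g, 'l) gtm \<Rightarrow> 'x filter \<Rightarrow>
    ('s val, 'g, 'l) config \<Rightarrow> ('x \<Rightarrow> ('s val, 'g, 'l) config) \<Rightarrow> bool" where
  "data_near N F c d \<longleftrightarrow> (\<forall>i \<le> maxtape N. \<forall>z v V.
     tape c i z = Data v \<longrightarrow> openin (space_topology (spaces N i)) V \<longrightarrow> v \<in> V \<longrightarrow>
     eventually (\<lambda>x. \<exists>v' \<in> V. tape (d x) i z = Data v') F)"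

lemma data_nearI:
  assumes "\<And>i z v V. i \<le> maxtape N \<Longrightarrow> tape c i z = Data v \<Longrightarrow>
     openin (space_topology (spaces N i)) V \<Longrightarrow> v \<in> V \<Longrightarrow>
     eventually (\<lambda>x. \<exists>v' \<in> V. tape (d x) i z = Data v') F"
  shows "data_near N F c d"
  using assms by (auto simp: data_near_def)

lemma data_nearD:
  assumes "data_near N F c d" "i \<le> maxtape N" "tape c i z = Data v"
     "openin (space_topology (spaces N i)) V" "v \<in> V"
  shows "eventually (\<lambda>x. \<exists>v' \<in> V. tape (d x) i z = Data v') F"
  using assms by (auto simp: data_near_def)

lemma call_near:
  assumes near: "data_near N F c d" "eventually (\<lambda>x. same_control c (d x)) F"
    and sp: "\<forall>i \<le> maxtape N. spaces N i \<in> {Words, Seqs}"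
    and cont: "continuous_pfun n (\<lambda>j. spaces N (ix j)) R f" "\<forall>j \<in> {1..n}. ix j \<le> maxtape N"
    and call: "scanned_args c n ix a" "f a = Some y"
    and V: "openin (space_topology R) V" "y \<in> V"
  shows "eventually (\<lambda>x. \<forall>a' y'. scanned_args (d x) n ix a' \<longrightarrow> f a' = Some y' \<longrightarrow> y' \<in> V) F"
proof -
  obtain U where U: "\<And>j. j \<in> {1..n} \<Longrightarrow> openin (space_topology (spaces N (ix j))) (U j) \<and> a j \<in> U j"
    "\<And>a' y'. f a' = Some y' \<Longrightarrow> (\<And>j. j \<in> {1..n} \<Longrightarrow> a' j \<in> U j) \<Longrightarrow> y' \<in> V"
    using continuous_pfun_box[OF cont(1) _ call(2) V] sp cont(2) by blast
  have "eventually (\<lambda>x. \<exists>v' \<in> U j. tape (d x) (ix j) (head c (ix j)) = Data v') F" if "j \<in> {1..n}" for j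
    using U(1)[OF that] cont(2) that call(1)
    by (intro data_nearD[OF near(1)]) (auto simp: scanned_args_def scanned_def)
  then have "eventually (\<lambda>x. \<forall>j \<in> {1..n}. \<exists>v' \<in> U j. tape (d x) (ix j) (head c (ix j)) = Data v') F"
    by (intro eventually_ball_finite) auto
  with near(2) show ?thesis
  proof eventually_elim
    case (elim x)
    show ?case
    proof (intro allI impI)
      fix a' y' assume "scanned_args (d x) n ix a'" "f a' = Some y'"
      then show "y' \<in> V"
        using elim by (intro U(2)) (fastforce simp: scanned_args_def scanned_def same_control_def)+
    qed
  qed
qed

lemma near_set_cell:
  assumes "data_near N F c d" "eventually (\<lambda>x. same_control c (d x)) F"
    and "\<And>v' V. v = Data v' \<Longrightarrow> openin (space_topology (spaces N i)) V \<Longrightarrow> v' \<in> V \<Longrightarrow>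
      eventually (\<lambda>x. \<exists>u \<in> V. w x = Data u) F"
    and "eventually (\<lambda>x. d' x = (d x)\<lparr>label := l', tape := set_cell (d x) i (w x)\<rparr> \<and>
      (\<forall>g. w x = Sym g \<longleftrightarrow> v = Sym g)) F"
  shows "data_near N F (c\<lparr>label := l', tape := set_cell c i v\<rparr>) d' \<and>
    eventually (\<lambda>x. same_control (c\<lparr>label := l', tape := set_cell c i v\<rparr>) (d' x)) F"
proof
  show "data_near N F (c\<lparr>label := l', tape := set_cell c i v\<rparr>) d'"
  proof (rule data_nearI)
    fix j z u V
    assume *: "j \<le> maxtape N" "tape (c\<lparr>label := l', tape := set_cell c i v\<rparr>) j z = Data u"
      "openin (space_topology (spaces N j)) V" "u \<in> V"
    show "eventually (\<lambda>x. \<exists>v' \<in> V. tape (d' x) j z = Data v') F"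
    proof (cases "j = i \<and> z = head c i")
      case True
      then have "eventually (\<lambda>x. \<exists>u \<in> V. w x = Data u) F"
        using assms(3)[of u V] * by (auto simp: set_cell_def)
      with assms(2,4) show ?thesis
        by eventually_elim (use True in \<open>auto simp: set_cell_def same_control_def\<close>)
    next
      case False
      then have "eventually (\<lambda>x. \<exists>v' \<in> V. tape (d x) j z = Data v') F"
        using * by (intro data_nearD[OF assms(1)]) (auto simp: set_cell_def split: if_splits)
      with assms(2,4) show ?thesis
        by eventually_elim (use False in \<open>auto simp: set_cell_def same_control_def\<close>)
    qed
  qed
  from assms(2,4) show "eventually (\<lambda>x. same_control (c\<lparr>label := l', tape := set_cell c i v\<rparr>) (d' x)) F"
    by eventually_elim (auto simp: set_cell_def same_control_def)
qed

lemma near_move: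
  assumes "data_near N F c d" "eventually (\<lambda>x. same_control c (d x)) F"
    and "eventually (\<lambda>x. d' x = (d x)\<lparr>label := l', head := (head (d x))(i := head (d x) i + k)\<rparr>) F"
  shows "data_near N F (c\<lparr>label := l', head := (head c)(i := head c i + k)\<rparr>) d' \<and>
    eventually (\<lambda>x. same_control (c\<lparr>label := l', head := (head c)(i := head c i + k)\<rparr>) (d' x)) F"
proof
  show "data_near N F (c\<lparr>label := l', head := (head c)(i := head c i + k)\<rparr>) d'"
  proof (rule data_nearI)
    fix j z u V
    assume *: "j \<le> maxtape N" "tape (c\<lparr>label := l', head := (head c)(i := head c i + k)\<rparr>) j z = Data u"
      "openin (space_topology (spaces N j)) V" "u \<in> V"
    have "eventually (\<lambda>x. \<exists>v' \<in> V. tape (d x) j z = Data v') F"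
      using * by (intro data_nearD[OF assms(1)]) auto
    with assms(3) show "eventually (\<lambda>x. \<exists>v' \<in> V. tape (d' x) j z = Data v') F"
      by eventually_elim auto
  qed
  from assms(2,3) show "eventually (\<lambda>x. same_control
      (c\<lparr>label := l', head := (head c)(i := head c i + k)\<rparr>) (d' x)) F"
    by eventually_elim (auto simp: same_control_def)
qed

lemma near_relabel:
  assumes "data_near N F c d" "eventually (\<lambda>x. same_control c (d x)) F"
    and "eventually (\<lambda>x. d' x = (d x)\<lparr>label := l'\<rparr>) F"
  shows "data_near N F (c\<lparr>label := l'\<rparr>) d' \<and> eventually (\<lambda>x. same_control (c\<lparr>label := l'\<rparr>) (d' x)) F"
proof -
  show ?thesis using near_move[OF assms(1,2), where d' = d' and l' = l' and i = 0 and k = 0] assms(3) by simp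
qed

text \<open>
  For a test the set consisting of the single word \<open>[b]\<close> is open, so nearby computations take the
  same branch; for an assignment the new content is continuous as the composition of a continuous
  function with continuous arguments.
\<close>

lemma near_step:
  assumes "wf_gtm N" and used: "\<forall>(n, D, R, f) \<in> used_functions N. continuous_pfun n D R f"
    and sp: "\<forall>i \<le> maxtape N. spaces N i \<in> {Words, Seqs}"
    and near: "data_near N F c d" "eventually (\<lambda>x. same_control c (d x)) F"
    and c: "label c \<in> labels N" "succ N c c'"
    and d: "eventually (\<lambda>x. succ N (d x) (d' x)) F"
  shows "data_near N F c' d' \<and> eventually (\<lambda>x. same_control c' (d' x)) F"
proof -
  have l: "label c \<in> labels N - {final N}" and exec: "exec (Stm N (label c)) c c'"
    using c by (auto simp: succ_def)
  have wfs: "wf_stm N (Stm N (label c))" using l assms(1) by (auto simp: wf_gtm_def)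
  from near(2) d have ev: "eventually (\<lambda>x. same_control c (d x) \<and> exec (Stm N (label c)) (d x) (d' x)) F"
    by eventually_elim (auto simp: succ_def same_control_def)
  show ?thesis
  proof (cases "Stm N (label c)")
    case (Right i l')
    have "eventually (\<lambda>x. d' x = (d x)\<lparr>label := l', head := (head (d x))(i := head (d x) i + 1)\<rparr>) F"
      using ev by eventually_elim (simp add: Right)
    from near_move[OF near this] show ?thesis using exec by (simp add: Right)
  next
    case (Left i l')
    have "eventually (\<lambda>x. d' x = (d x)\<lparr>label := l', head := (head (d x))(i := head (d x) i + (- 1))\<rparr>) F"
      using ev by eventually_elim (simp add: Left)
    from near_move[OF near this] show ?thesis using exec by (simp add: Left)
  next
    case (Write i a l')
    have "eventually (\<lambda>x. d' x = (d x)\<lparr>label := l', tape := set_cell (d x) i (Sym a)\<rparr> \<and>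
        (\<forall>g. Sym a = Sym g \<longleftrightarrow> Sym a = Sym g)) F"
      using ev by eventually_elim (simp add: Write)
    from near_set_cell[OF near _ this] show ?thesis using exec by (simp add: Write)
  next
    case (IfSym i a l' l'')
    have "eventually (\<lambda>x. d' x = (d x)\<lparr>label := if scanned c i = Sym a then l' else l''\<rparr>) F"
      using ev by eventually_elim (auto simp: IfSym scanned_def same_control_def)
    from near_relabel[OF near this] show ?thesis using exec by (simp add: IfSym)
  next
    case (Assign i n ix f l')
    obtain a y where a: "scanned_args c n ix a" "f a = Some y"
      "c' = c\<lparr>label := l', tape := set_cell c i (Data y)\<rparr>" using exec Assign by auto
    have ix: "\<forall>j \<in> {1..n}. ix j \<le> maxtape N" using wfs Assign by auto
    have "(n, \<lambda>j. spaces N (ix j), spaces N i, f) \<in> used_functions N"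
      using l Assign unfolding used_functions_def by blast
    then have cont: "continuous_pfun n (\<lambda>j. spaces N (ix j)) (spaces N i) f" using used by blast
    define w where "w x = scanned (d' x) i" for x
    have w: "eventually (\<lambda>x. \<exists>a' y'. scanned_args (d x) n ix a' \<and> f a' = Some y' \<and> w x = Data y' \<and>
        d' x = (d x)\<lparr>label := l', tape := set_cell (d x) i (Data y')\<rparr>) F"
      using ev by eventually_elim (auto simp: Assign w_def scanned_def set_cell_def)
    have "eventually (\<lambda>x. d' x = (d x)\<lparr>label := l', tape := set_cell (d x) i (w x)\<rparr> \<and>
        (\<forall>g. w x = Sym g \<longleftrightarrow> Data y = Sym g)) F"
      using w by eventually_elim auto
    moreover have "eventually (\<lambda>x. \<exists>u \<in> V. w x = Data u) F"
      if "openin (space_topology (spaces N i)) V" "y \<in> V" for V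
      using w call_near[OF near sp cont ix a(1,2) that] by eventually_elim blast
    ultimately show ?thesis
      unfolding a(3) by (intro near_set_cell[OF near]) auto
  next
    case (Test n ix f l' l'')
    obtain a b where a: "scanned_args c n ix a" "f a = Some [b]"
      "b = 0 \<and> c' = c\<lparr>label := l'\<rparr> \<or> b = 1 \<and> c' = c\<lparr>label := l''\<rparr>"
      using exec Test by auto
    have ix: "\<forall>j \<in> {1..n}. ix j \<le> maxtape N" using wfs Test by auto
    have "(n, \<lambda>j. spaces N (ix j), Words, \<lambda>x. map_option Word (f x)) \<in> used_functions N"
      using l Test unfolding used_functions_def by blast
    then have cont: "continuous_pfun n (\<lambda>j. spaces N (ix j)) Words (\<lambda>x. map_option Word (f x))"
      using used by blast
    have op: "openin (space_topology Words) {Word [b]}"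
      by (simp add: space_topology_def Words_def)
    have "eventually (\<lambda>x. \<forall>a' y'. scanned_args (d x) n ix a' \<longrightarrow>
        map_option Word (f a') = Some y' \<longrightarrow> y' \<in> {Word [b]}) F"
      by (rule call_near[OF near sp cont ix a(1) _ op]) (simp_all add: a(2))
    then have "eventually (\<lambda>x. \<forall>a' y'. scanned_args (d x) n ix a' \<longrightarrow> f a' = Some y' \<longrightarrow> y' = [b]) F"
      by (rule eventually_mono) auto
    with ev have "eventually (\<lambda>x. d' x = (d x)\<lparr>label := label c'\<rparr>) F"
      by eventually_elim (use a(3) in \<open>fastforce simp: Test\<close>)
    from near_relabel[OF near this] show ?thesis using a(3) by auto
  qed
qed

text \<open>
  Inputs near \<open>x0\<close> accept at the same time as \<open>x0\<close>, since they run through the same labels.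
\<close>

theorem continuous_gtm_fun:
  fixes N :: "('s::{finite, zero_neq_one}, 's val, 'g, 'l) gtm"
  assumes "wf_gtm N" and sp: "\<forall>i \<le> maxtape N. spaces N i \<in> {Words, Seqs}"
    and used: "\<forall>(n, D, R, f) \<in> used_functions N. continuous_pfun n D R f"
  shows "continuous_pfun (inputs N) (spaces N) (spaces N 0) (gtm_fun N)"
proof -
  let ?X = "product_topology (\<lambda>j. space_topology (spaces N j)) {1..inputs N}"
  define Z where "Z = subtopology ?X (dom (gtm_fun N))"
  have inputs_le: "inputs N \<le> maxtape N" using assms(1) by (simp add: wf_gtm_def)
  have dom: "dom (gtm_fun N) \<subseteq> PiE {1..inputs N} (spaces N)"
    using gtm_fun_eq_Some_iff[of N] unfolding gtm_yields_def by blast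
  have "PiE {1..inputs N} (\<lambda>j. topspace (space_topology (spaces N j))) = PiE {1..inputs N} (spaces N)"
    using sp inputs_le by (intro PiE_cong topspace_space_topology) auto
  then have Z: "topspace Z = dom (gtm_fun N)" using dom by (auto simp: Z_def)
  have "\<exists>\<kappa> T. x \<in> dom (gtm_fun N) \<longrightarrow> \<kappa> 0 = IC N x \<and> (\<forall>t<T. succ N (\<kappa> t) (\<kappa> (Suc t))) \<and>
      accepting_config N (\<kappa> T) (the (gtm_fun N x))" for x
    using gtm_yields_run[of N x] by (metis domIff gtm_fun_eq_Some_iff option.collapse)
  then obtain \<kappa> T where \<kappa>: "\<And>x. x \<in> dom (gtm_fun N) \<Longrightarrow> \<kappa> x 0 = IC N x"
    "\<And>x t. x \<in> dom (gtm_fun N) \<Longrightarrow> t < T x \<Longrightarrow> succ N (\<kappa> x t) (\<kappa> x (Suc t))"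
    "\<And>x. x \<in> dom (gtm_fun N) \<Longrightarrow> accepting_config N (\<kappa> x (T x)) (the (gtm_fun N x))"
    by metis
  have "continuous_map Z (space_topology (spaces N 0)) (\<lambda>x. the (gtm_fun N x))"
  proof (rule continuous_map_eventually)
    fix x assume "x \<in> topspace Z"
    then show "the (gtm_fun N x) \<in> topspace (space_topology (spaces N 0))"
      using \<kappa>(3) Z sp topspace_space_topology[of "spaces N 0"] by (auto simp: accepting_config_def)
  next
    fix x0 V
    assume x0: "x0 \<in> topspace Z" and V: "openin (space_topology (spaces N 0)) V" "the (gtm_fun N x0) \<in> V"
    define F where "F = nhdsin Z x0"
    have x0': "x0 \<in> dom (gtm_fun N)" using x0 Z by simp
    have F_dom: "eventually (\<lambda>x. x \<in> dom (gtm_fun N)) F"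
      unfolding F_def eventually_nhdsin using Z x0 openin_topspace[of Z] by blast
    have "data_near N F (\<kappa> x0 t) (\<lambda>x. \<kappa> x t) \<and> eventually (\<lambda>x. same_control (\<kappa> x0 t) (\<kappa> x t)) F \<and>
        eventually (\<lambda>x. t \<le> T x) F \<and> label (\<kappa> x0 t) \<in> labels N" if "t \<le> T x0" for t
      using that
    proof (induction t)
      case 0
      have "data_near N F (\<kappa> x0 0) (\<lambda>x. \<kappa> x 0)"
      proof (rule data_nearI)
        fix i z v W
        assume "i \<le> maxtape N" "tape (\<kappa> x0 0) i z = Data v"
          and W: "openin (space_topology (spaces N i)) W" "v \<in> W"
        then have i: "i \<in> {1..inputs N}" "z = 0" "v = x0 i"
          using \<kappa>(1)[OF x0'] by (auto simp: IC_def split: if_splits)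
        have "continuous_map Z (space_topology (spaces N i)) (\<lambda>x. x i)"
          unfolding Z_def
          using continuous_map_product_projection[OF i(1), of "\<lambda>j. space_topology (spaces N j)"]
          by (rule continuous_map_from_subtopology)
        then have "openin Z {x \<in> topspace Z. x i \<in> W}"
          using W(1) by (rule openin_continuous_map_preimage)
        then have "eventually (\<lambda>x. x i \<in> W) F"
          unfolding F_def eventually_nhdsin using x0 W(2) i(3) by blast
        with F_dom show "eventually (\<lambda>x. \<exists>v' \<in> W. tape (\<kappa> x 0) i z = Data v') F"
          by eventually_elim (use \<kappa>(1) i in \<open>auto simp: IC_def\<close>)
      qed
      moreover have "eventually (\<lambda>x. same_control (\<kappa> x0 0) (\<kappa> x 0)) F"
        using F_dom by eventually_elim (use \<kappa>(1) x0' in \<open>auto simp: same_control_def IC_def\<close>)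
      ultimately show ?case
        using \<kappa>(1)[OF x0'] assms(1) by (simp add: IC_def wf_gtm_def)
    next
      case (Suc t)
      have step: "succ N (\<kappa> x0 t) (\<kappa> x0 (Suc t))" using \<kappa>(2)[OF x0'] Suc.prems by simp
      have IH: "data_near N F (\<kappa> x0 t) (\<lambda>x. \<kappa> x t)" "eventually (\<lambda>x. same_control (\<kappa> x0 t) (\<kappa> x t)) F"
        "eventually (\<lambda>x. t \<le> T x) F" "label (\<kappa> x0 t) \<in> labels N" using Suc by auto
      have later: "eventually (\<lambda>x. Suc t \<le> T x \<and> succ N (\<kappa> x t) (\<kappa> x (Suc t))) F"
        using F_dom IH(2,3)
      proof eventually_elim
        case (elim x)
        \<comment> \<open>The computation from \<open>x\<close> cannot end before the one from \<open>x0\<close>, having the same label.\<close>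
        have "label (\<kappa> x t) \<noteq> final N" using elim(2) step by (simp add: same_control_def succ_def)
        then have "t \<noteq> T x" using \<kappa>(3)[OF elim(1)] by (auto simp: accepting_config_def)
        then show ?case using elim \<kappa>(2)[OF elim(1), of t] by simp
      qed
      then have "eventually (\<lambda>x. succ N (\<kappa> x t) (\<kappa> x (Suc t))) F" "eventually (\<lambda>x. Suc t \<le> T x) F"
        by (auto elim: eventually_mono)
      moreover have "label (\<kappa> x0 (Suc t)) \<in> labels N"
        using step IH(4) assms(1) exec_label_closed by (fastforce simp: succ_def wf_gtm_def)
      ultimately show ?case
        using near_step[OF assms(1) used sp IH(1,2,4) step] by simp
    qed
    from this[of "T x0"] have *: "data_near N F (\<kappa> x0 (T x0)) (\<lambda>x. \<kappa> x (T x0))"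
      "eventually (\<lambda>x. same_control (\<kappa> x0 (T x0)) (\<kappa> x (T x0))) F" "eventually (\<lambda>x. T x0 \<le> T x) F" by auto
    have "eventually (\<lambda>x. \<exists>v' \<in> V. tape (\<kappa> x (T x0)) 0 0 = Data v') F"
      using \<kappa>(3)[OF x0'] by (intro data_nearD[OF *(1) _ _ V]) (auto simp: accepting_config_def)
    with F_dom *(2,3) show "eventually (\<lambda>x. the (gtm_fun N x) \<in> V) (nhdsin Z x0)"
      unfolding F_def[symmetric]
    proof eventually_elim
      case (elim x)
      have "label (\<kappa> x (T x0)) = final N"
        using elim(2) \<kappa>(3)[OF x0'] by (auto simp: same_control_def accepting_config_def)
      then have "T x = T x0" using \<kappa>(2)[OF elim(1), of "T x0"] elim(3) by (fastforce simp: succ_def)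
      then show ?case using \<kappa>(3)[OF elim(1)] elim(4) by (auto simp: accepting_config_def)
    qed
  qed
  then show ?thesis using dom by (simp add: continuous_pfun_def Z_def)
qed

section \<open>Stack programs and their compilation to Type-2 machines\<close>

text \<open>
  Values are kept on \<open>SA\<close>; \<open>SB\<close> and \<open>SC\<close> are auxiliary, and \<open>SK\<close> is a counter in unary. All stacks
  other than \<open>SA\<close> are empty between the operations on values.
\<close>

datatype stk = SA | SB | SC | SK

datatype 's prog =
    Nop
  | Push stk bool
  | Pop stk
  | Advance nat
  | Emit 's
  | Then "'s prog" "'s prog" (infixr \<open>;;\<close> 60)
  | IfTop stk "bool option" "'s prog" "'s prog"
  | IfLetter nat 's "'s prog" "'s prog"
  | Until stk "bool option" "'s prog"

text \<open>
  The stacks, the number of letters read from each input, and the output.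
\<close>

type_synonym 's pstate = "(stk \<Rightarrow> bool list) \<times> (nat \<Rightarrow> nat) \<times> 's list"

definition top_of :: "bool list \<Rightarrow> bool option" where
  "top_of s = (case s of [] \<Rightarrow> None | b # _ \<Rightarrow> Some b)"

lemma top_of_simps [simp]: "top_of [] = None" "top_of (b # s) = Some b"
  by (simp_all add: top_of_def)

text \<open>
  The top element \<open>None\<close> stands for the empty stack. \<open>Until k v c\<close> repeats \<open>c\<close> until the top of \<open>k\<close>
  is \<open>v\<close>.
\<close>

inductive runs :: "'s val tuple \<Rightarrow> 's prog \<Rightarrow> 's pstate \<Rightarrow> 's pstate \<Rightarrow> bool" for x where
  Nop: "runs x Nop st st"
| Push: "runs x (Push k b) (S, r, w) (S(k := b # S k), r, w)"
| Pop: "S k = b # s \<Longrightarrow> runs x (Pop k) (S, r, w) (S(k := s), r, w)"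
| Advance: "runs x (Advance j) (S, r, w) (S, r(j := Suc (r j)), w)"
| Emit: "runs x (Emit a) (S, r, w) (S, r, w @ [a])"
| Then: "runs x c st st' \<Longrightarrow> runs x d st' st'' \<Longrightarrow> runs x (c ;; d) st st''"
| IfTop_yes: "top_of (S k) = v \<Longrightarrow> runs x c (S, r, w) st' \<Longrightarrow> runs x (IfTop k v c d) (S, r, w) st'"
| IfTop_no: "top_of (S k) \<noteq> v \<Longrightarrow> runs x d (S, r, w) st' \<Longrightarrow> runs x (IfTop k v c d) (S, r, w) st'"
| IfLetter_yes: "input_tape (x j) (int (r j)) = Letter a \<Longrightarrow> runs x c (S, r, w) st' \<Longrightarrow>
    runs x (IfLetter j a c d) (S, r, w) st'"
| IfLetter_no: "input_tape (x j) (int (r j)) \<noteq> Letter a \<Longrightarrow> runs x d (S, r, w) st' \<Longrightarrow>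
    runs x (IfLetter j a c d) (S, r, w) st'"
| Until_stop: "top_of (S k) = v \<Longrightarrow> runs x (Until k v c) (S, r, w) (S, r, w)"
| Until_go: "top_of (S k) \<noteq> v \<Longrightarrow> runs x c (S, r, w) st' \<Longrightarrow> runs x (Until k v c) st' st'' \<Longrightarrow>
    runs x (Until k v c) (S, r, w) st''"

fun stk_index :: "stk \<Rightarrow> nat" where
  "stk_index SA = 1" | "stk_index SB = 2" | "stk_index SC = 3" | "stk_index SK = 4"

definition stk_of :: "nat \<Rightarrow> stk" where
  "stk_of i = (if i = 1 then SA else if i = 2 then SB else if i = 3 then SC else SK)"

lemma stk_of_index [simp]: "stk_of (stk_index k) = k"
  by (cases k) (simp_all add: stk_of_def)

lemma stk_index_range: "stk_index k \<in> {1..4}"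
  by (cases k) simp_all

lemma stk_index_eq [simp]: "stk_index k = stk_index k' \<longleftrightarrow> k = k'"
  by (metis stk_of_index)

lemma stk_index_bounds [simp]: "Suc 0 \<le> stk_index k" "stk_index k \<le> 4" "stk_index k \<noteq> 0"
  "Suc 0 \<le> n + stk_index k"
  using stk_index_range[of k] by auto

lemma stack_tape_index_cases:
  assumes "i \<in> {n + 1..n + 4}"
  obtains k where "i = n + stk_index k"
proof -
  have "i - n = 1 \<or> i - n = 2 \<or> i - n = 3 \<or> i - n = 4" using assms by auto
  then have "i - n = stk_index (stk_of (i - n))" by (auto simp: stk_of_def)
  then show thesis using that[of "stk_of (i - n)"] assms by auto
qed

fun bit_symbol :: "bool option \<Rightarrow> 's symbol" where
  "bit_symbol None = blank"
| "bit_symbol (Some False) = Aux 1"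
| "bit_symbol (Some True) = Aux 2"

lemma bit_symbol_eq [simp]: "bit_symbol u = bit_symbol v \<longleftrightarrow> u = v"
  by (cases u rule: bit_symbol.cases; cases v rule: bit_symbol.cases) auto

fun prog_size :: "'s prog \<Rightarrow> nat" where
  "prog_size Nop = 1"
| "prog_size (Push k b) = 2"
| "prog_size (Pop k) = 2"
| "prog_size (Advance j) = 1"
| "prog_size (Emit a) = 1"
| "prog_size (c ;; d) = prog_size c + prog_size d"
| "prog_size (IfTop k v c d) = 1 + prog_size c + prog_size d"
| "prog_size (IfLetter j a c d) = 1 + prog_size c + prog_size d"
| "prog_size (Until k v c) = 1 + prog_size c"

text \<open>
  \<open>code n c s e l\<close> is the statement at label \<open>l\<close> of the flowchart of \<open>c\<close> for a machine with \<open>n\<close>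
  inputs, where \<open>c\<close> occupies the labels from \<open>s\<close> on and continues at label \<open>e\<close>.
\<close>

fun code :: "nat \<Rightarrow> 's prog \<Rightarrow> nat \<Rightarrow> nat \<Rightarrow> nat \<Rightarrow> 's t2_stm" where
  "code n Nop s e l = T2_If (n + 1) blank e e"
| "code n (Push k b) s e l =
     (if l = s then T2_Right (n + stk_index k) (s + 1)
      else T2_Write (n + stk_index k) (bit_symbol (Some b)) e)"
| "code n (Pop k) s e l =
     (if l = s then T2_Write (n + stk_index k) blank (s + 1)
      else T2_Left (n + stk_index k) e)"
| "code n (Advance j) s e l = T2_Right j e"
| "code n (Emit a) s e l = T2_Out a e"
| "code n (c ;; d) s e l =
     (if l < s + prog_size c then code n c s (s + prog_size c) l
      else code n d (s + prog_size c) e l)"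
| "code n (IfTop k v c d) s e l =
     (if l = s then T2_If (n + stk_index k) (bit_symbol v) (s + 1) (s + 1 + prog_size c)
      else if l < s + 1 + prog_size c then code n c (s + 1) e l
      else code n d (s + 1 + prog_size c) e l)"
| "code n (IfLetter j a c d) s e l =
     (if l = s then T2_If j (Letter a) (s + 1) (s + 1 + prog_size c)
      else if l < s + 1 + prog_size c then code n c (s + 1) e l
      else code n d (s + 1 + prog_size c) e l)"
| "code n (Until k v c) s e l =
     (if l = s then T2_If (n + stk_index k) (bit_symbol v) e (s + 1)
      else code n c (s + 1) s l)"

fun reads_within :: "nat \<Rightarrow> 's prog \<Rightarrow> bool" where
  "reads_within n (Advance j) \<longleftrightarrow> j \<in> {1..n}"
| "reads_within n (c ;; d) \<longleftrightarrow> reads_within n c \<and> reads_within n d"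
| "reads_within n (IfTop k v c d) \<longleftrightarrow> reads_within n c \<and> reads_within n d"
| "reads_within n (IfLetter j a c d) \<longleftrightarrow> j \<in> {1..n} \<and> reads_within n c \<and> reads_within n d"
| "reads_within n (Until k v c) \<longleftrightarrow> reads_within n c"
| "reads_within n _ \<longleftrightarrow> True"

lemma prog_size_pos [simp]: "0 < prog_size c"
  by (induction c) auto

text \<open>
  The bottom element stands in cell \<open>1\<close>, so that the head position is the height of the stack, and the
  empty stack is the tape that a machine is started with.
\<close>

definition stack_tape :: "bool list \<Rightarrow> int \<Rightarrow> 's symbol" where
  "stack_tape s z =
     (if 1 \<le> z \<and> z \<le> int (length s) then bit_symbol (Some (s ! nat (int (length s) - z))) else blank)"

lemma stack_tape_top: "stack_tape s (int (length s)) = bit_symbol (top_of s)"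
  by (cases s) (auto simp: stack_tape_def)

lemma stack_tape_push:
  "(stack_tape s)(int (length s) + 1 := bit_symbol (Some b)) = stack_tape (b # s)"
proof
  fix z
  show "((stack_tape s)(int (length s) + 1 := bit_symbol (Some b))) z = stack_tape (b # s) z"
  proof (cases "1 \<le> z \<and> z \<le> int (length s)")
    case True
    then have "nat (int (length (b # s)) - z) = Suc (nat (int (length s) - z))"
      by (simp add: nat_eq_iff)
    then show ?thesis using True by (simp add: stack_tape_def)
  qed (auto simp: stack_tape_def)
qed

lemma stack_tape_pop: "(stack_tape (b # s))(1 + int (length s) := blank) = stack_tape s"
proof -
  have "(stack_tape s)(int (length s) + 1 := blank) = stack_tape s"
    by (auto simp: stack_tape_def)
  then show ?thesis by (metis stack_tape_push fun_upd_upd add.commute)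
qed

definition prog_config :: "nat \<Rightarrow> 's val tuple \<Rightarrow> nat \<Rightarrow> 's pstate \<Rightarrow> 's t2_config" where
  "prog_config n x l st = (case st of (S, r, w) \<Rightarrow>
     \<lparr>t2_label = l,
      t2_tape = (\<lambda>i. if i \<in> {1..n} then input_tape (x i)
                     else if i \<in> {n + 1..n + 4} then stack_tape (S (stk_of (i - n)))
                     else (\<lambda>_. blank)),
      t2_head = (\<lambda>i. if i \<in> {1..n} then int (r i)
                     else if i \<in> {n + 1..n + 4} then int (length (S (stk_of (i - n)))) else 0),
      t2_out = w\<rparr>)"

lemma prog_config_sel:
  "t2_label (prog_config n x l st) = l"
  "t2_out (prog_config n x l (S, r, w)) = w"
  "j \<in> {1..n} \<Longrightarrow> t2_tape (prog_config n x l (S, r, w)) j = input_tape (x j)"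
  "j \<in> {1..n} \<Longrightarrow> t2_head (prog_config n x l (S, r, w)) j = int (r j)"
  "t2_tape (prog_config n x l (S, r, w)) (n + stk_index k) = stack_tape (S k)"
  "t2_head (prog_config n x l (S, r, w)) (n + stk_index k) = int (length (S k))"
  by (auto simp: prog_config_def split: prod.split)

text \<open>
  At least one step is demanded, so that a machine that passes through infinitely many
  configurations in this sense is known to run forever.
\<close>

definition reaches :: "'s t2_machine \<Rightarrow> 's t2_config \<Rightarrow> 's t2_config \<Rightarrow> bool" where
  "reaches M c c' \<longleftrightarrow> (\<exists>t>0. (t2_step M ^^ t) c = c')"

lemma reaches_step: "t2_step M c = c' \<Longrightarrow> reaches M c c'"
  unfolding reaches_def by (rule exI[of _ 1]) simp

lemma reaches_trans: "reaches M c c' \<Longrightarrow> reaches M c' c'' \<Longrightarrow> reaches M c c''"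
proof -
  assume "reaches M c c'" "reaches M c' c''"
  then obtain t u where "0 < t" "(t2_step M ^^ t) c = c'" "0 < u" "(t2_step M ^^ u) c' = c''"
    unfolding reaches_def by blast
  then have "0 < u + t" "(t2_step M ^^ (u + t)) c = c''" by (simp_all add: funpow_add)
  then show "reaches M c c''" unfolding reaches_def by blast
qed

lemma t2_config_eqI:
  fixes c d :: "'s t2_config"
  assumes "t2_label c = t2_label d" "t2_tape c = t2_tape d" "t2_head c = t2_head d"
    "t2_out c = t2_out d"
  shows "c = d"
  using assms by simp

text \<open>
  The two labels differ because the equations are applied across a step.
\<close>

lemma prog_config_set_stack:
  "(t2_tape (prog_config n x l (S, r, w)))(n + stk_index k := stack_tape s) =
     t2_tape (prog_config n x l' (S(k := s), r, w))"
  "(t2_head (prog_config n x l (S, r, w)))(n + stk_index k := int (length s)) =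
     t2_head (prog_config n x l' (S(k := s), r, w))"
proof -
  have "((t2_tape (prog_config n x l (S, r, w)))(n + stk_index k := stack_tape s)) i =
      t2_tape (prog_config n x l' (S(k := s), r, w)) i \<and>
    ((t2_head (prog_config n x l (S, r, w)))(n + stk_index k := int (length s))) i =
      t2_head (prog_config n x l' (S(k := s), r, w)) i" for i
  proof (cases "i \<in> {n + 1..n + 4}")
    case True
    then obtain k' where "i = n + stk_index k'" by (rule stack_tape_index_cases)
    then show ?thesis by (simp add: prog_config_def)
  next
    case False
    then have "i \<noteq> n + stk_index k" using stk_index_range[of k] by auto
    then show ?thesis using False by (auto simp: prog_config_def)
  qed
  then show "(t2_tape (prog_config n x l (S, r, w)))(n + stk_index k := stack_tape s) =
     t2_tape (prog_config n x l' (S(k := s), r, w))"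
    "(t2_head (prog_config n x l (S, r, w)))(n + stk_index k := int (length s)) =
     t2_head (prog_config n x l' (S(k := s), r, w))"
    by blast+
qed

lemma reaches_push:
  assumes "t2_stm M s = T2_Right (n + stk_index k) s'" "s \<noteq> t2_final M"
    and "t2_stm M s' = T2_Write (n + stk_index k) (bit_symbol (Some b)) e" "s' \<noteq> t2_final M"
  shows "reaches M (prog_config n x s (S, r, w)) (prog_config n x e (S(k := b # S k), r, w))"
proof -
  let ?c = "prog_config n x s (S, r, w)"
  have "(t2_step M ^^ 2) ?c = prog_config n x e (S(k := b # S k), r, w)"
  proof (rule t2_config_eqI)
    show "t2_tape ((t2_step M ^^ 2) ?c) = t2_tape (prog_config n x e (S(k := b # S k), r, w))"
      using assms
      by (simp add: stack_tape_push numeral_2_eq_2 t2_step_def prog_config_sel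
          prog_config_set_stack(1)[of n x s S r w k "b # S k" e, symmetric])
    show "t2_head ((t2_step M ^^ 2) ?c) = t2_head (prog_config n x e (S(k := b # S k), r, w))"
      using assms
      by (simp add: numeral_2_eq_2 t2_step_def prog_config_sel
          prog_config_set_stack(2)[of n x s S r w k "b # S k" e, symmetric] add.commute)
  qed (use assms in \<open>auto simp: numeral_2_eq_2 t2_step_def prog_config_sel\<close>)
  then show ?thesis unfolding reaches_def by (metis zero_less_numeral)
qed

lemma reaches_pop:
  assumes "t2_stm M s = T2_Write (n + stk_index k) blank s'" "s \<noteq> t2_final M"
    and "t2_stm M s' = T2_Left (n + stk_index k) e" "s' \<noteq> t2_final M"
    and "S k = b # st"
  shows "reaches M (prog_config n x s (S, r, w)) (prog_config n x e (S(k := st), r, w))"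
proof -
  let ?c = "prog_config n x s (S, r, w)"
  have "(t2_step M ^^ 2) ?c = prog_config n x e (S(k := st), r, w)"
  proof (rule t2_config_eqI)
    show "t2_tape ((t2_step M ^^ 2) ?c) = t2_tape (prog_config n x e (S(k := st), r, w))"
      using assms
      by (simp add: numeral_2_eq_2 t2_step_def prog_config_sel stack_tape_pop
          prog_config_set_stack(1)[of n x s S r w k st e, symmetric])
    show "t2_head ((t2_step M ^^ 2) ?c) = t2_head (prog_config n x e (S(k := st), r, w))"
      using assms
      by (simp add: numeral_2_eq_2 t2_step_def prog_config_sel
          prog_config_set_stack(2)[of n x s S r w k st e, symmetric])
  qed (use assms in \<open>auto simp: numeral_2_eq_2 t2_step_def prog_config_sel\<close>)
  then show ?thesis unfolding reaches_def by (metis zero_less_numeral)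
qed

lemma reaches_advance:
  assumes "t2_stm M s = T2_Right j e" "s \<noteq> t2_final M" "j \<in> {1..n}"
  shows "reaches M (prog_config n x s (S, r, w)) (prog_config n x e (S, r(j := Suc (r j)), w))"
  using assms by (intro reaches_step) (auto simp: t2_step_def prog_config_def fun_eq_iff)

lemma reaches_emit:
  assumes "t2_stm M s = T2_Out a e" "s \<noteq> t2_final M"
  shows "reaches M (prog_config n x s (S, r, w)) (prog_config n x e (S, r, w @ [a]))"
  using assms by (intro reaches_step) (auto simp: t2_step_def prog_config_def)

lemma reaches_if:
  assumes "t2_stm M s = T2_If i a l l'" "s \<noteq> t2_final M"
  shows "reaches M (prog_config n x s (S, r, w))
    (prog_config n x (if t2_tape (prog_config n x s (S, r, w)) i (t2_head (prog_config n x s (S, r, w)) i) = a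
       then l else l') (S, r, w))"
  using assms by (intro reaches_step) (auto simp: t2_step_def prog_config_def)

text \<open>
  \<open>M\<close> contains the flowchart of \<open>c\<close>, entered at \<open>s\<close> and left to \<open>e\<close>.
\<close>

definition carries :: "'s t2_machine \<Rightarrow> nat \<Rightarrow> 's prog \<Rightarrow> nat \<Rightarrow> nat \<Rightarrow> bool" where
  "carries M n c s e \<longleftrightarrow>
     (\<forall>l \<in> {s..<s + prog_size c}. t2_stm M l = code n c s e l \<and> l \<noteq> t2_final M)"

lemma carriesD:
  "carries M n c s e \<Longrightarrow> s \<le> l \<Longrightarrow> l < s + prog_size c \<Longrightarrow>
     t2_stm M l = code n c s e l \<and> l \<noteq> t2_final M"
  by (auto simp: carries_def)

lemma carries_Then:
  assumes "carries M n (c ;; d) s e"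
  shows "carries M n c s (s + prog_size c)" "carries M n d (s + prog_size c) e"
  using assms by (auto simp: carries_def)

lemma carries_IfTop:
  assumes "carries M n (IfTop k v c d) s e"
  shows "t2_stm M s = T2_If (n + stk_index k) (bit_symbol v) (s + 1) (s + 1 + prog_size c)"
    and "s \<noteq> t2_final M"
    and "carries M n c (s + 1) e" "carries M n d (s + 1 + prog_size c) e"
  using assms by (auto simp: carries_def)

lemma carries_IfLetter:
  assumes "carries M n (IfLetter j a c d) s e"
  shows "t2_stm M s = T2_If j (Letter a) (s + 1) (s + 1 + prog_size c)"
    and "s \<noteq> t2_final M"
    and "carries M n c (s + 1) e" "carries M n d (s + 1 + prog_size c) e"
  using assms by (auto simp: carries_def)

lemma carries_Until:
  assumes "carries M n (Until k v c) s e"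
  shows "t2_stm M s = T2_If (n + stk_index k) (bit_symbol v) e (s + 1)"
    and "s \<noteq> t2_final M"
    and "carries M n c (s + 1) s"
  using assms by (auto simp: carries_def)

text \<open>
  By induction on the run: the flowchart of a part keeps its place within that of the whole.
\<close>

theorem reaches_runs:
  assumes "runs x c st st'" "carries M n c s e" "reads_within n c"
  shows "reaches M (prog_config n x s st) (prog_config n x e st')"
  using assms
proof (induction arbitrary: s e rule: runs.induct)
  case (Nop st)
  then show ?case
    using carriesD[OF Nop.prems(1), of s] reaches_if[of M s "n + 1" blank e e n x]
    by (cases st) auto
next
  case (Push k b S r w)
  then show ?case
    using carriesD[OF Push.prems(1), of s] carriesD[OF Push.prems(1), of "s + 1"]
    by (intro reaches_push[where s' = "s + 1"]) auto
next
  case (Pop S k b st r w)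
  then show ?case
    using carriesD[OF Pop.prems(1), of s] carriesD[OF Pop.prems(1), of "s + 1"]
    by (intro reaches_pop[where s' = "s + 1"]) auto
next
  case (Advance j S r w)
  then show ?case
    using carriesD[OF Advance.prems(1), of s] by (intro reaches_advance) auto
next
  case (Emit a S r w)
  then show ?case
    using carriesD[OF Emit.prems(1), of s] by (intro reaches_emit) auto
next
  case (Then c st st' d st'')
  then show ?case
    using carries_Then[OF Then.prems(1)] reaches_trans[OF Then.IH(1) Then.IH(2)] by simp
next
  case (IfTop_yes S k v c r w st' d)
  have "reaches M (prog_config n x s (S, r, w)) (prog_config n x (s + 1) (S, r, w))"
    using IfTop_yes.hyps carries_IfTop[OF IfTop_yes.prems(1)] IfTop_yes.prems(2)
      reaches_if[of M s "n + stk_index k" "bit_symbol v" "s + 1" "s + 1 + prog_size c" n x S r w]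
    by (simp add: prog_config_sel stack_tape_top)
  moreover have "reaches M (prog_config n x (s + 1) (S, r, w)) (prog_config n x e st')"
    using IfTop_yes.IH carries_IfTop[OF IfTop_yes.prems(1)] IfTop_yes.prems(2) by simp
  ultimately show ?case by (rule reaches_trans)
next
  case (IfTop_no S k v d r w st' c)
  have "reaches M (prog_config n x s (S, r, w)) (prog_config n x (s + 1 + prog_size c) (S, r, w))"
    using IfTop_no.hyps carries_IfTop[OF IfTop_no.prems(1)] IfTop_no.prems(2)
      reaches_if[of M s "n + stk_index k" "bit_symbol v" "s + 1" "s + 1 + prog_size c" n x S r w]
    by (simp add: prog_config_sel stack_tape_top)
  moreover have "reaches M (prog_config n x (s + 1 + prog_size c) (S, r, w)) (prog_config n x e st')"
    using IfTop_no.IH carries_IfTop[OF IfTop_no.prems(1)] IfTop_no.prems(2) by simp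
  ultimately show ?case by (rule reaches_trans)
next
  case (IfLetter_yes j r a c S w st' d)
  have "reaches M (prog_config n x s (S, r, w)) (prog_config n x (s + 1) (S, r, w))"
    using IfLetter_yes.hyps carries_IfLetter[OF IfLetter_yes.prems(1)] IfLetter_yes.prems(2)
      reaches_if[of M s "j" "Letter a" "s + 1" "s + 1 + prog_size c" n x S r w]
    by (simp add: prog_config_sel)
  moreover have "reaches M (prog_config n x (s + 1) (S, r, w)) (prog_config n x e st')"
    using IfLetter_yes.IH carries_IfLetter[OF IfLetter_yes.prems(1)] IfLetter_yes.prems(2) by simp
  ultimately show ?case by (rule reaches_trans)
next
  case (IfLetter_no j r a d S w st' c)
  have "reaches M (prog_config n x s (S, r, w)) (prog_config n x (s + 1 + prog_size c) (S, r, w))"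
    using IfLetter_no.hyps carries_IfLetter[OF IfLetter_no.prems(1)] IfLetter_no.prems(2)
      reaches_if[of M s "j" "Letter a" "s + 1" "s + 1 + prog_size c" n x S r w]
    by (simp add: prog_config_sel)
  moreover have "reaches M (prog_config n x (s + 1 + prog_size c) (S, r, w)) (prog_config n x e st')"
    using IfLetter_no.IH carries_IfLetter[OF IfLetter_no.prems(1)] IfLetter_no.prems(2) by simp
  ultimately show ?case by (rule reaches_trans)
next
  case (Until_stop S k v c r w)
  then show ?case
    using carries_Until[OF Until_stop.prems(1)]
      reaches_if[of M s "n + stk_index k" "bit_symbol v" e "s + 1" n x S r w]
    by (simp add: prog_config_sel stack_tape_top)
next
  case (Until_go S k v c r w st' st'')
  have "reaches M (prog_config n x s (S, r, w)) (prog_config n x (s + 1) (S, r, w))"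
    using Until_go.hyps carries_Until[OF Until_go.prems(1)]
      reaches_if[of M s "n + stk_index k" "bit_symbol v" e "s + 1" n x S r w]
    by (simp add: prog_config_sel stack_tape_top)
  moreover have "reaches M (prog_config n x (s + 1) (S, r, w)) (prog_config n x s st')"
    using Until_go carries_Until[OF Until_go.prems(1)] by simp
  moreover have "reaches M (prog_config n x s st') (prog_config n x e st'')"
    using Until_go by simp
  ultimately show ?case by (blast intro: reaches_trans)
qed

lemma code_wf:
  assumes "reads_within n c" "l \<in> {s..<s + prog_size c}" "{s..<s + prog_size c} \<subseteq> t2_labels M"
    and "e \<in> t2_labels M" "t2_work M = 4" "t2_aux M = {0, 1, 2}"
  shows "wf_t2_stm M n (code n c s e l)"
proof -
  have bit: "bit_symbol v \<in> range Letter \<union> Aux ` {0, 1, 2}" for v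
    by (cases v rule: bit_symbol.cases) auto
  show ?thesis
    using assms
  proof (induction c arbitrary: s e)
    case (Then c d)
    show ?case
    proof (cases "l < s + prog_size c")
      case True
      have "s + prog_size c \<in> {s..<s + prog_size (c ;; d)}" by simp
      then have "wf_t2_stm M n (code n c s (s + prog_size c) l)"
        using True Then.prems by (intro Then.IH(1)) (auto simp: subset_iff)
      then show ?thesis using True by simp
    next
      case False
      then have "wf_t2_stm M n (code n d (s + prog_size c) e l)"
        using Then.prems by (intro Then.IH(2)) (auto simp: subset_iff)
      then show ?thesis using False by simp
    qed
  next
    case (IfTop k v c d)
    show ?case
    proof (cases "l = s")
      case True
      then show ?thesis using IfTop.prems bit[of v] prog_size_pos[of d]
        by (simp add: subset_iff)
    next
      case False
      have "wf_t2_stm M n (code n c (s + 1) e l)" if "l < s + 1 + prog_size c"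
        using False that IfTop.prems by (intro IfTop.IH(1)) (simp_all add: subset_iff)
      moreover have "wf_t2_stm M n (code n d (s + 1 + prog_size c) e l)" if "\<not> l < s + 1 + prog_size c"
        using False that IfTop.prems by (intro IfTop.IH(2)) (simp_all add: subset_iff)
      ultimately show ?thesis using False by simp
    qed
  next
    case (IfLetter j a c d)
    show ?case
    proof (cases "l = s")
      case True
      then show ?thesis using IfLetter.prems prog_size_pos[of d] by (simp add: subset_iff)
    next
      case False
      have "wf_t2_stm M n (code n c (s + 1) e l)" if "l < s + 1 + prog_size c"
        using False that IfLetter.prems by (intro IfLetter.IH(1)) (simp_all add: subset_iff)
      moreover have "wf_t2_stm M n (code n d (s + 1 + prog_size c) e l)" if "\<not> l < s + 1 + prog_size c"
        using False that IfLetter.prems by (intro IfLetter.IH(2)) (simp_all add: subset_iff)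
      ultimately show ?thesis using False by simp
    qed
  next
    case (Until k v c)
    show ?case
    proof (cases "l = s")
      case True
      then show ?thesis using Until.prems bit[of v] prog_size_pos[of c] by (simp add: subset_iff)
    next
      case False
      then have "wf_t2_stm M n (code n c (s + 1) s l)"
        using Until.prems by (intro Until.IH) (auto simp: subset_iff)
      then show ?thesis using False by simp
    qed
  next
    case (Push k b)
    then show ?case using bit[of "Some b"] by (auto simp: subset_iff)
  qed (auto simp: subset_iff)
qed

section \<open>Recursive functions on binary trees\<close>

datatype tree = Leaf | Node tree tree

text \<open>
  Prefix notation is self-delimiting: the end of a tree on top of a stack can be found without a
  separator.
\<close>

fun ser :: "tree \<Rightarrow> bool list" where
  "ser Leaf = [False]"
| "ser (Node a b) = True # ser a @ ser b"

lemma ser_nonempty [simp]: "ser t \<noteq> []"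
  by (cases t) auto

definition stack_A :: "bool list \<Rightarrow> stk \<Rightarrow> bool list" where
  "stack_A a = (\<lambda>_. [])(SA := a)"

lemma stack_A_simps [simp]: "stack_A a SA = a" "k \<noteq> SA \<Longrightarrow> stack_A a k = []"
  "(stack_A a)(SA := b) = stack_A b"
  by (auto simp: stack_A_def)

fun push_all :: "bool \<Rightarrow> stk list \<Rightarrow> 's prog" where
  "push_all b [] = Nop"
| "push_all b (k # ks) = Push k b ;; push_all b ks"

text \<open>
  Moving a stack reverses it; with two targets it is copied as well.
\<close>

definition pour :: "stk \<Rightarrow> stk list \<Rightarrow> 's prog" where
  "pour k ks = Until k None (IfTop k (Some True) (Pop k ;; push_all True ks) (Pop k ;; push_all False ks))"

text \<open>
  \<open>SK\<close> counts the subtrees that are still to be read: a node replaces one by two, a leaf completes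
  one.
\<close>

definition move_tree :: "stk \<Rightarrow> 's prog" where
  "move_tree k = Push SK True ;;
     Until SK None (IfTop SA (Some True) (Pop SA ;; Push k True ;; Push SK True)
                                         (Pop SA ;; Push k False ;; Pop SK))"

lemma runs_eq: "runs x c st st' \<Longrightarrow> st' = st'' \<Longrightarrow> runs x c st st''"
  by simp

lemma runs_push_all:
  "distinct ks \<Longrightarrow> runs x (push_all b ks) (S, r, w) ((\<lambda>i. if i \<in> set ks then b # S i else S i), r, w)"
proof (induction ks arbitrary: S)
  case Nil
  then show ?case by (simp add: runs.Nop)
next
  case (Cons k ks)
  have "(\<lambda>i. if i \<in> set ks then b # (S(k := b # S k)) i else (S(k := b # S k)) i) =
      (\<lambda>i. if i \<in> set (k # ks) then b # S i else S i)"
    using Cons.prems by auto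
  then show ?case
    using Cons.prems runs.Then[OF runs.Push[of x k b S r w] Cons.IH] by simp
qed

lemma runs_pour:
  assumes "distinct ks" "k \<notin> set ks"
  shows "runs x (pour k ks) (S, r, w)
    ((\<lambda>i. if i = k then [] else if i \<in> set ks then rev (S k) @ S i else S i), r, w)"
proof (induction "S k" arbitrary: S)
  case Nil
  then have "(\<lambda>i. if i = k then [] else if i \<in> set ks then rev (S k) @ S i else S i) = S"
    by auto
  then show ?case using Nil by (simp add: pour_def runs.Until_stop)
next
  case (Cons b s)
  define S1 where "S1 = S(k := s)"
  define S2 where "S2 = (\<lambda>i. if i \<in> set ks then b # S1 i else S1 i)"
  have S: "S k = b # s" using Cons.hyps(2) by simp
  have pop: "runs x (Pop k ;; push_all b ks) (S, r, w) (S2, r, w)"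
    unfolding S2_def S1_def using assms(1) S by (rule_tac runs.Then[OF runs.Pop runs_push_all]) auto
  then have body: "runs x (IfTop k (Some True) (Pop k ;; push_all True ks) (Pop k ;; push_all False ks))
      (S, r, w) (S2, r, w)"
    using S by (cases b) (auto intro: runs.IfTop_yes runs.IfTop_no)
  have "S2 k = s" using assms(2) by (simp add: S2_def S1_def)
  moreover have "(\<lambda>i. if i = k then [] else if i \<in> set ks then rev (S2 k) @ S2 i else S2 i) =
      (\<lambda>i. if i = k then [] else if i \<in> set ks then rev (S k) @ S i else S i)"
    using assms(2) S by (auto simp: S2_def S1_def)
  ultimately have "runs x (pour k ks) (S2, r, w)
      ((\<lambda>i. if i = k then [] else if i \<in> set ks then rev (S k) @ S i else S i), r, w)"
    using Cons.hyps(1)[of S2] by simp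
  then show ?case using body S unfolding pour_def by (intro runs.Until_go) auto
qed

text \<open>
  The invariant of the loop in \<open>move_tree\<close>, for a list \<open>ts\<close> of pending subtrees.
\<close>

lemma runs_move_trees:
  assumes "k \<noteq> SA" "k \<noteq> SK"
    and "S SA = concat (map ser ts) @ a" "S SK = replicate (length ts) True"
  shows "runs x (Until SK None (IfTop SA (Some True) (Pop SA ;; Push k True ;; Push SK True)
                                         (Pop SA ;; Push k False ;; Pop SK)))
    (S, r, w) (S(SA := a, k := rev (concat (map ser ts)) @ S k, SK := []), r, w)"
  using assms(3,4)
proof (induction "length (concat (map ser ts))" arbitrary: S ts rule: less_induct)
  case less
  let ?body = "IfTop SA (Some True) (Pop SA ;; Push k True ;; Push SK True)
      (Pop SA ;; Push k False ;; Pop SK)"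
  show ?case
  proof (cases ts)
    case Nil
    then have "S(SA := a, k := rev (concat (map ser ts)) @ S k, SK := []) = S"
      using less.prems assms by auto
    then show ?thesis using Nil less.prems by (simp add: runs.Until_stop)
  next
    case (Cons t us)
    show ?thesis
    proof (cases t)
      case Leaf
      define S1 where "S1 = S(SA := concat (map ser us) @ a, k := False # S k, SK := replicate (length us) True)"
      have "runs x (Pop SA ;; Push k False ;; Pop SK) (S, r, w) (S1, r, w)"
        using less.prems Cons Leaf assms(1,2)
        by (rule_tac runs_eq[OF runs.Then[OF runs.Pop[where s = "concat (map ser us) @ a" and b = False]
              runs.Then[OF runs.Push runs.Pop[where b = True and s = "replicate (length us) True"]]]])
          (auto simp: S1_def)
      then have "runs x ?body (S, r, w) (S1, r, w)"
        using less.prems Cons Leaf assms(1,2)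
        by (intro runs.IfTop_no) (auto simp: S1_def)
      moreover have "runs x (Until SK None ?body) (S1, r, w)
          (S1(SA := a, k := rev (concat (map ser us)) @ S1 k, SK := []), r, w)"
        using assms(1,2) Cons by (intro less.hyps) (auto simp: S1_def)
      moreover have "S1(SA := a, k := rev (concat (map ser us)) @ S1 k, SK := []) =
          S(SA := a, k := rev (concat (map ser ts)) @ S k, SK := [])"
        using assms(1,2) Cons Leaf by (auto simp: S1_def)
      ultimately show ?thesis
        using less.prems Cons by (rule_tac runs.Until_go[where st' = "(S1, r, w)"]) auto
    next
      case (Node l t')
      define S1 where "S1 = S(SA := concat (map ser (l # t' # us)) @ a, k := True # S k,
        SK := replicate (length (l # t' # us)) True)"
      have "runs x (Pop SA ;; Push k True ;; Push SK True) (S, r, w) (S1, r, w)"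
        using less.prems Cons Node assms(1,2)
        by (rule_tac runs_eq[OF runs.Then[OF runs.Pop[where s = "concat (map ser (l # t' # us)) @ a" and b = True]
              runs.Then[OF runs.Push runs.Push]]])
          (auto simp: S1_def fun_eq_iff)
      then have "runs x ?body (S, r, w) (S1, r, w)"
        using less.prems Cons Node assms(1,2)
        by (intro runs.IfTop_yes) (auto simp: S1_def)
      moreover have "runs x (Until SK None ?body) (S1, r, w)
          (S1(SA := a, k := rev (concat (map ser (l # t' # us))) @ S1 k, SK := []), r, w)"
        using assms(1,2) Cons Node by (intro less.hyps) (auto simp: S1_def)
      moreover have "S1(SA := a, k := rev (concat (map ser (l # t' # us))) @ S1 k, SK := []) =
          S(SA := a, k := rev (concat (map ser ts)) @ S k, SK := [])"
        using assms(1,2) Cons Node by (auto simp: S1_def)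
      ultimately show ?thesis
        using less.prems Cons by (rule_tac runs.Until_go[where st' = "(S1, r, w)"]) auto
    qed
  qed
qed

lemma runs_move_tree:
  assumes "k \<noteq> SA" "k \<noteq> SK" "S SA = ser t @ a" "S SK = []"
  shows "runs x (move_tree k) (S, r, w) (S(SA := a, k := rev (ser t) @ S k), r, w)"
proof -
  have "(S(SK := True # S SK))(SA := a, k := rev (concat (map ser [t])) @ (S(SK := True # S SK)) k, SK := []) =
      S(SA := a, k := rev (ser t) @ S k)"
    using assms by auto
  then show ?thesis
    unfolding move_tree_def
    using runs.Then[OF runs.Push runs_move_trees[OF assms(1,2), of "S(SK := True # S SK)" "[t]" a]] assms
    by simp
qed

definition drop_tree :: "'s prog" where
  "drop_tree = move_tree SB ;; pour SB []"

definition dup_tree :: "'s prog" where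
  "dup_tree = move_tree SB ;; pour SB [SA, SC] ;; pour SC [SB] ;; pour SB [SA]"

definition swap_trees :: "'s prog" where
  "swap_trees = move_tree SB ;; move_tree SC ;; pour SB [SA] ;; pour SC [SA]"

lemma runs_drop_tree: "runs x drop_tree (stack_A (ser t @ a), r, w) (stack_A a, r, w)"
  unfolding drop_tree_def
  by (rule runs_eq, rule runs.Then[OF runs_move_tree runs_pour])
    (auto simp: stack_A_def fun_eq_iff)

lemma runs_dup_tree:
  "runs x dup_tree (stack_A (ser t @ a), r, w) (stack_A (ser t @ ser t @ a), r, w)"
  unfolding dup_tree_def
  by (rule runs_eq, rule runs.Then[OF runs_move_tree[of _ _ t a]
        runs.Then[OF runs_pour runs.Then[OF runs_pour runs_pour]]])
    (auto simp: stack_A_def fun_eq_iff)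

lemma runs_swap_trees:
  "runs x swap_trees (stack_A (ser t @ ser u @ a), r, w) (stack_A (ser u @ ser t @ a), r, w)"
  unfolding swap_trees_def
  by (rule runs_eq, rule runs.Then[OF runs_move_tree[of _ _ t "ser u @ a"]
        runs.Then[OF runs_move_tree[of _ _ u a] runs.Then[OF runs_pour runs_pour]]])
    (auto simp: stack_A_def fun_eq_iff)

fun push_list :: "bool list \<Rightarrow> 's prog" where
  "push_list [] = Nop"
| "push_list (b # bs) = push_list bs ;; Push SA b"

lemma runs_push_A: "runs x (Push SA b) (stack_A a, r, w) (stack_A (b # a), r, w)"
  using runs.Push[of x SA b "stack_A a"] by simp

lemma runs_pop_A: "runs x (Pop SA) (stack_A (b # a), r, w) (stack_A a, r, w)"
  using runs.Pop[of "stack_A (b # a)" SA b a x] by simp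

lemma runs_push_list: "runs x (push_list bs) (stack_A a, r, w) (stack_A (bs @ a), r, w)"
  by (induction bs) (auto intro: runs.intros(1,6) runs_push_A)

fun left :: "tree \<Rightarrow> tree" where
  "left Leaf = Leaf" | "left (Node a b) = a"

fun right :: "tree \<Rightarrow> tree" where
  "right Leaf = Leaf" | "right (Node a b) = b"

text \<open>
  The number of iterations that a tree stands for. It is the value of a coded natural number and the
  length of a coded list.
\<close>

fun spine :: "tree \<Rightarrow> nat" where
  "spine Leaf = 0" | "spine (Node a b) = Suc (spine b)"

text \<open>
  Each clause is chosen so that it is realized by a short program on the stack \<open>SA\<close>; there is no
  recursion on trees other than iteration along the right spine.
\<close>

inductive tree_rec :: "(tree \<Rightarrow> tree) \<Rightarrow> bool" where
  id: "tree_rec (\<lambda>t. t)"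
| comp: "tree_rec f \<Longrightarrow> tree_rec g \<Longrightarrow> tree_rec (\<lambda>t. g (f t))"
| const: "tree_rec (\<lambda>t. u)"
| left: "tree_rec left"
| right: "tree_rec right"
| Node: "tree_rec f \<Longrightarrow> tree_rec g \<Longrightarrow> tree_rec (\<lambda>t. Node (f t) (g t))"
| If: "tree_rec b \<Longrightarrow> tree_rec f \<Longrightarrow> tree_rec g \<Longrightarrow> tree_rec (\<lambda>t. if b t = Leaf then f t else g t)"
| iter: "tree_rec h \<Longrightarrow> tree_rec (\<lambda>t. (h ^^ spine (left t)) (right t))"

text \<open>
  The arbitrary stack content \<open>a\<close> below the argument makes it possible to keep other values while
  \<open>c\<close> is running.
\<close>

definition realizes :: "'s prog \<Rightarrow> (tree \<Rightarrow> tree) \<Rightarrow> bool" where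
  "realizes c g \<longleftrightarrow> (\<forall>n. reads_within n c) \<and>
     (\<forall>x t a r w. runs x c (stack_A (ser t @ a), r, w) (stack_A (ser (g t) @ a), r, w))"

lemma reads_within_pure [simp]:
  "reads_within n (push_all b ks)" "reads_within n (pour k ks)" "reads_within n (move_tree k)"
  "reads_within n drop_tree" "reads_within n dup_tree" "reads_within n swap_trees"
  "reads_within n (push_list bs)"
proof -
  show all: "reads_within n (push_all b ks)" for b ks by (induction ks) auto
  show pour: "reads_within n (pour k ks)" for k ks by (simp add: pour_def all)
  show "reads_within n drop_tree" "reads_within n dup_tree" "reads_within n swap_trees"
    by (simp_all add: drop_tree_def dup_tree_def swap_trees_def move_tree_def pour)
  show "reads_within n (push_list bs)" by (induction bs) auto
qed (simp add: move_tree_def)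

lemma top_ser: "top_of (ser t @ a) = Some (t \<noteq> Leaf)"
  by (cases t) auto

text \<open>
  The loop of \<open>tree_rec.iter\<close>: the tree \<open>n\<close> that counts lies above the iterated value \<open>s\<close>, and is put
  aside by a swap while \<open>h\<close> is applied.
\<close>

lemma runs_iterate:
  assumes "realizes c h"
  shows "runs x (Until SA (Some False) (Pop SA ;; drop_tree ;; swap_trees ;; c ;; swap_trees))
    (stack_A (ser n @ ser s @ a), r, w) (stack_A (False # ser ((h ^^ spine n) s) @ a), r, w)"
proof (induction n arbitrary: s)
  case Leaf
  then show ?case by (simp add: runs.Until_stop)
next
  case (Node u n)
  have c: "runs x c (stack_A (ser s @ b), r, w) (stack_A (ser (h s) @ b), r, w)" for s b
    using assms by (simp add: realizes_def)
  have "runs x (Pop SA ;; drop_tree ;; swap_trees ;; c ;; swap_trees)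
      (stack_A (True # ser u @ ser n @ ser s @ a), r, w) (stack_A (ser n @ ser (h s) @ a), r, w)"
    by (rule runs.Then[OF runs_pop_A], rule runs.Then[OF runs_drop_tree],
        rule runs.Then[OF runs_swap_trees], rule runs.Then[OF c], rule runs_swap_trees)
  then show ?case
    using Node.IH(2)[of "h s"]
    by (auto simp: funpow_Suc_right simp del: funpow.simps(2)
        intro: runs.Until_go[where st' = "(stack_A (ser n @ ser (h s) @ a), r, w)"])
qed

text \<open>
  A binary construction first duplicates the argument, evaluates its first part on the copy, and
  swaps.
\<close>

theorem tree_rec_realizable:
  assumes "tree_rec g"
  shows "\<exists>c :: 's prog. realizes c g"
  using assms
proof induction
  case id
  then show ?case by (intro exI[of _ Nop]) (simp add: realizes_def runs.Nop)
next
  case (comp f g)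
  then obtain c d :: "'s prog" where "realizes c f" "realizes d g" by blast
  then have "realizes (c ;; d) (\<lambda>t. g (f t))"
    unfolding realizes_def by (metis reads_within.simps(2) runs.Then)
  then show ?case by blast
next
  case (const u)
  have "realizes (drop_tree ;; push_list (ser u) :: 's prog) (\<lambda>t. u)"
    unfolding realizes_def by (auto intro: runs.Then runs_drop_tree runs_push_list)
  then show ?case by blast
next
  case left
  have "runs x (IfTop SA (Some False) Nop (Pop SA ;; swap_trees ;; drop_tree))
      (stack_A (ser t @ a), r, w) (stack_A (ser (left t) @ a), r, w)" for x :: "'s val tuple" and t a r w
  proof (cases t)
    case Leaf
    then show ?thesis by (auto intro!: runs.IfTop_yes runs.Nop)
  next
    case (Node u v)
    then show ?thesis
      by (auto intro!: runs.IfTop_no runs.Then[OF runs_pop_A] runs.Then[OF runs_swap_trees] runs_drop_tree)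
  qed
  then have "realizes (IfTop SA (Some False) Nop (Pop SA ;; swap_trees ;; drop_tree) :: 's prog) left"
    unfolding realizes_def by auto
  then show ?case by blast
next
  case right
  have "runs x (IfTop SA (Some False) Nop (Pop SA ;; drop_tree))
      (stack_A (ser t @ a), r, w) (stack_A (ser (right t) @ a), r, w)" for x :: "'s val tuple" and t a r w
  proof (cases t)
    case Leaf
    then show ?thesis by (auto intro!: runs.IfTop_yes runs.Nop)
  next
    case (Node u v)
    then show ?thesis
      by (auto intro!: runs.IfTop_no runs.Then[OF runs_pop_A] runs_drop_tree)
  qed
  then have "realizes (IfTop SA (Some False) Nop (Pop SA ;; drop_tree) :: 's prog) right"
    unfolding realizes_def by auto
  then show ?case by blast
next
  case (Node f g)
  then obtain c d :: "'s prog" where *: "realizes c f" "realizes d g" by blast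
  have "runs x (dup_tree ;; c ;; swap_trees ;; d ;; swap_trees ;; Push SA True)
      (stack_A (ser t @ a), r, w) (stack_A (ser (Node (f t) (g t)) @ a), r, w)" for x t a r w
  proof -
    have "runs x c (stack_A (ser t @ ser t @ a), r, w) (stack_A (ser (f t) @ ser t @ a), r, w)"
      "runs x d (stack_A (ser t @ ser (f t) @ a), r, w) (stack_A (ser (g t) @ ser (f t) @ a), r, w)"
      using * by (simp_all add: realizes_def)
    then show ?thesis
      using runs_push_A[of x True "ser (f t) @ ser (g t) @ a" r w]
      by (auto intro!: runs.Then[OF runs_dup_tree] runs.Then[OF runs_swap_trees] intro: runs.Then)
  qed
  then have "realizes (dup_tree ;; c ;; swap_trees ;; d ;; swap_trees ;; Push SA True) (\<lambda>t. Node (f t) (g t))"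
    using * unfolding realizes_def by simp
  then show ?case by blast
next
  case (If b f g)
  then obtain c d e :: "'s prog" where *: "realizes c b" "realizes d f" "realizes e g" by blast
  have "runs x (dup_tree ;; c ;; IfTop SA (Some False) (drop_tree ;; d) (drop_tree ;; e))
      (stack_A (ser t @ a), r, w) (stack_A (ser (if b t = Leaf then f t else g t) @ a), r, w)" for x t a r w
  proof -
    have c: "runs x c (stack_A (ser t @ ser t @ a), r, w) (stack_A (ser (b t) @ ser t @ a), r, w)"
      using * by (simp add: realizes_def)
    have d: "runs x (drop_tree ;; d) (stack_A (ser (b t) @ ser t @ a), r, w) (stack_A (ser (f t) @ a), r, w)"
      using * by (intro runs.Then[OF runs_drop_tree]) (simp add: realizes_def)
    have e: "runs x (drop_tree ;; e) (stack_A (ser (b t) @ ser t @ a), r, w) (stack_A (ser (g t) @ a), r, w)"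
      using * by (intro runs.Then[OF runs_drop_tree]) (simp add: realizes_def)
    show ?thesis
    proof (cases "b t = Leaf")
      case True
      then show ?thesis using d
        by (intro runs.Then[OF runs_dup_tree] runs.Then[OF c] runs.IfTop_yes) auto
    next
      case False
      then show ?thesis using e
        by (intro runs.Then[OF runs_dup_tree] runs.Then[OF c] runs.IfTop_no) (auto simp: top_ser)
    qed
  qed
  then have "realizes (dup_tree ;; c ;; IfTop SA (Some False) (drop_tree ;; d) (drop_tree ;; e))
      (\<lambda>t. if b t = Leaf then f t else g t)"
    using * unfolding realizes_def by simp
  then show ?case by blast
next
  case (iter h)
  then obtain c :: "'s prog" where *: "realizes c h" by blast
  let ?loop = "Until SA (Some False) (Pop SA ;; drop_tree ;; swap_trees ;; c ;; swap_trees)"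
  have "runs x (IfTop SA (Some False) Nop (Pop SA ;; ?loop ;; Pop SA))
      (stack_A (ser t @ a), r, w) (stack_A (ser ((h ^^ spine (left t)) (right t)) @ a), r, w)" for x t a r w
  proof (cases t)
    case Leaf
    then show ?thesis by (auto intro!: runs.IfTop_yes runs.Nop)
  next
    case (Node u v)
    then show ?thesis
      using runs_iterate[OF *, of x u v a r w]
      by (auto intro!: runs.IfTop_no runs.Then[OF runs_pop_A] runs_pop_A intro: runs.Then)
  qed
  then have "realizes (IfTop SA (Some False) Nop (Pop SA ;; ?loop ;; Pop SA))
      (\<lambda>t. (h ^^ spine (left t)) (right t))"
    using * unfolding realizes_def by simp
  then show ?case by blast
qed

section \<open>Effective functions on coded data\<close>

class codable =
  fixes enc :: "'a \<Rightarrow> tree"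

instantiation nat :: codable begin
fun enc_nat :: "nat \<Rightarrow> tree" where
  "enc_nat 0 = Leaf"
| "enc_nat (Suc n) = Node Leaf (enc_nat n)"
instance ..
end

instantiation bool :: codable begin
definition enc_bool :: "bool \<Rightarrow> tree" where
  "enc_bool b = (if b then Node Leaf Leaf else Leaf)"
instance ..
end

instantiation prod :: (codable, codable) codable begin
definition enc_prod :: "'a \<times> 'b \<Rightarrow> tree" where
  "enc_prod p = Node (enc (fst p)) (enc (snd p))"
instance ..
end

instantiation list :: (codable) codable begin
fun enc_list :: "'a list \<Rightarrow> tree" where
  "enc_list [] = Leaf"
| "enc_list (a # as) = Node (enc a) (enc_list as)"
instance ..
end

text \<open>
  Computability of functions between coded types. The lemmas collected in \<open>eff\<close> have conclusions of
  the form \<open>effective (\<lambda>x. \<dots>)\<close> with arbitrary subterms depending on \<open>x\<close>, so that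
  effectiveness of a function follows from its definition by introduction rules.
\<close>

definition effective :: "('a::codable \<Rightarrow> 'b::codable) \<Rightarrow> bool" where
  "effective f \<longleftrightarrow> (\<exists>g. tree_rec g \<and> (\<forall>x. g (enc x) = enc (f x)))"

lemma effectiveI: "tree_rec g \<Longrightarrow> (\<And>x. g (enc x) = enc (f x)) \<Longrightarrow> effective f"
  by (auto simp: effective_def)

lemma effectiveE:
  assumes "effective f"
  obtains g where "tree_rec g" "\<And>x. g (enc x) = enc (f x)"
  using assms by (auto simp: effective_def)

named_theorems eff

lemma effective_id [eff]: "effective (\<lambda>x. x)"
  by (rule effectiveI[OF tree_rec.id]) simp

lemma effective_const [eff]: "effective (\<lambda>x. c)"
  by (rule effectiveI[OF tree_rec.const]) simp

lemma effective_comp: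
  assumes "effective g" "effective f"
  shows "effective (\<lambda>x. g (f x))"
proof -
  obtain f' where f: "tree_rec f'" "\<And>x. f' (enc x) = enc (f x)"
    using assms(2) by (rule effectiveE) blast
  obtain g' where g: "tree_rec g'" "\<And>x. g' (enc x) = enc (g x)"
    using assms(1) by (rule effectiveE) blast
  show ?thesis by (rule effectiveI[OF tree_rec.comp[OF f(1) g(1)]]) (simp add: f g)
qed

lemma effective_Pair [eff]:
  assumes "effective f" "effective g"
  shows "effective (\<lambda>x. (f x, g x))"
proof -
  obtain f' where f: "tree_rec f'" "\<And>x. f' (enc x) = enc (f x)"
    using assms(1) by (rule effectiveE) blast
  obtain g' where g: "tree_rec g'" "\<And>x. g' (enc x) = enc (g x)"
    using assms(2) by (rule effectiveE) blast
  show ?thesis by (rule effectiveI[OF tree_rec.Node[OF f(1) g(1)]]) (simp add: f g enc_prod_def)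
qed

lemma effective_fst [eff]: "effective f \<Longrightarrow> effective (\<lambda>x. fst (f x))"
  by (erule effective_comp[rotated], rule effectiveI[OF tree_rec.left]) (simp add: enc_prod_def)

lemma effective_snd [eff]: "effective f \<Longrightarrow> effective (\<lambda>x. snd (f x))"
  by (erule effective_comp[rotated], rule effectiveI[OF tree_rec.right]) (simp add: enc_prod_def)

lemma effective_binary:
  assumes "effective (\<lambda>p. h (fst p) (snd p))" "effective f" "effective g"
  shows "effective (\<lambda>x. h (f x) (g x))"
  using effective_comp[OF assms(1) effective_Pair[OF assms(2,3)]] by simp

lemma effective_If [eff]:
  assumes "effective b" "effective f" "effective g"
  shows "effective (\<lambda>x. if b x then f x else g x)"
proof -
  obtain b' where b: "tree_rec b'" "\<And>x. b' (enc x) = enc (b x)"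
    using assms(1) by (rule effectiveE) blast
  obtain f' where f: "tree_rec f'" "\<And>x. f' (enc x) = enc (f x)"
    using assms(2) by (rule effectiveE) blast
  obtain g' where g: "tree_rec g'" "\<And>x. g' (enc x) = enc (g x)"
    using assms(3) by (rule effectiveE) blast
  show ?thesis
    by (rule effectiveI[OF tree_rec.If[OF b(1) g(1) f(1)]]) (simp add: b f g enc_bool_def)
qed

text \<open>The common part of the case distinctions on lists and on natural numbers.\<close>

text \<open>
  The common part of the case distinctions on lists and on numbers. In the second case the tree that
  consists of the context \<open>x\<close> and the nonempty value is already the code of the triple formed by
  context and components; so nothing has to be decomposed.
\<close>

lemma effective_case_Leaf:
  assumes "effective f" "effective g" "effective h"
    and "\<And>x. f x = e \<Longrightarrow> r x = g x" "enc e = Leaf"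
    and "\<And>x. f x \<noteq> e \<Longrightarrow> \<exists>y. enc y = Node (enc x) (enc (f x)) \<and> r x = h y"
    and "\<And>x. f x \<noteq> e \<Longrightarrow> enc (f x) \<noteq> Leaf"
  shows "effective r"
proof -
  obtain f' where f: "tree_rec f'" "\<And>x. f' (enc x) = enc (f x)"
    using assms(1) by (rule effectiveE) blast
  obtain g' where g: "tree_rec g'" "\<And>x. g' (enc x) = enc (g x)"
    using assms(2) by (rule effectiveE) blast
  obtain h' where h: "tree_rec h'" "\<And>x. h' (enc x) = enc (h x)"
    using assms(3) by (rule effectiveE) blast
  have "tree_rec (\<lambda>t. if f' t = Leaf then g' t else h' (Node t (f' t)))"
    by (intro tree_rec.If f(1) g(1) tree_rec.comp[OF _ h(1)] tree_rec.Node tree_rec.id)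
  then show ?thesis
  proof (rule effectiveI)
    fix x
    show "(if f' (enc x) = Leaf then g' (enc x) else h' (Node (enc x) (f' (enc x)))) = enc (r x)"
    proof (cases "f x = e")
      case True
      then show ?thesis using assms(4,5) by (simp add: f g)
    next
      case False
      then obtain y where "enc y = Node (enc x) (enc (f x))" "r x = h y" using assms(6) by blast
      then show ?thesis using assms(7)[OF False] h(2)[of y] by (simp add: f)
    qed
  qed
qed

lemma effective_case_list [eff]:
  assumes "effective f" "effective g" "effective (\<lambda>p. h (fst p) (fst (snd p)) (snd (snd p)))"
  shows "effective (\<lambda>x. case f x of [] \<Rightarrow> g x | y # ys \<Rightarrow> h x y ys)"
proof (rule effective_case_Leaf[OF assms, where e = "[]"])
  fix x assume "f x \<noteq> []"
  then obtain y ys where "f x = y # ys" by (cases "f x") auto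
  then show "\<exists>p. enc p = Node (enc x) (enc (f x)) \<and>
      (case f x of [] \<Rightarrow> g x | y # ys \<Rightarrow> h x y ys) = h (fst p) (fst (snd p)) (snd (snd p))"
    by (intro exI[of _ "(x, y, ys)"]) (simp add: enc_prod_def)
next
  fix x assume "f x \<noteq> []"
  then show "enc (f x) \<noteq> Leaf" by (cases "f x") auto
qed auto

lemma effective_case_nat [eff]:
  assumes "effective f" "effective g" "effective (\<lambda>p. h (fst p) (snd p))"
  shows "effective (\<lambda>x. case f x of 0 \<Rightarrow> g x | Suc n \<Rightarrow> h x n)"
proof (rule effective_case_Leaf[where e = 0, OF assms(1,2)])
  show "effective (\<lambda>p :: _ \<times> nat \<times> nat. h (fst p) (snd (snd p)))"
    using effective_comp[OF assms(3), of "\<lambda>p. (fst p, snd (snd p))"]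
    by (simp add: effective_Pair effective_fst effective_snd effective_id)
  fix x assume "f x \<noteq> 0"
  then obtain n where "f x = Suc n" by (cases "f x") auto
  then show "\<exists>p :: _ \<times> nat \<times> nat. enc p = Node (enc x) (enc (f x)) \<and>
      (case f x of 0 \<Rightarrow> g x | Suc n \<Rightarrow> h x n) = h (fst p) (snd (snd p))"
    by (intro exI[of _ "(x, 0, n)"]) (simp add: enc_prod_def)
next
  fix x assume "f x \<noteq> 0"
  then show "enc (f x) \<noteq> Leaf" by (cases "f x") auto
qed auto

lemma effective_Cons [eff]:
  assumes "effective f" "effective g"
  shows "effective (\<lambda>x. f x # g x)"
proof -
  have "effective (\<lambda>p :: 'b \<times> 'b list. fst p # snd p)"
    by (rule effectiveI[OF tree_rec.id]) (simp add: enc_prod_def)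
  from effective_comp[OF this effective_Pair[OF assms]] show ?thesis by simp
qed

lemma effective_Suc [eff]:
  assumes "effective f"
  shows "effective (\<lambda>x. Suc (f x))"
  by (rule effective_comp[OF _ assms], rule effectiveI[OF tree_rec.Node[OF tree_rec.const tree_rec.id]])
    simp

text \<open>
  Iteration with a step that depends on the context \<open>x\<close>, which is carried along in the iterated
  state.
\<close>

lemma effective_funpow_spine:
  fixes h :: "'a::codable \<Rightarrow> 's::codable \<Rightarrow> 's"
  assumes "effective k" "effective (\<lambda>p. h (fst p) (snd p))" "effective s"
    and "\<And>x. n x = spine (enc (k x))"
  shows "effective (\<lambda>x. (h x ^^ n x) (s x))"
proof -
  obtain k' where k: "tree_rec k'" "\<And>x. k' (enc x) = enc (k x)"
    using assms(1) by (rule effectiveE) blast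
  obtain h' where h: "tree_rec h'" "\<And>p. h' (enc p) = enc (h (fst p) (snd p))"
    using assms(2) by (rule effectiveE) blast
  obtain s' where s: "tree_rec s'" "\<And>x. s' (enc x) = enc (s x)"
    using assms(3) by (rule effectiveE) blast
  define H where "H = (\<lambda>t. Node (left t) (h' t))"
  have "tree_rec H"
    unfolding H_def by (intro tree_rec.Node tree_rec.left h)
  then have "tree_rec (\<lambda>t. right ((H ^^ spine (left t)) (right t)))"
    by (intro tree_rec.comp[OF _ tree_rec.right] tree_rec.iter)
  then have "tree_rec (\<lambda>t. right ((H ^^ spine (left (Node (k' t) (Node t (s' t)))))
      (right (Node (k' t) (Node t (s' t))))))"
    by (rule tree_rec.comp[rotated]) (intro tree_rec.Node k s tree_rec.id)
  moreover have "(H ^^ m) (Node (enc x) (enc y)) = Node (enc x) (enc ((h x ^^ m) y))" for m x y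
    using h(2)[of "(x, _)"] by (induction m) (simp_all add: H_def enc_prod_def)
  ultimately show ?thesis
    by (elim effectiveI) (simp add: k s assms(4))
qed

lemma spine_nat [simp]: "spine (enc (n :: nat)) = n"
  by (induction n) auto

lemma spine_list [simp]: "spine (enc (xs :: 'a::codable list)) = length xs"
  by (induction xs) auto

lemma effective_funpow [eff]:
  fixes h :: "'a::codable \<Rightarrow> 's::codable \<Rightarrow> 's"
  assumes "effective n" "effective (\<lambda>p. h (fst p) (snd p))" "effective s"
  shows "effective (\<lambda>x. (h x ^^ n x) (s x))"
  by (rule effective_funpow_spine[OF assms]) simp

lemma effective_length [eff]:
  assumes "effective f"
  shows "effective (\<lambda>x. length (f x))"
proof -
  have "effective (\<lambda>x. (Suc ^^ length (f x)) 0)"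
    by (rule effective_funpow_spine[OF assms]) (simp_all add: effective_Suc effective_snd effective_id effective_const)
  then show ?thesis by simp
qed

lemma effective_eq_const [eff]:
  fixes c :: nat
  assumes "effective f"
  shows "effective (\<lambda>x. f x = c)"
proof -
  have "effective (\<lambda>n. n = c)"
  proof (induction c)
    case 0
    have eq: "(\<lambda>n. n = 0) = (\<lambda>n. case n of 0 \<Rightarrow> True | Suc m \<Rightarrow> False)"
      by (rule ext) (simp split: nat.split)
    show ?case unfolding eq by (intro eff)
  next
    case (Suc c)
    have eq: "(\<lambda>n. n = Suc c) = (\<lambda>n. case n of 0 \<Rightarrow> False | Suc m \<Rightarrow> m = c)"
      by (rule ext) (simp split: nat.split)
    show ?case
      unfolding eq
      by (intro effective_case_nat effective_id effective_const effective_comp[OF Suc.IH effective_snd])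
  qed
  from effective_comp[OF this assms] show ?thesis .
qed

text \<open>
  A loop over a list keeps the remaining list in its state.
\<close>

lemma effective_rev_append [eff]:
  assumes "effective f" "effective g"
  shows "effective (\<lambda>x. rev (f x) @ g x)"
proof -
  define step :: "'b list \<times> 'b list \<Rightarrow> 'b list \<times> 'b list" where
    "step = (\<lambda>p. case fst p of [] \<Rightarrow> p | y # ys \<Rightarrow> (ys, y # snd p))"
  have "(step ^^ length xs) (xs, ys) = ([], rev xs @ ys)" for xs ys
    by (induction xs arbitrary: ys) (simp_all add: step_def funpow_Suc_right del: funpow.simps(2))
  moreover have "effective step" unfolding step_def by (intro eff)
  then have "effective (\<lambda>x. snd ((step ^^ length (f x)) (f x, g x)))"
    using assms effective_comp[OF \<open>effective step\<close> effective_snd[OF effective_id]] by (intro eff)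
  ultimately show ?thesis by simp
qed

lemma effective_rev [eff]: "effective f \<Longrightarrow> effective (\<lambda>x. rev (f x))"
  using effective_rev_append[of f "\<lambda>_. []"] by (simp add: effective_const)

lemma effective_append [eff]: "effective f \<Longrightarrow> effective g \<Longrightarrow> effective (\<lambda>x. f x @ g x)"
  using effective_rev_append[OF effective_rev, of f g] by simp

lemma effective_map_consts [eff]:
  assumes "\<And>i. i \<in> set is \<Longrightarrow> effective (F i)"
  shows "effective (\<lambda>x. map (\<lambda>i. F i x) is)"
  using assms by (induction "is") (auto intro: eff)

text \<open>
  Functions given by a table, such as the statements of a machine.
\<close>

lemma effective_finite_cases:
  fixes k :: "_ \<Rightarrow> nat"
  assumes "finite L" "\<And>i. i \<in> L \<Longrightarrow> effective (F i)" "effective k" "effective d"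
  shows "effective (\<lambda>x. if k x \<in> L then F (k x) x else d x)"
  using assms
proof (induction L)
  case (insert i L)
  have "(\<lambda>x. if k x \<in> insert i L then F (k x) x else d x) =
      (\<lambda>x. if k x = i then F i x else if k x \<in> L then F (k x) x else d x)" by auto
  then show ?case using insert by (auto intro!: eff)
qed auto

section \<open>Online computation by a Type-2 machine\<close>

text \<open>
  The code \<open>0\<close> is that of the blank, and \<open>1\<close> is not the code of any symbol.
\<close>

fun sym_code :: "'s::finite symbol \<Rightarrow> nat" where
  "sym_code (Aux n) = 2 * n"
| "sym_code (Letter a) = 2 * to_nat_on (UNIV :: 's set) a + 3"

lemma to_nat_on_UNIV_eq [simp]:
  "to_nat_on (UNIV :: 's::finite set) a = to_nat_on UNIV b \<longleftrightarrow> a = b"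
  by (simp add: countable_finite)

lemma sym_code_eq [simp]: "sym_code u = sym_code v \<longleftrightarrow> u = v"
proof -
  have "2 * m + 3 \<noteq> 2 * n" for m n :: nat by presburger
  then show ?thesis by (cases u; cases v) (auto simp: eq_commute[of "2 * _" "2 * _ + 3"])
qed

lemma sym_code_neq_1 [simp]: "sym_code u \<noteq> 1" "sym_code u \<noteq> Suc 0" "Suc 0 \<noteq> sym_code u"
  by (cases u; simp; presburger)+

definition letters :: "'s::finite list" where
  "letters = (SOME as. set as = UNIV \<and> distinct as)"

lemma letters: "set (letters :: 's::finite list) = UNIV" "distinct (letters :: 's list)"
  using someI_ex[OF finite_distinct_list[OF finite[of UNIV]]] unfolding letters_def by auto

definition letters_with_code :: "nat \<Rightarrow> 's::finite list" where
  "letters_with_code c = filter (\<lambda>a. c = sym_code (Letter a)) letters"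

lemma letters_with_code_Letter [simp]: "letters_with_code (sym_code (Letter a)) = [a]"
proof -
  have "filter (\<lambda>b. a = b) xs = [a]" if "a \<in> set xs" "distinct xs" for xs :: "'a list"
    using that by (induction xs) (auto simp: filter_empty_conv)
  then show ?thesis
    using letters unfolding letters_with_code_def by (auto simp del: sym_code.simps)
qed

lemma letters_with_code_other [simp]:
  "letters_with_code 0 = []" "letters_with_code 1 = []" "letters_with_code (Suc 0) = []"
  by (auto simp: letters_with_code_def filter_empty_conv)

text \<open>
  The innermost alternative is the blank, the only other symbol on an input tape.
\<close>

definition read_letter :: "nat \<Rightarrow> 's::finite prog" where
  "read_letter j =
     foldr (\<lambda>a c. IfLetter j a (push_list (ser (enc (sym_code (Letter a))))) c) letters
       (push_list (ser (enc (0 :: nat)))) ;; Advance j"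

lemma input_tape_cases: "(\<exists>a. input_tape v z = Letter a) \<or> input_tape v z = blank"
  by (cases v) auto

lemma runs_read_letter:
  "runs x (read_letter j) (stack_A a, r, w)
     (stack_A (ser (enc (sym_code (input_tape (x j) (int (r j))))) @ a), r(j := Suc (r j)), w)"
proof -
  let ?u = "input_tape (x j) (int (r j))"
  have "runs x (foldr (\<lambda>a c. IfLetter j a (push_list (ser (enc (sym_code (Letter a))))) c) as
       (push_list (ser (enc (0 :: nat))))) (stack_A a, r, w) (stack_A (ser (enc (sym_code ?u)) @ a), r, w)"
    if "\<forall>b. ?u = Letter b \<longrightarrow> b \<in> set as" for as
    using that
  proof (induction as)
    case Nil
    then have "sym_code ?u = 0" using input_tape_cases[of "x j" "int (r j)"] by auto
    then show ?case using runs_push_list[of x "ser (enc (0 :: nat))"] by simp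
  next
    case (Cons b as)
    show ?case
    proof (cases "?u = Letter b")
      case True
      then show ?thesis
        by (simp del: sym_code.simps) (intro runs.IfLetter_yes runs_push_list)
    next
      case False
      then show ?thesis using Cons
        by (simp del: sym_code.simps) (intro runs.IfLetter_no, auto)
    qed
  qed
  then show ?thesis
    unfolding read_letter_def by (intro runs.Then[OF _ runs.Advance]) (simp add: letters)
qed

fun read_vector :: "nat list \<Rightarrow> 's::finite prog" where
  "read_vector [] = Push SA False"
| "read_vector (j # js) = read_vector js ;; read_letter j ;; Push SA True"

lemma runs_read_vector:
  "distinct js \<Longrightarrow> runs x (read_vector js) (stack_A a, r, w)
     (stack_A (ser (enc (map (\<lambda>j. sym_code (input_tape (x j) (int (r j)))) js)) @ a),
      (\<lambda>j. if j \<in> set js then Suc (r j) else r j), w)"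
proof (induction js)
  case Nil
  then show ?case using runs_push_A[of x False] by simp
next
  case (Cons j js)
  define r1 where "r1 = (\<lambda>j. if j \<in> set js then Suc (r j) else r j)"
  have r1: "r1 j = r j" "r1(j := Suc (r1 j)) = (\<lambda>i. if i \<in> set (j # js) then Suc (r i) else r i)"
    using Cons.prems by (auto simp: r1_def)
  show ?case
    unfolding r1(2)[symmetric]
    using Cons runs_push_A[of x True]
      runs_read_letter[of x j "ser (enc (map (\<lambda>j. sym_code (input_tape (x j) (int (r j)))) js)) @ a" r1 w]
    by (auto simp: r1 simp flip: r1_def intro!: runs.Then)
qed

lemma reads_within_read_vector:
  assumes "set js \<subseteq> {1..n}"
  shows "reads_within n (read_vector js)"
proof -
  have *: "reads_within n (foldr (\<lambda>a c. IfLetter j a (push_list (ser (enc (sym_code (Letter a))))) c) as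
       (push_list (ser (enc (0 :: nat)))))" if "j \<in> {1..n}" for j and as :: "'a list"
    using that by (induction as) auto
  show ?thesis using assms * by (induction js) (auto simp: read_letter_def)
qed

text \<open>
  \<open>b\<close> decides a property of the tree on top of \<open>SA\<close>, which is preserved.
\<close>

definition when_true :: "'s prog \<Rightarrow> 's prog \<Rightarrow> 's prog" where
  "when_true b c = dup_tree ;; b ;; IfTop SA (Some False) drop_tree (drop_tree ;; c)"

lemma runs_when_true:
  assumes "realizes b g" "g t = enc P"
    and "P \<Longrightarrow> runs x c (stack_A (ser t @ a), r, w) st'" "\<not> P \<Longrightarrow> st' = (stack_A (ser t @ a), r, w)"
  shows "runs x (when_true b c) (stack_A (ser t @ a), r, w) st'"
proof -
  have b: "runs x b (stack_A (ser t @ ser t @ a), r, w) (stack_A (ser (enc P) @ ser t @ a), r, w)"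
    using assms(1,2) unfolding realizes_def by metis
  show ?thesis
  proof (cases P)
    case True
    then have "runs x (drop_tree ;; c) (stack_A (ser (enc P) @ ser t @ a), r, w) st'"
      using assms(3) by (intro runs.Then[OF runs_drop_tree]) auto
    then show ?thesis
      unfolding when_true_def using True
      by (intro runs.Then[OF runs_dup_tree] runs.Then[OF b] runs.IfTop_no) (auto simp: top_ser enc_bool_def)
  next
    case False
    then show ?thesis
      unfolding when_true_def using assms(4)
      by (intro runs.Then[OF runs_dup_tree] runs.Then[OF b] runs.IfTop_yes)
        (auto simp: top_ser enc_bool_def runs_drop_tree[of x Leaf, simplified])
  qed
qed

lemma reads_within_when_true [simp]:
  "reads_within n (when_true b c) \<longleftrightarrow> reads_within n b \<and> reads_within n c"
  by (auto simp: when_true_def)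

fun emit_letters :: "('s \<Rightarrow> 's prog) \<Rightarrow> 's list \<Rightarrow> 's prog" where
  "emit_letters b [] = Nop"
| "emit_letters b (a # as) = when_true (b a) (Emit a) ;; emit_letters b as"

lemma runs_emit_letters:
  assumes "\<And>a. realizes (b a) (g a)" "\<And>a. g a t = enc (P a)"
  shows "runs x (emit_letters b as) (stack_A (ser t @ s), r, w) (stack_A (ser t @ s), r, w @ filter P as)"
proof (induction as arbitrary: w)
  case Nil
  then show ?case by (simp add: runs.Nop)
next
  case (Cons a as)
  have "runs x (when_true (b a) (Emit a)) (stack_A (ser t @ s), r, w)
      (stack_A (ser t @ s), r, w @ filter P [a])"
    by (rule runs_when_true[OF assms]) (auto intro: runs.Emit)
  then show ?case using Cons.IH[of "w @ filter P [a]"] by (auto intro: runs.Then split: if_splits)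
qed

fun online_state :: "('v \<times> 'st \<Rightarrow> 'st) \<Rightarrow> 'st \<Rightarrow> (nat \<Rightarrow> 'v) \<Rightarrow> nat \<Rightarrow> 'st" where
  "online_state \<Phi> s0 v 0 = s0"
| "online_state \<Phi> s0 v (Suc t) = \<Phi> (v t, online_state \<Phi> s0 v t)"

text \<open>
  \<open>act t\<close> is the action after round \<open>t\<close>: the code of a letter to be written, \<open>1\<close> to halt, \<open>0\<close> for
  nothing.
\<close>

definition online_output :: "(nat \<Rightarrow> nat) \<Rightarrow> nat \<Rightarrow> 's::finite list" where
  "online_output act T = concat (map (\<lambda>t. letters_with_code (act t)) [0..<T])"

lemma online_output_simps [simp]:
  "online_output act 0 = []"
  "online_output act (Suc T) = online_output act T @ letters_with_code (act T)"
  by (simp_all add: online_output_def)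

definition input_codes :: "nat \<Rightarrow> 's::finite val tuple \<Rightarrow> nat \<Rightarrow> nat list" where
  "input_codes n x t = map (\<lambda>j. sym_code (input_tape (x j) (int t))) [1..<Suc n]"

lemma prog_config_initial:
  "t2_initial M n x = prog_config n x (t2_init M) ((\<lambda>_. []), (\<lambda>_. 0), [])"
  by (auto simp: t2_initial_def prog_config_def stack_tape_def fun_eq_iff)

lemma bit_symbol_eq_2: "bit_symbol v = Aux 2 \<longleftrightarrow> v = Some True"
  using bit_symbol_eq[of v "Some True"] unfolding bit_symbol.simps .

text \<open>
  The machine keeps the code of its state on \<open>SA\<close> and repeats a program for one round until that
  program leaves a mark on \<open>SK\<close>. The first property describes the start of round \<open>T\<close>, the second one
  the halting configuration. The inequality \<open>T \<le> \<tau>\<close> will show that a machine without a halting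
  round never halts.
\<close>

theorem online_machine:
  fixes \<Phi> :: "nat list \<times> 'st::codable \<Rightarrow> 'st" and act :: "'st \<Rightarrow> nat"
  assumes "effective \<Phi>" "effective act"
  obtains M :: "'s::finite t2_machine" where
    "wf_t2 n M"
    "\<And>x S A T. S = online_state \<Phi> s0 (input_codes n x) \<Longrightarrow> A = (\<lambda>t. act (S (Suc t))) \<Longrightarrow>
       \<forall>t<T. A t \<noteq> 1 \<Longrightarrow>
       \<exists>\<tau>\<ge>T. t2_label (t2_run M n x \<tau>) \<noteq> t2_final M \<and> t2_out (t2_run M n x \<tau>) = online_output A T"
    "\<And>x S A T. S = online_state \<Phi> s0 (input_codes n x) \<Longrightarrow> A = (\<lambda>t. act (S (Suc t))) \<Longrightarrow>
       \<forall>t<T. A t \<noteq> 1 \<Longrightarrow> A T = 1 \<Longrightarrow>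
       \<exists>\<tau>. t2_label (t2_run M n x \<tau>) = t2_final M \<and> t2_out (t2_run M n x \<tau>) = online_output A T"
proof -
  obtain phi' where phi': "tree_rec phi'" "\<And>p. phi' (enc p) = enc (\<Phi> p)"
    using assms(1) by (rule effectiveE) blast
  obtain phi :: "'s prog" where phi: "realizes phi phi'"
    using tree_rec_realizable[OF phi'(1)] by blast
  have test: "\<exists>b :: 's prog. \<exists>g. realizes b g \<and> (\<forall>s. g (enc s) = enc (act s = c))" for c
    using effective_eq_const[OF assms(2), of c] tree_rec_realizable unfolding effective_def by metis
  obtain halt :: "'s prog" and halt' where
    halt: "realizes halt halt'" "\<And>s. halt' (enc s) = enc (act s = 1)"
    using test[of 1] by blast
  have "\<forall>a :: 's. \<exists>b :: 's prog. \<exists>g. realizes b g \<and> (\<forall>s. g (enc s) = enc (act s = sym_code (Letter a)))"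
    using test by blast
  then obtain em :: "'s \<Rightarrow> 's prog" and em' where
    em: "\<And>a. realizes (em a) (em' a)" "\<And>a s. em' a (enc s) = enc (act s = sym_code (Letter a))"
    by metis
  define round where "round = read_vector [1..<Suc n] ;; Push SA True ;; phi ;;
    emit_letters em letters ;; when_true halt (Push SK True)"
  define start where "start = (push_list (ser (enc s0)) :: 's prog)"
  define main where "main = start ;; Until SK (Some True) round"
  define M where "M = \<lparr>t2_labels = {0..prog_size main}, t2_init = 0, t2_final = prog_size main,
    t2_aux = {0, 1, 2}, t2_work = 4, t2_stm = code n main 0 (prog_size main)\<rparr>"
  have em_reads: "reads_within n (emit_letters em as)" for as
    using em(1) by (induction as) (auto simp: realizes_def)
  have "reads_within n (read_vector [1..<Suc n] :: 's prog)"
    by (rule reads_within_read_vector) auto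
  then have reads: "reads_within n main"
    using phi halt(1) em_reads
    by (auto simp: main_def start_def round_def realizes_def simp del: upt_Suc)
  have "wf_t2_stm M n (t2_stm M l)" if "l \<in> t2_labels M - {t2_final M}" for l
    using that code_wf[OF reads, of l 0 M "prog_size main"]
    by (force simp: M_def)
  then have "wf_t2 n M"
    unfolding wf_t2_def by (simp add: M_def)
  have carries: "carries M n main 0 (prog_size main)"
    by (simp add: carries_def M_def)
  let ?L = "prog_size start"
  note parts = carries_Then[OF carries[unfolded main_def], folded main_def, simplified]
    carries_Until[OF carries_Then(2)[OF carries[unfolded main_def], folded main_def], simplified]
  have round_reads: "reads_within n round" "reads_within n start"
    using reads by (auto simp: main_def)
  have head: "reaches M (prog_config n x ?L (S, r, w))
      (prog_config n x (if top_of (S SK) = Some True then prog_size main else Suc ?L) (S, r, w))" for x S r w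
    using reaches_if[OF parts(3) parts(4), of n x S r w]
    using prog_config_sel(5,6)[of n x _ S r w SK]
    by (simp add: stack_tape_top bit_symbol_eq_2)
  \<comment> \<open>The numbers of letters read at the start of round \<open>t\<close>.\<close>
  define r where "r t = (\<lambda>j. if j \<in> {1..n} then t else 0)" for t :: nat
  have round: "runs x round (stack_A (ser (enc s)), r t, w)
      ((stack_A (ser (enc (\<Phi> (input_codes n x t, s)))))
         (SK := if act (\<Phi> (input_codes n x t, s)) = 1 then [True] else []), r (Suc t),
       w @ letters_with_code (act (\<Phi> (input_codes n x t, s))))" for x s t w
  proof -
    let ?p = "(input_codes n x t, s)"
    have vec: "runs x (read_vector [1..<Suc n]) (stack_A (ser (enc s)), r t, w)
        (stack_A (ser (enc (input_codes n x t)) @ ser (enc s)), r (Suc t), w)"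
    proof (rule runs_eq[OF runs_read_vector])
      have "map (\<lambda>j. sym_code (input_tape (x j) (int (r t j)))) [1..<Suc n] = input_codes n x t"
        unfolding input_codes_def by (auto simp: r_def)
      moreover have "(\<lambda>j. if j \<in> set [1..<Suc n] then Suc (r t j) else r t j) = r (Suc t)"
        by (auto simp: r_def)
      ultimately show "(stack_A (ser (enc (map (\<lambda>j. sym_code (input_tape (x j) (int (r t j)))) [1..<Suc n])) @ ser (enc s)),
          \<lambda>j. if j \<in> set [1..<Suc n] then Suc (r t j) else r t j, w) =
        (stack_A (ser (enc (input_codes n x t)) @ ser (enc s)), r (Suc t), w)" by (simp only:)
    qed simp
    have push: "runs x (Push SA True) (stack_A (ser (enc (input_codes n x t)) @ ser (enc s)), r (Suc t), w)
        (stack_A (ser (enc ?p) @ []), r (Suc t), w)"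
      using runs_push_A[of x True] by (simp add: enc_prod_def)
    have phi: "runs x phi (stack_A (ser (enc ?p) @ []), r (Suc t), w)
        (stack_A (ser (enc (\<Phi> ?p)) @ []), r (Suc t), w)"
      using phi phi'(2)[of ?p] unfolding realizes_def by metis
    have emit: "runs x (emit_letters em letters) (stack_A (ser (enc (\<Phi> ?p)) @ []), r (Suc t), w)
        (stack_A (ser (enc (\<Phi> ?p)) @ []), r (Suc t), w @ letters_with_code (act (\<Phi> ?p)))"
      unfolding letters_with_code_def by (rule runs_emit_letters[OF em])
    have stop: "runs x (when_true halt (Push SK True))
        (stack_A (ser (enc (\<Phi> ?p)) @ []), r (Suc t), w @ letters_with_code (act (\<Phi> ?p)))
        ((stack_A (ser (enc (\<Phi> ?p))))(SK := if act (\<Phi> ?p) = 1 then [True] else []),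
          r (Suc t), w @ letters_with_code (act (\<Phi> ?p)))"
    proof (rule runs_when_true[OF halt])
      assume "act (\<Phi> ?p) = 1"
      then show "runs x (Push SK True)
        (stack_A (ser (enc (\<Phi> ?p)) @ []), r (Suc t), w @ letters_with_code (act (\<Phi> ?p)))
        ((stack_A (ser (enc (\<Phi> ?p))))(SK := if act (\<Phi> ?p) = 1 then [True] else []),
          r (Suc t), w @ letters_with_code (act (\<Phi> ?p)))"
        using runs.Push[of x SK True "stack_A (ser (enc (\<Phi> ?p)))"] by simp
    qed (auto simp: fun_eq_iff stack_A_def)
    show ?thesis
      unfolding round_def
      by (rule runs.Then[OF vec runs.Then[OF push runs.Then[OF phi runs.Then[OF emit stop]]]])
  qed
  have loop: "\<exists>\<tau>\<ge>T. t2_run M n x \<tau> = prog_config n x ?L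
      (stack_A (ser (enc (S T))), r T, online_output A T)"
    if "S = online_state \<Phi> s0 (input_codes n x)" "A = (\<lambda>t. act (S (Suc t)))" "\<forall>t<T. A t \<noteq> 1" for x S A T
    using that(3)
  proof (induction T)
    case 0
    have "runs x start (stack_A [], r 0, []) (stack_A (ser (enc s0)), r 0, [])"
      unfolding start_def using runs_push_list[of x "ser (enc s0)" "[]"] by simp
    from reaches_runs[OF this parts(1) round_reads(2)] have "reaches M (t2_initial M n x)
        (prog_config n x ?L (stack_A (ser (enc s0)), r 0, []))"
      by (simp add: prog_config_initial M_def stack_A_def r_def fun_upd_idem)
    then show ?case by (auto simp: reaches_def t2_run_def that)
  next
    case (Suc T)
    then obtain \<tau> where \<tau>: "\<tau> \<ge> T" "t2_run M n x \<tau> = prog_config n x ?L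
      (stack_A (ser (enc (S T))), r T, online_output A T)" by auto
    have "A T \<noteq> 1" using Suc.prems by simp
    then have "(stack_A (ser (enc (S (Suc T)))))(SK := []) = stack_A (ser (enc (S (Suc T))))"
      by (simp add: fun_upd_idem)
    then have "reaches M (prog_config n x (Suc ?L) (stack_A (ser (enc (S T))), r T, online_output A T))
        (prog_config n x ?L (stack_A (ser (enc (S (Suc T)))), r (Suc T), online_output A (Suc T)))"
      using reaches_runs[OF round parts(5) round_reads(1), of x "S T" T "online_output A T"] \<open>A T \<noteq> 1\<close> that
      by simp
    then have "reaches M (t2_run M n x \<tau>)
        (prog_config n x ?L (stack_A (ser (enc (S (Suc T)))), r (Suc T), online_output A (Suc T)))"
      unfolding \<tau>(2) using reaches_trans[OF head[of x "stack_A (ser (enc (S T)))" "r T" "online_output A T"]]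
      by simp
    then obtain d where "d > 0" "(t2_step M ^^ d) (t2_run M n x \<tau>) =
        prog_config n x ?L (stack_A (ser (enc (S (Suc T)))), r (Suc T), online_output A (Suc T))"
      unfolding reaches_def by blast
    then have "t2_run M n x (d + \<tau>) =
        prog_config n x ?L (stack_A (ser (enc (S (Suc T)))), r (Suc T), online_output A (Suc T))" "d + \<tau> \<ge> Suc T"
      using \<tau>(1) by (simp_all add: t2_run_def funpow_add)
    then show ?case by blast
  qed
  show thesis
  proof (rule that[OF \<open>wf_t2 n M\<close>])
    fix x :: "'s val tuple" and S A T
    assume *: "S = online_state \<Phi> s0 (input_codes n x)" "A = (\<lambda>t. act (S (Suc t)))" "\<forall>t<T. A t \<noteq> 1"
    obtain \<tau> where \<tau>: "\<tau> \<ge> T" "t2_run M n x \<tau> = prog_config n x ?L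
      (stack_A (ser (enc (S T))), r T, online_output A T)" using loop[OF *] by blast
    then show "\<exists>\<tau>\<ge>T. t2_label (t2_run M n x \<tau>) \<noteq> t2_final M \<and> t2_out (t2_run M n x \<tau>) = online_output A T"
      using parts(4) by (intro exI[of _ \<tau>]) (simp add: prog_config_sel)
    assume "A T = 1"
    then have "reaches M (prog_config n x (Suc ?L) (stack_A (ser (enc (S T))), r T, online_output A T))
        (prog_config n x ?L ((stack_A (ser (enc (S (Suc T)))))(SK := [True]), r (Suc T), online_output A T))"
      using reaches_runs[OF round parts(5) round_reads(1), of x "S T" T "online_output A T"] * by simp
    then have "reaches M (t2_run M n x \<tau>)
        (prog_config n x (prog_size main) ((stack_A (ser (enc (S (Suc T)))))(SK := [True]), r (Suc T), online_output A T))"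
      unfolding \<tau>(2)
      using reaches_trans[OF head[of x "stack_A (ser (enc (S T)))" "r T" "online_output A T"]]
        reaches_trans[OF _ head[of x "(stack_A (ser (enc (S (Suc T)))))(SK := [True])" "r (Suc T)" "online_output A T"]]
      by simp
    then obtain d where "(t2_step M ^^ d) (t2_run M n x \<tau>) =
        (prog_config n x (prog_size main) ((stack_A (ser (enc (S (Suc T)))))(SK := [True]), r (Suc T), online_output A T))"
      unfolding reaches_def by blast
    then have "t2_run M n x (d + \<tau>) =
        (prog_config n x (prog_size main) ((stack_A (ser (enc (S (Suc T)))))(SK := [True]), r (Suc T), online_output A T))"
      by (simp add: t2_run_def funpow_add)
    then show "\<exists>\<tau>. t2_label (t2_run M n x \<tau>) = t2_final M \<and> t2_out (t2_run M n x \<tau>) = online_output A T"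
      by (intro exI[of _ "d + \<tau>"]) (simp add: prog_config_sel M_def)
  qed
qed

lemma t2_run_Suc: "t2_run M n x (Suc t) = t2_step M (t2_run M n x t)"
  by (simp add: t2_run_def)

lemma t2_out_step: "\<exists>u. t2_out (t2_step M c) = t2_out c @ u"
  by (auto simp: t2_step_def split: t2_stm.split)

lemma t2_out_mono: "t \<le> t' \<Longrightarrow> \<exists>u. t2_out (t2_run M n x t') = t2_out (t2_run M n x t) @ u"
proof (induction t' rule: dec_induct)
  case (step m)
  then show ?case using t2_out_step[of M "t2_run M n x m"] by (auto simp: t2_run_Suc)
qed simp

lemma t2_run_final:
  assumes "t2_label (t2_run M n x t) = t2_final M" "t \<le> t'"
  shows "t2_run M n x t' = t2_run M n x t"
  using assms(2)
proof (induction t' rule: dec_induct)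
  case (step m)
  then show ?case using assms(1) by (simp add: t2_run_Suc t2_step_def)
qed simp

section \<open>Tapes with two-sided lists\<close>

text \<open>
  The cells to the left of the head, from right to left; the scanned cell and those to its right;
  the numbers of moves to the right and to the left made so far. The counters make it possible to
  return to cell \<open>0\<close>, from which the result of a generalized machine is read.
\<close>

type_synonym 'c ztape = "'c list \<times> 'c list \<times> nat \<times> nat"

text \<open>
  Beyond the end of a list there are default cells.
\<close>

definition nthd :: "'a \<Rightarrow> 'a list \<Rightarrow> nat \<Rightarrow> 'a" where
  "nthd d xs i = (if i < length xs then xs ! i else d)"

definition zread :: "'c \<Rightarrow> 'c ztape \<Rightarrow> 'c" where
  "zread d z = (case fst (snd z) of [] \<Rightarrow> d | a # _ \<Rightarrow> a)"

definition ztl :: "'a list \<Rightarrow> 'a list" where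
  "ztl xs = (case xs of [] \<Rightarrow> [] | _ # ys \<Rightarrow> ys)"

definition zwrite :: "'c \<Rightarrow> 'c ztape \<Rightarrow> 'c ztape" where
  "zwrite a z = (fst z, a # ztl (fst (snd z)), snd (snd z))"

definition zright :: "'c \<Rightarrow> 'c ztape \<Rightarrow> 'c ztape" where
  "zright d z = (zread d z # fst z, ztl (fst (snd z)), Suc (fst (snd (snd z))), snd (snd (snd z)))"

definition zleft :: "'c \<Rightarrow> 'c ztape \<Rightarrow> 'c ztape" where
  "zleft d z = (ztl (fst z), (case fst z of [] \<Rightarrow> d | a # _ \<Rightarrow> a) # fst (snd z),
     fst (snd (snd z)), Suc (snd (snd (snd z))))"

definition zinit :: "'c list \<Rightarrow> 'c ztape" where
  "zinit r = ([], r, 0, 0)"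

definition zhome :: "'c \<Rightarrow> 'c ztape \<Rightarrow> 'c ztape" where
  "zhome d z = (zright d ^^ snd (snd (snd z))) ((zleft d ^^ fst (snd (snd z))) z)"

fun zpos :: "'c ztape \<Rightarrow> int" where
  "zpos (l, r, p, q) = int p - int q"

text \<open>
  The tape with absolute cell numbers that is represented; by the lemmas below, operations on lists
  can then be reasoned about as operations on tapes.
\<close>

fun zabs :: "'c \<Rightarrow> 'c ztape \<Rightarrow> int \<Rightarrow> 'c" where
  "zabs d (l, r, p, q) k =
     (let j = k - (int p - int q) in if j \<ge> 0 then nthd d r (nat j) else nthd d l (nat (- j - 1)))"

lemma nthd_simps [simp]:
  "nthd d [] i = d" "nthd d (a # as) 0 = a" "nthd d (a # as) (Suc i) = nthd d as i"
  by (auto simp: nthd_def)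

lemma nthd_0: "nthd d xs 0 = (case xs of [] \<Rightarrow> d | a # _ \<Rightarrow> a)"
  by (cases xs) auto

lemma nthd_ztl [simp]: "nthd d (ztl xs) i = nthd d xs (Suc i)"
  by (cases xs) (auto simp: ztl_def)

lemma zread_zabs: "zread d z = zabs d z (zpos z)"
  by (cases z) (auto simp: zread_def nthd_0)

lemma zabs_zright [simp]: "zabs d (zright d z) = zabs d z"
proof
  fix k
  obtain l r p q where z: "z = (l, r, p, q)" by (cases z)
  define j where "j = k - (int p - int q)"
  consider "j < 0" | "j = 0" | "j > 0" by linarith
  then show "zabs d (zright d z) k = zabs d z k"
  proof cases
    case 1
    have "k - (int (Suc p) - int q) = j - 1" by (simp add: j_def)
    moreover have "nat (- (j - 1) - 1) = Suc (nat (- j - 1))" using 1 by simp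
    ultimately show ?thesis using 1 by (simp add: z zright_def Let_def j_def[symmetric] del: of_nat_Suc)
  next
    case 2
    have "k - (int (Suc p) - int q) = - 1" using 2 by (simp add: j_def)
    then show ?thesis using 2
      by (simp add: z zright_def zread_def nthd_0 Let_def j_def[symmetric] del: of_nat_Suc)
  next
    case 3
    have "k - (int (Suc p) - int q) = j - 1" by (simp add: j_def)
    moreover have "Suc (nat (j - 1)) = nat j" using 3 by simp
    ultimately show ?thesis using 3 by (simp add: z zright_def Let_def j_def[symmetric] del: of_nat_Suc)
  qed
qed

lemma zabs_zleft [simp]: "zabs d (zleft d z) = zabs d z"
proof
  fix k
  obtain l r p q where z: "z = (l, r, p, q)" by (cases z)
  define j where "j = k - (int p - int q)"
  have j1: "k - (int p - int (Suc q)) = j + 1" by (simp add: j_def)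
  consider "j < - 1" | "j = - 1" | "j \<ge> 0" by linarith
  then show "zabs d (zleft d z) k = zabs d z k"
  proof cases
    case 1
    moreover have "nat (- j - 1) = Suc (nat (- (j + 1) - 1))" using 1 by simp
    ultimately show ?thesis using j1
      by (simp add: z zleft_def Let_def j_def[symmetric] del: of_nat_Suc)
  next
    case 2
    then show ?thesis using j1
      by (simp add: z zleft_def nthd_0 Let_def j_def[symmetric] del: of_nat_Suc)
  next
    case 3
    moreover have "nat (j + 1) = Suc (nat j)" using 3 by simp
    ultimately show ?thesis using j1
      by (simp add: z zleft_def Let_def j_def[symmetric] del: of_nat_Suc)
  qed
qed

lemma zabs_zwrite [simp]: "zabs d (zwrite a z) = (zabs d z)(zpos z := a)"
proof
  fix k
  obtain l r p q where z: "z = (l, r, p, q)" by (cases z)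
  define j where "j = k - (int p - int q)"
  consider "j < 0" | "j = 0" | "j > 0" by linarith
  then show "zabs d (zwrite a z) k = ((zabs d z)(zpos z := a)) k"
  proof cases
    case 3
    then have "nat j = Suc (nat (j - 1))" "k \<noteq> int p - int q" by (auto simp: j_def)
    then show ?thesis using 3 by (simp add: z zwrite_def Let_def j_def[symmetric])
  qed (auto simp: z zwrite_def Let_def j_def)
qed

lemma zpos_simps [simp]:
  "zpos (zright d z) = zpos z + 1" "zpos (zleft d z) = zpos z - 1" "zpos (zwrite a z) = zpos z"
  "zpos (zinit r) = 0"
  by (cases z; simp add: zright_def zleft_def zwrite_def zinit_def)+

lemma zabs_zinit: "zabs d (zinit r) k = (if k \<ge> 0 then nthd d r (nat k) else d)"
  by (simp add: zinit_def)

lemma zread_zhome: "zread d (zhome d z) = zabs d z 0"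
proof -
  have "zabs d ((zright d ^^ m) y) = zabs d y \<and> zpos ((zright d ^^ m) y) = zpos y + int m" for m y
    by (induction m) auto
  moreover have "zabs d ((zleft d ^^ m) y) = zabs d y \<and> zpos ((zleft d ^^ m) y) = zpos y - int m" for m y
    by (induction m) auto
  ultimately show ?thesis by (cases z) (simp add: zread_zabs zhome_def del: zabs.simps)
qed

lemma effective_ztl [eff]: "effective f \<Longrightarrow> effective (\<lambda>x. ztl (f x))"
  unfolding ztl_def by (intro eff)

lemma effective_zread [eff]:
  "effective f \<Longrightarrow> effective (\<lambda>x. zread d (f x))"
  unfolding zread_def by (intro eff)

lemma effective_zwrite [eff]:
  "effective g \<Longrightarrow> effective f \<Longrightarrow> effective (\<lambda>x. zwrite (g x) (f x))"
  unfolding zwrite_def by (intro eff)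

lemma effective_zright [eff]:
  "effective f \<Longrightarrow> effective (\<lambda>x. zright d (f x))"
  unfolding zright_def by (intro eff)

lemma effective_zleft [eff]:
  "effective f \<Longrightarrow> effective (\<lambda>x. zleft d (f x))"
  unfolding zleft_def by (intro eff)

lemma effective_zinit [eff]:
  "effective f \<Longrightarrow> effective (\<lambda>x. zinit (f x))"
  unfolding zinit_def by (intro eff)

lemma effective_zhome [eff]:
  "effective f \<Longrightarrow> effective (\<lambda>x. zhome d (f x))"
  unfolding zhome_def by (intro eff)

lemma effective_nthd [eff]:
  assumes "effective f"
  shows "effective (\<lambda>x. nthd d (f x) i)"
proof -
  have "effective (\<lambda>xs. nthd d xs i)"
  proof (induction i)
    case 0
    show ?case unfolding nthd_0 by (intro eff)
  next
    case (Suc i)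
    from effective_comp[OF Suc effective_ztl[OF effective_id]] show ?case by simp
  qed
  from effective_comp[OF this assms] show ?thesis .
qed

lemma effective_list_update [eff]:
  fixes f :: "'a::codable \<Rightarrow> 'c::codable list"
  assumes "effective f" "effective g"
  shows "effective (\<lambda>x. (f x)[i := g x])"
proof -
  have "effective (\<lambda>p :: 'c list \<times> 'c. (fst p)[i := snd p])"
  proof (induction i)
    case 0
    have eq: "(\<lambda>p :: 'c list \<times> 'c. (fst p)[0 := snd p]) = (\<lambda>p. case fst p of [] \<Rightarrow> [] | _ # ys \<Rightarrow> snd p # ys)"
      by (rule ext) (simp split: list.split)
    show ?case unfolding eq by (intro eff)
  next
    case (Suc i)
    have eq: "(\<lambda>p :: 'c list \<times> 'c. (fst p)[Suc i := snd p]) =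
        (\<lambda>p. case fst p of [] \<Rightarrow> [] | y # ys \<Rightarrow> y # ys[i := snd p])"
      by (rule ext) (simp split: list.split)
    have "effective (\<lambda>q :: ('c list \<times> 'c) \<times> 'c \<times> 'c list. (snd (snd q))[i := snd (fst q)])"
      by (rule effective_comp[OF Suc effective_Pair[OF
            effective_snd[OF effective_snd[OF effective_id]]
            effective_snd[OF effective_fst[OF effective_id]]], simplified])
    then show ?case unfolding eq by (intro effective_case_list effective_Cons eff) 
  qed
  from effective_comp[OF this effective_Pair[OF assms]] show ?thesis by simp
qed

section \<open>Type-2 machines on finite approximations of their inputs\<close>

type_synonym approx = "nat list \<times> bool"

text \<open>
  Words and sequences are treated alike through the content of an input tape. If the flag \<open>snd a\<close> is
  set, \<open>fst a\<close> is the complete value; otherwise at least the first \<open>D\<close> letters are known. Note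
  that for an unset flag \<open>D\<close> cannot exceed the length of a word, so sufficiently precise
  approximations of a word are complete.
\<close>

definition approximates :: "nat \<Rightarrow> approx \<Rightarrow> 's::finite val \<Rightarrow> bool" where
  "approximates D a v \<longleftrightarrow>
     (\<forall>i < length (fst a). input_tape v (int i) \<noteq> blank \<and> fst a ! i = sym_code (input_tape v (int i))) \<and>
     (if snd a then input_tape v (int (length (fst a))) = blank else D \<le> length (fst a))"

lemma approximates_mono: "approximates D a v \<Longrightarrow> D' \<le> D \<Longrightarrow> approximates D' a v"
  by (auto simp: approximates_def split: if_splits)

lemma input_tape_beyond_blank:
  assumes "input_tape v (int i) = blank" "i \<le> j"
  shows "input_tape v (int j) = blank"
  using assms by (cases v) (auto split: if_splits)

lemma input_tape_negative [simp]: "z < 0 \<Longrightarrow> input_tape v z = blank"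
  by (cases v) auto

text \<open>
  The symbol with code \<open>1\<close> marks the end of the known part.
\<close>

definition approx_tape :: "approx \<Rightarrow> nat ztape" where
  "approx_tape a = zinit (fst a @ (if snd a then [] else [1]))"

lemma zpos_approx_tape [simp]: "zpos (approx_tape a) = 0"
  by (simp add: approx_tape_def)

lemma zabs_approx_tape:
  assumes "approximates D a v" "\<not> snd a \<Longrightarrow> h \<le> int (length (fst a))"
  shows "zabs 0 (approx_tape a) h =
    (if \<not> snd a \<and> h = int (length (fst a)) then 1 else sym_code (input_tape v h))"
proof (cases "0 \<le> h \<and> h < int (length (fst a))")
  case True
  then obtain i where "h = int i" "i < length (fst a)" by (metis of_nat_less_iff nat_0_le)
  then show ?thesis using assms(1)
    by (auto simp: approx_tape_def zabs_zinit nthd_def nth_append approximates_def)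
next
  case False
  show ?thesis
  proof (cases "h < 0")
    case True
    then show ?thesis by (simp add: approx_tape_def zabs_zinit)
  next
    case False
    then obtain j where j: "h = int j" "length (fst a) \<le> j"
      using \<open>\<not> (0 \<le> h \<and> h < int (length (fst a)))\<close> by (metis nat_0_le not_le of_nat_le_iff)
    show ?thesis
    proof (cases "snd a")
      case True
      then have "input_tape v (int j) = blank"
        using assms(1) input_tape_beyond_blank[OF _ j(2)] by (auto simp: approximates_def)
      then show ?thesis using True j by (simp add: approx_tape_def zabs_zinit nthd_def)
    next
      case False
      then have "j = length (fst a)" using assms(2) j by simp
      then show ?thesis using False j(1) by (simp add: approx_tape_def zabs_zinit nthd_def)
    qed
  qed
qed

type_synonym apx_config = "nat \<times> nat ztape list \<times> nat list"

definition apx_tape :: "apx_config \<Rightarrow> nat \<Rightarrow> nat ztape" where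
  "apx_tape z i = nthd (zinit []) (fst (snd z)) i"

text \<open>
  A machine that scans the end mark stays where it is. It suffices to check this before a move to the
  right, which could otherwise go past the mark, and before a symbol is examined.
\<close>

fun apx_exec :: "'s::finite t2_stm \<Rightarrow> apx_config \<Rightarrow> apx_config" where
  "apx_exec (T2_Right i l') z =
     (if zread 0 (apx_tape z i) = 1 then z
      else (l', (fst (snd z))[i := zright 0 (apx_tape z i)], snd (snd z)))"
| "apx_exec (T2_Left i l') z = (l', (fst (snd z))[i := zleft 0 (apx_tape z i)], snd (snd z))"
| "apx_exec (T2_Write i a l') z =
     (l', (fst (snd z))[i := zwrite (sym_code a) (apx_tape z i)], snd (snd z))"
| "apx_exec (T2_If i a l' l'') z =
     (if zread 0 (apx_tape z i) = 1 then z
      else if zread 0 (apx_tape z i) = sym_code a then (l', snd z) else (l'', snd z))"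
| "apx_exec (T2_Out a l') z = (l', fst (snd z), snd (snd z) @ [sym_code (Letter a)])"

definition apx_step :: "'s::finite t2_machine \<Rightarrow> apx_config \<Rightarrow> apx_config" where
  "apx_step M z = (if fst z \<in> t2_labels M - {t2_final M} then apx_exec (t2_stm M (fst z)) z else z)"

definition apx_initial :: "'s::finite t2_machine \<Rightarrow> nat \<Rightarrow> (nat \<Rightarrow> approx) \<Rightarrow> apx_config" where
  "apx_initial M n a =
     (t2_init M, zinit [] # map (\<lambda>j. approx_tape (a j)) [1..<Suc n] @ replicate (t2_work M) (zinit []), [])"

definition apx_run :: "'s::finite t2_machine \<Rightarrow> nat \<Rightarrow> nat \<Rightarrow> (nat \<Rightarrow> approx) \<Rightarrow> approx" where
  "apx_run M n T a =
     (let z = (apx_step M ^^ T) (apx_initial M n a) in (snd (snd z), fst z = t2_final M))"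

lemma effective_apx_tape [eff]: "effective f \<Longrightarrow> effective (\<lambda>x. apx_tape (f x) i)"
  unfolding apx_tape_def by (intro eff)

lemma effective_apx_exec [eff]: "effective (apx_exec s)"
  by (cases s) (simp_all only: apx_exec.simps[abs_def], (intro eff)+)

lemma effective_apx_step [eff]:
  assumes "finite (t2_labels M)" "effective f"
  shows "effective (\<lambda>x. apx_step M (f x))"
proof -
  have "effective (apx_step M)"
    unfolding apx_step_def[abs_def] using assms(1)
    by (intro effective_finite_cases[where F = "\<lambda>l. apx_exec (t2_stm M l)"] eff) auto
  from effective_comp[OF this assms(2)] show ?thesis .
qed

lemma effective_apx_run:
  assumes "finite (t2_labels M)" "effective T" "\<And>j. j \<in> {1..n} \<Longrightarrow> effective (\<lambda>x. A x j)"
  shows "effective (\<lambda>x. apx_run M n (T x) (A x))"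
proof -
  have "effective (\<lambda>x. approx_tape (A x j))" if "j \<in> {1..n}" for j
    unfolding approx_tape_def using assms(3)[OF that] by (intro eff)
  then have "effective (\<lambda>x. apx_initial M n (A x))"
    unfolding apx_initial_def by (intro eff) auto
  then show ?thesis
    unfolding apx_run_def Let_def using assms(1,2) by (intro eff)
qed

text \<open>
  Work tapes are represented exactly. Input tapes agree with the real ones up to the end mark, which
  the head does not pass.
\<close>

definition apx_represents ::
    "'s::finite t2_machine \<Rightarrow> nat \<Rightarrow> 's val tuple \<Rightarrow> (nat \<Rightarrow> approx) \<Rightarrow> 's t2_config \<Rightarrow> apx_config \<Rightarrow> bool" where
  "apx_represents M n x a c z \<longleftrightarrow>
     fst z = t2_label c \<and> t2_label c \<in> t2_labels M \<and>
     length (fst (snd z)) = Suc (n + t2_work M) \<and>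
     snd (snd z) = map (sym_code \<circ> Letter) (t2_out c) \<and>
     (\<forall>i \<in> {1..n + t2_work M}. zpos (fst (snd z) ! i) = t2_head c i) \<and>
     (\<forall>i \<in> {n + 1..n + t2_work M}. zabs 0 (fst (snd z) ! i) = sym_code \<circ> t2_tape c i) \<and>
     (\<forall>i \<in> {1..n}. zabs 0 (fst (snd z) ! i) = zabs 0 (approx_tape (a i)) \<and>
        t2_tape c i = input_tape (x i) \<and>
        (\<not> snd (a i) \<longrightarrow> t2_head c i \<le> int (length (fst (a i)))))"

lemma apx_represents_tape:
  assumes "apx_represents M n x a c z" "i \<in> {1..n + t2_work M}"
  shows "apx_tape z i = fst (snd z) ! i" "i < length (fst (snd z))"
  using assms by (auto simp: apx_represents_def apx_tape_def nthd_def)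

lemma apx_represents_read:
  assumes "apx_represents M n x a c z" "\<forall>i \<in> {1..n}. approximates D (a i) (x i)"
    and "i \<in> {1..n + t2_work M}"
  shows "zread 0 (apx_tape z i) =
    (if i \<le> n \<and> \<not> snd (a i) \<and> t2_head c i = int (length (fst (a i))) then 1
     else sym_code (t2_tape c i (t2_head c i)))"
proof (cases "i \<le> n")
  case True
  then have i: "i \<in> {1..n}" using assms(3) by auto
  then have "zread 0 (apx_tape z i) = zabs 0 (approx_tape (a i)) (t2_head c i)"
    using assms apx_represents_tape(1)[OF assms(1,3)]
    by (auto simp: zread_zabs apx_represents_def simp del: zabs.simps)
  then show ?thesis
    using zabs_approx_tape[of D "a i" "x i" "t2_head c i"] assms i
    by (auto simp: apx_represents_def)
next
  case False
  then show ?thesis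
    using assms apx_represents_tape(1)[OF assms(1,3)]
    by (auto simp: zread_zabs apx_represents_def simp del: zabs.simps)
qed

text \<open>
  A step is simulated unless the head stands on the end mark of an input.
\<close>

lemma apx_step_represents:
  assumes "wf_t2 n M" "apx_represents M n x a c z" "\<forall>i \<in> {1..n}. approximates D (a i) (x i)"
  shows "apx_represents M n x a (t2_step M c) (apx_step M z) \<or>
    apx_step M z = z \<and> (\<exists>i \<in> {1..n}. \<not> snd (a i) \<and> t2_head c i = int (length (fst (a i))))"
proof (cases "t2_label c = t2_final M")
  case True
  then show ?thesis using assms(2)
    by (auto simp: apx_step_def t2_step_def apx_represents_def)
next
  case False
  have l: "fst z = t2_label c" "t2_label c \<in> t2_labels M - {t2_final M}"
    using assms(2) False by (auto simp: apx_represents_def)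
  then have wf: "wf_t2_stm M n (t2_stm M (t2_label c))"
    using assms(1) by (auto simp: wf_t2_def)
  have step: "apx_step M z = apx_exec (t2_stm M (t2_label c)) z"
    using l by (simp add: apx_step_def)
  note read = apx_represents_read[OF assms(2,3)]
  note tape = apx_represents_tape[OF assms(2)]
  show ?thesis
  proof (cases "t2_stm M (t2_label c)")
    case (T2_Right i l')
    then have i: "i \<in> {1..n + t2_work M}" "l' \<in> t2_labels M" using wf by auto
    show ?thesis
    proof (cases "i \<le> n \<and> \<not> snd (a i) \<and> t2_head c i = int (length (fst (a i)))")
      case True
      then show ?thesis using read[OF i(1)] i step T2_Right by auto
    next
      case noblock: False
      then have "apx_step M z = (l', (fst (snd z))[i := zright 0 (fst (snd z) ! i)], snd (snd z))"
        using read[OF i(1)] step T2_Right tape[OF i(1)] by auto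
      moreover have "t2_step M c = c\<lparr>t2_label := l', t2_head := (t2_head c)(i := t2_head c i + 1)\<rparr>"
        using T2_Right False by (simp add: t2_step_def)
      moreover have "t2_head c i + 1 \<le> int (length (fst (a i)))" if "i \<le> n" "\<not> snd (a i)"
        using assms(2) i that noblock by (fastforce simp: apx_represents_def)
      ultimately show ?thesis
        using assms(2) i tape[OF i(1)] by (auto simp: apx_represents_def nth_list_update)
    qed
  next
    case (T2_Left i l')
    then have i: "i \<in> {1..n + t2_work M}" "l' \<in> t2_labels M" using wf by auto
    have "apx_step M z = (l', (fst (snd z))[i := zleft 0 (fst (snd z) ! i)], snd (snd z))"
      using step T2_Left tape[OF i(1)] by simp
    moreover have "t2_step M c = c\<lparr>t2_label := l', t2_head := (t2_head c)(i := t2_head c i - 1)\<rparr>"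
      using T2_Left False by (simp add: t2_step_def)
    moreover have "t2_head c i - 1 \<le> int (length (fst (a i)))" if "i \<le> n" "\<not> snd (a i)"
      using assms(2) i that by (fastforce simp: apx_represents_def)
    ultimately show ?thesis
      using assms(2) i tape[OF i(1)] by (auto simp: apx_represents_def nth_list_update)
  next
    case (T2_Write i s l')
    then have i: "i \<in> {n + 1..n + t2_work M}" "i \<in> {1..n + t2_work M}" "l' \<in> t2_labels M"
      using wf by auto
    have "apx_step M z = (l', (fst (snd z))[i := zwrite (sym_code s) (fst (snd z) ! i)], snd (snd z))"
      using step T2_Write tape[OF i(2)] by simp
    moreover have "t2_step M c =
        c\<lparr>t2_label := l', t2_tape := (t2_tape c)(i := (t2_tape c i)(t2_head c i := s))\<rparr>"
      using T2_Write False by (simp add: t2_step_def)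
    moreover have "zabs 0 (fst (snd z) ! i) = sym_code \<circ> t2_tape c i"
      "zpos (fst (snd z) ! i) = t2_head c i"
      using assms(2) i by (auto simp: apx_represents_def)
    ultimately show ?thesis
      using assms(2) i tape[OF i(2)] by (auto simp: apx_represents_def nth_list_update fun_eq_iff)
  next
    case (T2_If i s l' l'')
    then have i: "i \<in> {1..n + t2_work M}" "l' \<in> t2_labels M" "l'' \<in> t2_labels M" using wf by auto
    show ?thesis
    proof (cases "i \<le> n \<and> \<not> snd (a i) \<and> t2_head c i = int (length (fst (a i)))")
      case True
      then show ?thesis using read[OF i(1)] i step T2_If by auto
    next
      case noblock: False
      then have "apx_step M z = (if t2_tape c i (t2_head c i) = s then l' else l'', snd z)"
        using read[OF i(1)] step T2_If by auto
      moreover have "t2_step M c = c\<lparr>t2_label := if t2_tape c i (t2_head c i) = s then l' else l''\<rparr>"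
        using T2_If False by (simp add: t2_step_def)
      ultimately show ?thesis using assms(2) i by (auto simp: apx_represents_def)
    qed
  next
    case (T2_Out s l')
    then have "l' \<in> t2_labels M" using wf by auto
    moreover have "apx_step M z = (l', fst (snd z), snd (snd z) @ [sym_code (Letter s)])"
      using step T2_Out by simp
    moreover have "t2_step M c = c\<lparr>t2_label := l', t2_out := t2_out c @ [s]\<rparr>"
      using T2_Out False by (simp add: t2_step_def)
    ultimately show ?thesis using assms(2) by (auto simp: apx_represents_def)
  qed
qed

lemma apx_represents_initial:
  assumes "wf_t2 n M" "\<forall>i \<in> {1..n}. approximates D (a i) (x i)"
  shows "apx_represents M n x a (t2_initial M n x) (apx_initial M n a)"
proof -
  have ts: "fst (snd (apx_initial M n a)) ! i = (if i \<le> n then approx_tape (a i) else zinit [])"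
    if "i \<in> {1..n + t2_work M}" for i
    using that by (auto simp: apx_initial_def nth_Cons' nth_append simp del: upt_Suc)
  show ?thesis
    unfolding apx_represents_def using assms(1) ts
    by (auto simp: t2_initial_def wf_t2_def zabs_zinit fun_eq_iff simp del: upt_Suc)
      (auto simp: apx_initial_def)
qed

text \<open>
  Hence a machine reaches the end mark of an approximation of precision \<open>D\<close> only after \<open>D\<close> steps.
\<close>

lemma t2_head_bound: "t2_head (t2_run M n x t) i \<le> int t"
proof (induction t)
  case 0
  show ?case by (simp add: t2_run_def t2_initial_def)
next
  case (Suc t)
  have "t2_head (t2_step M c) i \<le> t2_head c i + 1" for c
    by (auto simp: t2_step_def split: t2_stm.split)
  from this[of "t2_run M n x t"] Suc show ?case by (simp add: t2_run_Suc)
qed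

text \<open>
  The outcome is that of some genuine configuration, and of a late one if both the
  number of steps and the precision of the arguments are large.
\<close>

lemma apx_run_eq:
  assumes "wf_t2 n M" "\<forall>i \<in> {1..n}. approximates D (a i) (x i)"
  shows "\<exists>t \<ge> min T D. apx_run M n T a =
    (map (sym_code \<circ> Letter) (t2_out (t2_run M n x t)), t2_label (t2_run M n x t) = t2_final M)"
proof -
  have "\<exists>t \<ge> min T D. apx_represents M n x a (t2_run M n x t) ((apx_step M ^^ T) (apx_initial M n a))"
  proof (induction T)
    case 0
    then show ?case using apx_represents_initial[OF assms] by (intro exI[of _ 0]) (simp add: t2_run_def)
  next
    case (Suc T)
    then obtain t where t: "t \<ge> min T D"
      "apx_represents M n x a (t2_run M n x t) ((apx_step M ^^ T) (apx_initial M n a))" by blast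
    from apx_step_represents[OF assms(1) t(2) assms(2)] show ?case
    proof
      assume "apx_represents M n x a (t2_step M (t2_run M n x t))
        (apx_step M ((apx_step M ^^ T) (apx_initial M n a)))"
      then show ?case using t(1) by (intro exI[of _ "Suc t"]) (simp add: t2_run_Suc)
    next
      assume *: "apx_step M ((apx_step M ^^ T) (apx_initial M n a)) = (apx_step M ^^ T) (apx_initial M n a) \<and>
        (\<exists>i\<in>{1..n}. \<not> snd (a i) \<and> t2_head (t2_run M n x t) i = int (length (fst (a i))))"
      then obtain i where "i \<in> {1..n}" "\<not> snd (a i)" "t2_head (t2_run M n x t) i = int (length (fst (a i)))"
        by blast
      \<comment> \<open>The head moves at most one cell per step.\<close>
      then have "D \<le> t"
        using assms(2) t2_head_bound[of M n x t i] by (auto simp: approximates_def split: if_splits)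
      then show ?case using * t(2) by (intro exI[of _ t]) simp
    qed
  qed
  then show ?thesis by (auto simp: apx_run_def apx_represents_def Let_def)
qed

lemma approximates_Word: "approximates D (map (sym_code \<circ> Letter) w, True) (Word w)"
  by (auto simp: approximates_def)

lemma approximates_prefix:
  assumes "\<And>i. i < length w \<Longrightarrow> input_tape v (int i) = Letter (w ! i)" "D \<le> length w"
  shows "approximates D (map (sym_code \<circ> Letter) w, False) v"
  using assms by (auto simp: approximates_def)

text \<open>
  What has been written at any time approximates the result: letters are never withdrawn, and a
  machine that has halted has written everything.
\<close>

lemma t2_yields_approximates:
  assumes "t2_yields M n x y"
  shows "approximates 0 (map (sym_code \<circ> Letter) (t2_out (t2_run M n x t)),
      t2_label (t2_run M n x t) = t2_final M) y"
    and "\<exists>t0. \<forall>t \<ge> t0. approximates m (map (sym_code \<circ> Letter) (t2_out (t2_run M n x t)),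
      t2_label (t2_run M n x t) = t2_final M) y"
proof -
  have "(\<forall>t. approximates 0 (map (sym_code \<circ> Letter) (t2_out (t2_run M n x t)),
      t2_label (t2_run M n x t) = t2_final M) y) \<and>
    (\<exists>t0. \<forall>t \<ge> t0. approximates m (map (sym_code \<circ> Letter) (t2_out (t2_run M n x t)),
      t2_label (t2_run M n x t) = t2_final M) y)"
  proof (cases y)
    case (Word w)
    then obtain t0 where t0: "t2_label (t2_run M n x t0) = t2_final M" "t2_out (t2_run M n x t0) = w"
      using assms by auto
    have late: "t2_run M n x t = t2_run M n x t0" if "t \<ge> t0" for t
      using t2_run_final[OF t0(1) that] .
    have "approximates 0 (map (sym_code \<circ> Letter) (t2_out (t2_run M n x t)),
        t2_label (t2_run M n x t) = t2_final M) y" for t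
    proof (cases "t2_label (t2_run M n x t) = t2_final M")
      case True
      then have "t2_run M n x t = t2_run M n x t0"
        using late[of t] t2_run_final[OF True, of t0] by fastforce
      then show ?thesis using t0 approximates_Word[of 0 w] Word by simp
    next
      case False
      then have "t \<le> t0" using late t0 by (metis nat_le_linear)
      then obtain u where u: "w = t2_out (t2_run M n x t) @ u"
        using t2_out_mono[of t t0 M n x] t0(2) by auto
      have "approximates 0 (map (sym_code \<circ> Letter) (t2_out (t2_run M n x t)), False) y"
        unfolding Word by (rule approximates_prefix) (auto simp: u nth_append)
      then show ?thesis using False by simp
    qed
    moreover have "approximates m (map (sym_code \<circ> Letter) (t2_out (t2_run M n x t)),
        t2_label (t2_run M n x t) = t2_final M) y" if "t \<ge> t0" for t
      using late[OF that] t0 approximates_Word[of m w] Word by simp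
    ultimately show ?thesis by blast
  next
    case (Seq q)
    have pre: "approximates D (map (sym_code \<circ> Letter) (t2_out (t2_run M n x t)),
        t2_label (t2_run M n x t) = t2_final M) y" if "D \<le> length (t2_out (t2_run M n x t))" for t D
    proof -
      have "input_tape y (int i) = Letter (t2_out (t2_run M n x t) ! i)" if "i < length (t2_out (t2_run M n x t))" for i
      proof -
        have "t2_out (t2_run M n x t) = map q [0..<length (t2_out (t2_run M n x t))]"
          using assms Seq by simp
        then have "t2_out (t2_run M n x t) ! i = map q [0..<length (t2_out (t2_run M n x t))] ! i"
          by (rule arg_cong)
        then show ?thesis using that Seq by simp
      qed
      from approximates_prefix[OF this that] show ?thesis using assms Seq by simp
    qed
    have "\<exists>t. m \<le> length (t2_out (t2_run M n x t))" using assms Seq by simp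
    then obtain t0 where t0: "m \<le> length (t2_out (t2_run M n x t0))" by blast
    have "m \<le> length (t2_out (t2_run M n x t))" if "t \<ge> t0" for t
      using t0 t2_out_mono[OF that, of M n x] by auto
    then show ?thesis using pre by blast
  qed
  then show "approximates 0 (map (sym_code \<circ> Letter) (t2_out (t2_run M n x t)),
      t2_label (t2_run M n x t) = t2_final M) y"
    and "\<exists>t0. \<forall>t \<ge> t0. approximates m (map (sym_code \<circ> Letter) (t2_out (t2_run M n x t)),
      t2_label (t2_run M n x t) = t2_final M) y" by blast+
qed

theorem apx_run_sound:
  assumes "wf_t2 n M" "t2_yields M n x y" "\<forall>i \<in> {1..n}. approximates 0 (a i) (x i)"
  shows "approximates 0 (apx_run M n T a) y"
  using apx_run_eq[OF assms(1,3), of T] t2_yields_approximates(1)[OF assms(2)] by auto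

theorem apx_run_converges:
  assumes "wf_t2 n M" "t2_yields M n x y"
  shows "\<exists>D. \<forall>T \<ge> D. \<forall>a. (\<forall>i \<in> {1..n}. approximates D (a i) (x i)) \<longrightarrow>
    approximates m (apx_run M n T a) y"
proof -
  obtain D where D: "\<forall>t \<ge> D. approximates m (map (sym_code \<circ> Letter) (t2_out (t2_run M n x t)),
      t2_label (t2_run M n x t) = t2_final M) y"
    using t2_yields_approximates(2)[OF assms(2)] by blast
  show ?thesis
  proof (intro exI[of _ D] allI impI)
    fix T a assume "D \<le> T" "\<forall>i \<in> {1..n}. approximates D (a i) (x i)"
    then obtain t where "t \<ge> D" "apx_run M n T a =
      (map (sym_code \<circ> Letter) (t2_out (t2_run M n x t)), t2_label (t2_run M n x t) = t2_final M)"
      using apx_run_eq[OF assms(1), of D a x T] by auto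
    then show "approximates m (apx_run M n T a) y" using D by simp
  qed
qed

section \<open>Generalized Turing machines on finite approximations\<close>

text \<open>
  The functions used by a statement; a test is regarded as a function into the words.
\<close>

definition calls :: "('s, 's val, 'g, 'l) stm \<Rightarrow> nat \<Rightarrow> (nat \<Rightarrow> nat) \<Rightarrow> ('s val tuple \<rightharpoonup> 's val) \<Rightarrow> bool" where
  "calls s n ix f \<longleftrightarrow> (\<exists>i l'. s = Assign i n ix f l') \<or>
     (\<exists>g l' l''. s = Test n ix g l' l'' \<and> f = (\<lambda>x. map_option Word (g x)))"

type_synonym apx_cell = "nat \<times> approx"

type_synonym apx_gconfig = "nat \<times> apx_cell ztape list"

text \<open>
  \<open>machine l\<close> is a Type-2 machine for the function used at label \<open>l\<close>.
\<close>

locale gtm_simulation =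
  fixes N :: "('s::{finite, zero_neq_one}, 's val, 'g, 'l) gtm"
    and machine :: "'l \<Rightarrow> 's t2_machine"
  assumes wf: "wf_gtm N"
    and machine_wf: "\<And>l n ix f. l \<in> labels N - {final N} \<Longrightarrow> calls (Stm N l) n ix f \<Longrightarrow> wf_t2 n (machine l)"
    and machine_yields: "\<And>l n ix f x y. l \<in> labels N - {final N} \<Longrightarrow> calls (Stm N l) n ix f \<Longrightarrow>
      f x = Some y \<Longrightarrow> t2_yields (machine l) n x y"
begin

definition label_code :: "'l \<Rightarrow> nat" where
  "label_code = to_nat_on (labels N)"

definition glyph_code :: "'g \<Rightarrow> nat" where
  "glyph_code = to_nat_on (symbols N)"

lemma label_code_eq: "l \<in> labels N \<Longrightarrow> l' \<in> labels N \<Longrightarrow> label_code l = label_code l' \<longleftrightarrow> l = l'"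
  using wf by (simp add: label_code_def wf_gtm_def countable_finite)

lemma glyph_code_eq: "g \<in> symbols N \<Longrightarrow> g' \<in> symbols N \<Longrightarrow> glyph_code g = glyph_code g' \<longleftrightarrow> g = g'"
  using wf by (simp add: glyph_code_def wf_gtm_def countable_finite)

text \<open>
  In a cell a first component \<open>0\<close> announces data, and \<open>Suc g\<close> the symbol with code \<open>g\<close>.
\<close>

definition blank_cell :: apx_cell where
  "blank_cell = (Suc (glyph_code (blank_sym N)), [], False)"

definition gtape :: "apx_gconfig \<Rightarrow> nat \<Rightarrow> apx_cell ztape" where
  "gtape z i = nthd (zinit []) (snd z) i"

definition gcell :: "apx_gconfig \<Rightarrow> nat \<Rightarrow> apx_cell" where
  "gcell z i = zread blank_cell (gtape z i)"

text \<open>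
  The argument \<open>T\<close> bounds the number of steps of the machines called. An undecided test leaves the
  configuration unchanged.
\<close>

fun gexec :: "'s t2_machine \<Rightarrow> nat \<Rightarrow> ('s, 's val, 'g, 'l) stm \<Rightarrow> apx_gconfig \<Rightarrow> apx_gconfig" where
  "gexec M T (Right i l') z = (label_code l', (snd z)[i := zright blank_cell (gtape z i)])"
| "gexec M T (Left i l') z = (label_code l', (snd z)[i := zleft blank_cell (gtape z i)])"
| "gexec M T (Write i a l') z =
     (label_code l', (snd z)[i := zwrite (Suc (glyph_code a), [], False) (gtape z i)])"
| "gexec M T (IfSym i a l' l'') z =
     (if fst (gcell z i) = Suc (glyph_code a) then (label_code l', snd z) else (label_code l'', snd z))"
| "gexec M T (Assign i n ix f l') z =
     (label_code l', (snd z)[i := zwrite (0, apx_run M n T (\<lambda>j. snd (gcell z (ix j)))) (gtape z i)])"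
| "gexec M T (Test n ix f l' l'') z =
     (let r = apx_run M n T (\<lambda>j. snd (gcell z (ix j))) in
      if snd r then
        (case fst r of [] \<Rightarrow> z
         | a # _ \<Rightarrow> if a = sym_code (Letter 0 :: 's symbol) then (label_code l', snd z)
                    else (label_code l'', snd z))
      else z)"

definition decode_label :: "nat \<Rightarrow> 'l" where
  "decode_label = inv_into (labels N) label_code"

lemma decode_label [simp]: "l \<in> labels N \<Longrightarrow> decode_label (label_code l) = l"
  unfolding decode_label_def using label_code_eq by (intro inv_into_f_f inj_onI) auto

text \<open>
  Outside the codes of nonfinal labels nothing happens, so iterating beyond the final
  configuration is harmless.
\<close>

definition gstep :: "nat \<Rightarrow> apx_gconfig \<Rightarrow> apx_gconfig" where
  "gstep T z = (if fst z \<in> label_code ` (labels N - {final N})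
     then gexec (machine (decode_label (fst z))) T (Stm N (decode_label (fst z))) z else z)"

definition ginitial :: "(nat \<Rightarrow> approx) \<Rightarrow> apx_gconfig" where
  "ginitial a = (label_code (init N),
     map (\<lambda>i. zinit (if i \<in> {1..inputs N} then [(0, a i)] else [])) [0..<Suc (maxtape N)])"

definition gresult :: "nat \<Rightarrow> (nat \<Rightarrow> approx) \<Rightarrow> approx" where
  "gresult T a = (let z = (gstep T ^^ T) (ginitial a) in
     if fst z = label_code (final N) then snd (zread blank_cell (zhome blank_cell (gtape z 0)))
     else ([], False))"

lemma effective_gtape [eff]: "effective f \<Longrightarrow> effective (\<lambda>x. gtape (f x) i)"
  unfolding gtape_def by (intro eff)

lemma effective_gcell [eff]: "effective f \<Longrightarrow> effective (\<lambda>x. gcell (f x) i)"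
  unfolding gcell_def by (intro eff)

lemma effective_gexec:
  assumes "l \<in> labels N - {final N}"
  shows "effective (\<lambda>p. gexec (machine l) (fst p) (Stm N l) (snd p))"
proof -
  have run: "effective (\<lambda>p. apx_run (machine l) n (fst p) (\<lambda>j. snd (gcell (snd p) (ix j))))"
    if "calls (Stm N l) n ix f" for n ix f
    using machine_wf[OF assms that] by (intro effective_apx_run eff) (auto simp: wf_t2_def)
  show ?thesis
  proof (cases "Stm N l")
    case (Assign i n ix f l')
    then have "calls (Stm N l) n ix f" by (simp add: calls_def)
    note run = run[OF this]
    show ?thesis unfolding Assign gexec.simps by (intro eff run)
  next
    case (Test n ix f l' l'')
    then have "calls (Stm N l) n ix (\<lambda>x. map_option Word (f x))" by (auto simp: calls_def)
    note run = run[OF this]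
    show ?thesis unfolding Test gexec.simps Let_def by (intro eff run)
  qed (simp_all only: gexec.simps, (intro eff)+)
qed

lemma effective_gstep: "effective (\<lambda>p. gstep (fst p) (snd p))"
proof -
  have fin: "finite (label_code ` (labels N - {final N}))"
    using wf by (simp add: wf_gtm_def)
  have "effective (\<lambda>p. gexec (machine (decode_label i)) (fst p) (Stm N (decode_label i)) (snd p))"
    if "i \<in> label_code ` (labels N - {final N})" for i
  proof -
    from that obtain l where l: "l \<in> labels N - {final N}" "i = label_code l" by blast
    then have "decode_label i = l" by simp
    then show ?thesis using effective_gexec[OF l(1)] by simp
  qed
  from effective_finite_cases[where F = "\<lambda>i p. gexec (machine (decode_label i)) (fst p)
      (Stm N (decode_label i)) (snd p)", OF fin this effective_fst[OF effective_snd[OF effective_id]]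
      effective_snd[OF effective_id]]
  show ?thesis unfolding gstep_def .
qed

lemma effective_gresult:
  assumes "effective T" "\<And>i. i \<in> {1..inputs N} \<Longrightarrow> effective (\<lambda>x. A x i)"
  shows "effective (\<lambda>x. gresult (T x) (A x))"
proof -
  have "effective (\<lambda>x. zinit (if i \<in> {1..inputs N} then [(0 :: nat, A x i)] else []))" for i
    using assms(2)[of i] by (cases "i \<in> {1..inputs N}") (auto intro!: eff simp del: atLeastAtMost_iff)
  then have "effective (\<lambda>x. ginitial (A x))"
    unfolding ginitial_def by (intro effective_Pair effective_const effective_map_consts)
  moreover have "effective (\<lambda>p. gstep (T (fst p)) (snd p))"
    by (rule effective_binary[OF effective_gstep effective_comp[OF assms(1) effective_fst[OF effective_id]]
        effective_snd[OF effective_id]])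
  ultimately show ?thesis
    unfolding gresult_def Let_def using assms(1) by (intro eff)
qed

definition represents_cell :: "nat \<Rightarrow> apx_cell \<Rightarrow> ('s val, 'g) cell \<Rightarrow> bool" where
  "represents_cell D u c \<longleftrightarrow> (case c of Sym g \<Rightarrow> g \<in> symbols N \<and> fst u = Suc (glyph_code g)
     | Data v \<Rightarrow> fst u = 0 \<and> approximates D (snd u) v)"

definition represents :: "nat \<Rightarrow> ('s val, 'g, 'l) config \<Rightarrow> apx_gconfig \<Rightarrow> bool" where
  "represents D c z \<longleftrightarrow>
     fst z = label_code (label c) \<and> label c \<in> labels N \<and> length (snd z) = Suc (maxtape N) \<and>
     (\<forall>i \<le> maxtape N. zpos (snd z ! i) = head c i \<and>
        (\<forall>k. represents_cell D (zabs blank_cell (snd z ! i) k) (tape c i k)))"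

lemma represents_mono: "represents D c z \<Longrightarrow> D' \<le> D \<Longrightarrow> represents D' c z"
  unfolding represents_def represents_cell_def
  by (auto split: cell.splits intro: approximates_mono)

lemma represents_tape:
  "represents D c z \<Longrightarrow> i \<le> maxtape N \<Longrightarrow> gtape z i = snd z ! i \<and> i < length (snd z)"
  by (auto simp: represents_def gtape_def nthd_def)

lemma represents_origin:
  assumes "represents D c z"
  shows "represents_cell D (zabs blank_cell (gtape z 0) 0) (tape c 0 0)"
  using assms represents_tape[OF assms, of 0] unfolding represents_def by simp

lemma represents_scanned:
  "represents D c z \<Longrightarrow> i \<le> maxtape N \<Longrightarrow> represents_cell D (gcell z i) (scanned c i)"
  using represents_tape[of D c z i]
  by (auto simp: represents_def gcell_def zread_zabs scanned_def simp del: zabs.simps)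

lemma represents_args:
  assumes "represents D c z" "scanned_args c n ix x" "\<forall>j \<in> {1..n}. ix j \<le> maxtape N"
  shows "\<forall>j \<in> {1..n}. approximates D (snd (gcell z (ix j))) (x j)"
  using assms represents_scanned[OF assms(1)]
  by (fastforce simp: scanned_args_def represents_cell_def)

lemma represents_set_cell:
  assumes "represents D c z" "m \<le> D" "i \<le> maxtape N" "l' \<in> labels N" "represents_cell m u v"
  shows "represents m (c\<lparr>label := l', tape := set_cell c i v\<rparr>)
    (label_code l', (snd z)[i := zwrite u (gtape z i)])"
  using represents_mono[OF assms(1,2)] assms(3-5) represents_tape[OF assms(1,3)]
  by (auto simp: represents_def set_cell_def nth_list_update)

lemma represents_relabel:
  assumes "represents D c z" "m \<le> D" "l' \<in> labels N"
  shows "represents m (c\<lparr>label := l'\<rparr>) (label_code l', snd z)"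
  using represents_mono[OF assms(1,2)] assms(3) by (auto simp: represents_def)

text \<open>
  The precision demanded of the result of the function used is a hypothesis here, so that the lemma
  serves both for soundness and for convergence. A test can remain undecided only if it is known with
  precision at most \<open>1\<close>, as its result is a word of length \<open>1\<close>.
\<close>

lemma gstep_represents:
  assumes "represents D c z" "succ N c c'" "m \<le> D"
    and run: "\<And>n ix f x y. calls (Stm N (label c)) n ix f \<Longrightarrow> scanned_args c n ix x \<Longrightarrow> f x = Some y \<Longrightarrow>
      \<forall>j \<in> {1..n}. ix j \<le> maxtape N \<Longrightarrow>
      approximates m (apx_run (machine (label c)) n T (\<lambda>j. snd (gcell z (ix j)))) y"
  shows "represents m c' (gstep T z) \<or> m \<le> 1 \<and> gstep T z = z"
proof -
  have l: "label c \<in> labels N - {final N}" "fst z = label_code (label c)"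
    using assms(1,2) by (auto simp: represents_def succ_def)
  then have step: "gstep T z = gexec (machine (label c)) T (Stm N (label c)) z"
    by (auto simp: gstep_def)
  have exec: "exec (Stm N (label c)) c c'" using assms(2) by (simp add: succ_def)
  have wfs: "wf_stm N (Stm N (label c))" using l wf by (auto simp: wf_gtm_def)
  note rep = represents_mono[OF assms(1,3)]
  show ?thesis
  proof (cases "Stm N (label c)")
    case (Right i l')
    then show ?thesis using rep exec wfs represents_tape[OF rep, of i]
      by (auto simp: step represents_def nth_list_update)
  next
    case (Left i l')
    then show ?thesis using rep exec wfs represents_tape[OF rep, of i]
      by (auto simp: step represents_def nth_list_update)
  next
    case (Write i a l')
    then have "represents m c' (gstep T z)"
      using exec wfs by (auto simp: step represents_cell_def intro!: represents_set_cell[OF assms(1,3)])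
    then show ?thesis ..
  next
    case (IfSym i a l' l'')
    then have "fst (gcell z i) = Suc (glyph_code a) \<longleftrightarrow> scanned c i = Sym a"
      using wfs represents_scanned[OF assms(1), of i] glyph_code_eq
      by (auto simp: represents_cell_def split: cell.splits)
    then have "represents m c' (gstep T z)"
      using exec wfs IfSym represents_relabel[OF assms(1,3)] by (auto simp: step)
    then show ?thesis ..
  next
    case (Assign i n ix f l')
    then obtain x y where xy: "scanned_args c n ix x" "f x = Some y"
      "c' = c\<lparr>label := l', tape := set_cell c i (Data y)\<rparr>"
      using exec by auto
    have "approximates m (apx_run (machine (label c)) n T (\<lambda>j. snd (gcell z (ix j)))) y"
      using wfs Assign by (intro run[where f = f, OF _ xy(1,2)]) (auto simp: calls_def)
    then have "represents m c' (gstep T z)"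
      using Assign wfs xy(3)
      by (auto simp: step represents_cell_def intro!: represents_set_cell[OF assms(1,3)])
    then show ?thesis ..
  next
    case (Test n ix f l' l'')
    obtain x b where x: "scanned_args c n ix x" "f x = Some [b]"
      "b = 0 \<and> c' = c\<lparr>label := l'\<rparr> \<or> b = 1 \<and> c' = c\<lparr>label := l''\<rparr>"
      using exec Test by auto
    define r where "r = apx_run (machine (label c)) n T (\<lambda>j. snd (gcell z (ix j)))"
    have r: "approximates m r (Word [b])"
      unfolding r_def using wfs Test x(2)
      by (intro run[OF _ x(1), of "\<lambda>x. map_option Word (f x)"]) (auto simp: calls_def)
    show ?thesis
    proof (cases "snd r")
      case True
      have "length (fst r) = 1"
      proof (rule ccontr)
        assume "length (fst r) \<noteq> 1"
        then consider "length (fst r) = 0" | "1 < length (fst r)" by linarith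
        then show False
        proof cases
          case 1
          then show False using r True by (auto simp: approximates_def)
        next
          case 2
          then show False using r by (auto simp: approximates_def dest!: spec[of _ 1])
        qed
      qed
      then have "fst r = [sym_code (Letter b)]"
        using r by (auto simp: approximates_def length_Suc_conv)
      then have "represents m c' (gstep T z)"
        using x(3) Test True wfs represents_relabel[OF assms(1,3)]
        by (auto simp: step r_def[symmetric] simp del: sym_code.simps)
      then show ?thesis ..
    next
      case False
      have "length (fst r) \<le> 1"
        using r by (auto simp: approximates_def dest!: spec[of _ 1])
      then have "m \<le> 1" using r False by (auto simp: approximates_def)
      moreover have "gstep T z = z" using False Test by (simp add: step r_def[symmetric])
      ultimately show ?thesis by simp
    qed
  qed
qed

lemma gstep_sound:
  assumes "represents 0 c z" "succ N c c'"
  shows "represents 0 c' (gstep T z) \<or> gstep T z = z"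
proof -
  have l: "label c \<in> labels N - {final N}"
    using assms by (auto simp: represents_def succ_def)
  have "represents 0 c' (gstep T z) \<or> 0 \<le> (1 :: nat) \<and> gstep T z = z"
  proof (rule gstep_represents[OF assms])
    fix n ix f x y
    assume *: "calls (Stm N (label c)) n ix f" "scanned_args c n ix x" "f x = Some y"
      "\<forall>j \<in> {1..n}. ix j \<le> maxtape N"
    show "approximates 0 (apx_run (machine (label c)) n T (\<lambda>j. snd (gcell z (ix j)))) y"
      by (rule apx_run_sound[OF machine_wf[OF l *(1)] machine_yields[OF l *(1,3)]
            represents_args[OF assms(1) *(2,4)]])
  qed simp
  then show ?thesis by simp
qed

text \<open>
  The precision \<open>2\<close> forces tests to be decided.
\<close>

lemma gstep_converges:
  assumes "succ N c c'" "label c \<in> labels N"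
  shows "\<exists>D. \<forall>T \<ge> D. \<forall>z. represents D c z \<longrightarrow> represents m c' (gstep T z)"
proof -
  have l: "label c \<in> labels N - {final N}" using assms by (auto simp: succ_def)
  obtain D where D: "\<And>n ix f x y T a. calls (Stm N (label c)) n ix f \<Longrightarrow> scanned_args c n ix x \<Longrightarrow>
      f x = Some y \<Longrightarrow> T \<ge> D \<Longrightarrow> \<forall>i \<in> {1..n}. approximates D (a i) (x i) \<Longrightarrow>
      approximates (max m 2) (apx_run (machine (label c)) n T a) y"
  proof (cases "\<exists>n ix f x y. calls (Stm N (label c)) n ix f \<and> scanned_args c n ix x \<and> f x = Some y")
    case True
    then obtain n ix f x y where *: "calls (Stm N (label c)) n ix f" "scanned_args c n ix x" "f x = Some y"
      by blast
    have uniq: "n' = n \<and> ix' = ix \<and> f' = f" if "calls (Stm N (label c)) n' ix' f'" for n' ix' f'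
      using that *(1) by (auto simp: calls_def)
    obtain D where "\<forall>T \<ge> D. \<forall>a. (\<forall>i \<in> {1..n}. approximates D (a i) (x i)) \<longrightarrow>
        approximates (max m 2) (apx_run (machine (label c)) n T a) y"
      using apx_run_converges[OF machine_wf[OF l *(1)] machine_yields[OF l *(1,3)]] by blast
    then show thesis using that[of D] uniq scanned_args_unique[OF _ *(2)] *(3) by (metis option.inject)
  qed (use that in blast)
  show ?thesis
  proof (intro exI[of _ "max D (max m 2)"] allI impI)
    fix T z assume T: "max D (max m 2) \<le> T" and z: "represents (max D (max m 2)) c z"
    have "represents (max m 2) c' (gstep T z) \<or> max m 2 \<le> 1 \<and> gstep T z = z"
    proof (rule gstep_represents[OF z assms(1)])
      fix n ix f x y
      assume *: "calls (Stm N (label c)) n ix f" "scanned_args c n ix x" "f x = Some y"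
        "\<forall>j \<in> {1..n}. ix j \<le> maxtape N"
      show "approximates (max m 2) (apx_run (machine (label c)) n T (\<lambda>j. snd (gcell z (ix j)))) y"
        using T by (intro D[OF *(1-3)] represents_args[OF represents_mono[OF z] *(2,4)]) auto
    qed simp
    then show "represents m c' (gstep T z)" using represents_mono[of "max m 2" c' "gstep T z" m] by auto
  qed
qed

lemma represents_initial:
  assumes "\<forall>i \<in> {1..inputs N}. approximates D (a i) (x i)"
  shows "represents D (IC N x) (ginitial a)"
proof -
  have "snd (ginitial a) ! i = zinit (if i \<in> {1..inputs N} then [(0, a i)] else [])" if "i \<le> maxtape N" for i
    using that by (simp add: ginitial_def del: upt_Suc)
  moreover have "represents_cell D blank_cell (Sym (blank_sym N))"
    using wf by (simp add: represents_cell_def blank_cell_def wf_gtm_def)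
  moreover have "nthd blank_cell [u] (nat k) = (if k = 0 then u else blank_cell)" if "k \<ge> 0" for u k
    using that by (simp add: nthd_def)
  ultimately show ?thesis
    unfolding represents_def using assms wf
    by (auto simp: IC_def zabs_zinit represents_cell_def wf_gtm_def) (auto simp: ginitial_def)
qed

context
  fixes x y \<kappa> S
  assumes start: "\<kappa> 0 = IC N x"
    and steps: "\<And>t. t < S \<Longrightarrow> succ N (\<kappa> t) (\<kappa> (Suc t))"
    and accept: "accepting_config N (\<kappa> S) y"
begin

lemma gstep_final: "represents D (\<kappa> S) z \<Longrightarrow> gstep T z = z"
  using accept label_code_eq by (auto simp: gstep_def represents_def accepting_config_def)

text \<open>
  A stage represents some configuration of the computation, possibly one at which it is held up.
\<close>

lemma gresult_sound:
  assumes "\<forall>i \<in> {1..inputs N}. approximates 0 (a i) (x i)"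
  shows "approximates 0 (gresult T a) y"
proof -
  have "\<exists>s \<le> S. represents 0 (\<kappa> s) ((gstep T ^^ t) (ginitial a))" for t
  proof (induction t)
    case 0
    then show ?case using represents_initial[OF assms] start by (intro exI[of _ 0]) simp
  next
    case (Suc t)
    then obtain s where s: "s \<le> S" "represents 0 (\<kappa> s) ((gstep T ^^ t) (ginitial a))" by blast
    show ?case
    proof (cases "s = S")
      case True
      then show ?thesis using s gstep_final[of 0 _ T] by (intro exI[of _ S]) auto
    next
      case False
      then have "succ N (\<kappa> s) (\<kappa> (Suc s))" "Suc s \<le> S" using steps s(1) by auto
      from gstep_sound[OF s(2) this(1), of T] show ?thesis
      proof
        assume "represents 0 (\<kappa> (Suc s)) (gstep T ((gstep T ^^ t) (ginitial a)))"
        then show ?thesis using \<open>Suc s \<le> S\<close> by (intro exI[of _ "Suc s"]) simp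
      next
        assume "gstep T ((gstep T ^^ t) (ginitial a)) = (gstep T ^^ t) (ginitial a)"
        then show ?thesis using s by (intro exI[of _ s]) simp
      qed
    qed
  qed
  then obtain s where s: "s \<le> S" "represents 0 (\<kappa> s) ((gstep T ^^ T) (ginitial a))" by blast
  let ?z = "(gstep T ^^ T) (ginitial a)"
  show ?thesis
  proof (cases "fst ?z = label_code (final N)")
    case True
    then have "label (\<kappa> s) = final N"
      using s(2) wf label_code_eq by (auto simp: represents_def wf_gtm_def)
    then have "s = S" using steps[of s] s(1) by (auto simp: succ_def order.order_iff_strict)
    then have "represents_cell 0 (zabs blank_cell (gtape ?z 0) 0) (Data y)"
      using represents_origin[OF s(2)] accept by (simp add: accepting_config_def)
    then show ?thesis using True by (simp add: gresult_def Let_def zread_zhome represents_cell_def)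
  next
    case False
    then show ?thesis by (simp add: gresult_def Let_def approximates_def)
  qed
qed

text \<open>
  By induction on the number of steps: the precision needed before a step is determined backwards from
  the one wanted after it, hence the quantification over all precisions in the induction.
\<close>

lemma gresult_converges:
  assumes "\<forall>m. \<exists>T0. \<forall>T \<ge> T0. \<forall>i \<in> {1..inputs N}. approximates m (a T i) (x i)"
  shows "\<exists>T0. \<forall>T \<ge> T0. approximates m (gresult T (a T)) y"
proof -
  have "\<forall>m. \<exists>T0. \<forall>T \<ge> T0. represents m (\<kappa> t) ((gstep T ^^ t) (ginitial (a T)))" if "t \<le> S" for t
    using that
  proof (induction t)
    case 0
    then show ?case using represents_initial start assms by (metis funpow_0)
  next
    case (Suc t)
    show ?case
    proof
      fix m
      from Suc obtain T1 where "\<forall>T \<ge> T1. represents 0 (\<kappa> t) ((gstep T ^^ t) (ginitial (a T)))" by fastforce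
      then have "label (\<kappa> t) \<in> labels N" by (auto simp: represents_def)
      moreover have "succ N (\<kappa> t) (\<kappa> (Suc t))" using steps Suc.prems by simp
      ultimately obtain D where D: "\<forall>T \<ge> D. \<forall>z. represents D (\<kappa> t) z \<longrightarrow> represents m (\<kappa> (Suc t)) (gstep T z)"
        using gstep_converges by blast
      obtain T0 where "\<forall>T \<ge> T0. represents D (\<kappa> t) ((gstep T ^^ t) (ginitial (a T)))"
        using Suc by fastforce
      then have "\<forall>T \<ge> max D T0. represents m (\<kappa> (Suc t)) ((gstep T ^^ Suc t) (ginitial (a T)))"
        using D by (simp del: split_paired_All)
      then show "\<exists>T0. \<forall>T \<ge> T0. represents m (\<kappa> (Suc t)) ((gstep T ^^ Suc t) (ginitial (a T)))" by blast
    qed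
  qed
  then obtain T0 where T0: "\<forall>T \<ge> T0. represents m (\<kappa> S) ((gstep T ^^ S) (ginitial (a T)))" by blast
  have "approximates m (gresult T (a T)) y" if "T \<ge> max T0 S" for T
  proof -
    have rep: "represents m (\<kappa> S) ((gstep T ^^ S) (ginitial (a T)))" using T0 that by simp
    have "(gstep T ^^ (d + S)) (ginitial (a T)) = (gstep T ^^ S) (ginitial (a T))" for d
      using gstep_final[OF rep] by (induction d) simp_all
    from this[of "T - S"] have "represents m (\<kappa> S) ((gstep T ^^ T) (ginitial (a T)))"
      using rep that by simp
    note rep = this
    have "represents_cell m (zabs blank_cell (gtape ((gstep T ^^ T) (ginitial (a T))) 0) 0) (Data y)"
      using represents_origin[OF rep] accept by (simp add: accepting_config_def)
    then show ?thesis
      using rep accept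
      by (simp add: gresult_def Let_def zread_zhome represents_cell_def represents_def accepting_config_def)
  qed
  then show ?thesis by blast
qed

end

end

section \<open>Computability\<close>

lemma sym_code_eq_0: "sym_code u = 0 \<longleftrightarrow> u = blank"
  using sym_code_eq[of u blank] by simp

text \<open>
  \<open>R t\<close> is the approximation of \<open>y\<close> known at stage \<open>t\<close>, \<open>e t\<close> the number of letters written before,
  and \<open>A t\<close> the action. Although each stage writes at most one letter, every letter is written at
  some time, because all sufficiently late stages know it.
\<close>

lemma output_of_approximations:
  fixes R :: "nat \<Rightarrow> approx" and y :: "'s::finite val" and A e :: "nat \<Rightarrow> nat"
  assumes sound: "\<And>t. approximates 0 (R t) y"
    and conv: "\<And>m. \<exists>t0. \<forall>t \<ge> t0. approximates m (R t) y"
    and e0: "e 0 = 0"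
    and step: "\<And>t. if e t < length (fst (R t)) then e (Suc t) = Suc (e t) \<and> A t = fst (R t) ! e t
      else e (Suc t) = e t \<and> A t = (if snd (R t) then 1 else 0)"
  shows "length (online_output A t :: 's list) = e t"
    and "i < e t \<Longrightarrow> input_tape y (int i) = Letter (online_output A t ! i)"
    and "A t = 1 \<Longrightarrow> y = Word (online_output A t)"
    and "(\<exists>T. A T = 1) \<or> (\<forall>m. \<exists>T. m \<le> e T)"
    and "y = Word w \<Longrightarrow> \<exists>T. A T = 1"
proof -
  have emit: "e (Suc t) = Suc (e t) \<and> A t = fst (R t) ! e t" if "e t < length (fst (R t))" for t
    using step[of t] that by simp
  have idle: "e (Suc t) = e t \<and> A t = (if snd (R t) then 1 else 0)" if "\<not> e t < length (fst (R t))" for t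
    using step[of t] that by simp
  have letter: "\<exists>a. input_tape y (int (e t)) = Letter a \<and> A t = sym_code (Letter a)"
    if "e t < length (fst (R t))" for t
    using sound[of t] emit[OF that] that input_tape_cases[of y "int (e t)"]
    by (auto simp: approximates_def)
  have out: "length (online_output A t :: 's list) = e t \<and>
      (\<forall>i < e t. input_tape y (int i) = Letter (online_output A t ! i))" for t
  proof (induction t)
    case 0
    then show ?case by (simp add: e0)
  next
    case (Suc t)
    show ?case
    proof (cases "e t < length (fst (R t))")
      case True
      then obtain a where a: "input_tape y (int (e t)) = Letter a" "A t = sym_code (Letter a)"
        using letter by blast
      then have "online_output A (Suc t) = online_output A t @ [a]"
        by (simp del: sym_code.simps)
      then show ?thesis using Suc a(1) emit[OF True] by (auto simp: nth_append less_Suc_eq)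
    next
      case False
      then have "online_output A (Suc t) = (online_output A t :: 's list)" using idle[OF False] by simp
      then show ?thesis using Suc idle[OF False] by simp
    qed
  qed
  then show "length (online_output A t :: 's list) = e t"
    "i < e t \<Longrightarrow> input_tape y (int i) = Letter (online_output A t ! i)" by blast+
  show halt: "y = Word (online_output A t)" if "A t = 1" for t
  proof -
    have no: "\<not> e t < length (fst (R t))" using letter[of t] that by (auto simp del: sym_code.simps)
    then have "snd (R t)" using conjunct2[OF idle[OF no]] that by (cases "snd (R t)") simp_all
    then have bl: "input_tape y (int (length (fst (R t)))) = blank"
      using sound[of t] by (simp add: approximates_def)
    then have e: "e t = length (fst (R t))" using out[of t] no by (metis nat_neq_iff symbol.distinct(1))
    obtain w where w: "y = Word w" using bl by (cases y) auto
    have "length w \<le> e t" using bl e w by (auto split: if_splits)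
    moreover have "e t \<le> length w"
    proof (rule ccontr)
      assume "\<not> e t \<le> length w"
      then show False using out[of t] w by (auto dest!: spec[of _ "length w"])
    qed
    ultimately have "w = online_output A t"
      using out[of t] w by (intro nth_equalityI) auto
    then show ?thesis using w by simp
  qed
  have mono: "e t \<le> e t'" if "t \<le> t'" for t t'
    using that
  proof (induction t' rule: dec_induct)
    case (step n)
    then show ?case using emit[of n] idle[of n] by (cases "e n < length (fst (R n))") auto
  qed simp
  have grow: "(\<exists>T. A T = 1) \<or> (\<exists>T. m \<le> e T)" for m
  proof (induction m)
    case (Suc m)
    show ?case
    proof (cases "\<exists>T. A T = 1")
      case no_halt: False
      then obtain T where T: "m \<le> e T" using Suc by blast
      obtain t0 where t0: "\<forall>t \<ge> t0. approximates (Suc m) (R t) y" using conv by blast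
      define t where "t = max T t0"
      have "Suc m \<le> e (Suc t)"
      proof (cases "e t < length (fst (R t))")
        case True
        then show ?thesis using emit[OF True] T mono[of T t] by (simp add: t_def)
      next
        case False
        then have "\<not> snd (R t)" using idle[OF False] no_halt by auto
        then have "Suc m \<le> length (fst (R t))" using t0 by (auto simp: t_def approximates_def)
        then show ?thesis using False idle[OF False] by simp
      qed
      then show ?thesis by blast
    qed simp
  qed simp
  then show "(\<exists>T. A T = 1) \<or> (\<forall>m. \<exists>T. m \<le> e T)" by blast
  show "\<exists>T. A T = 1" if "y = Word w"
  proof (rule ccontr)
    assume "\<nexists>T. A T = 1"
    then obtain T where "Suc (length w) \<le> e T" using grow by blast
    then have "input_tape y (int (length w)) \<noteq> blank" using out[of T] by auto
    then show False using that by simp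
  qed
qed

lemma t2_yields_unique: "t2_yields M n x v \<Longrightarrow> t2_yields M n x v' \<Longrightarrow> v = v'"
proof (cases v; cases v')
  fix w w' assume *: "t2_yields M n x v" "t2_yields M n x v'" "v = Word w" "v' = Word w'"
  then obtain t t' where t: "t2_label (t2_run M n x t) = t2_final M" "t2_out (t2_run M n x t) = w"
    "t2_label (t2_run M n x t') = t2_final M" "t2_out (t2_run M n x t') = w'" by auto
  have "t2_run M n x (max t t') = t2_run M n x t" "t2_run M n x (max t t') = t2_run M n x t'"
    by (rule t2_run_final[OF t(1)] t2_run_final[OF t(3)], simp)+
  then show ?thesis using t(2,4) *(3,4) by simp
next
  fix q q' assume *: "t2_yields M n x v" "t2_yields M n x v'" "v = Seq q" "v' = Seq q'"
  have "q m = q' m" for m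
  proof -
    have "\<exists>t. Suc m \<le> length (t2_out (t2_run M n x t))" using * by simp
    then obtain t where t: "m < length (t2_out (t2_run M n x t))" by (auto simp: Suc_le_eq)
    have "t2_out (t2_run M n x t) = map q [0..<length (t2_out (t2_run M n x t))]"
      "t2_out (t2_run M n x t) = map q' [0..<length (t2_out (t2_run M n x t))]"
      using * by simp_all
    then have "map q [0..<length (t2_out (t2_run M n x t))] ! m = map q' [0..<length (t2_out (t2_run M n x t))] ! m"
      by simp
    then show ?thesis using t by simp
  qed
  then show ?thesis using * by auto
qed auto

text \<open>
  The result of a Type-2 machine is unique, so \<open>M\<close> computes some partial function, and this is an
  extension of \<open>f\<close>.
\<close>

lemma computable_pfunI:
  assumes "wf_t2 n M" "\<And>x y. f x = Some y \<Longrightarrow> x \<in> PiE {1..n} D \<and> y \<in> R \<and> t2_yields M n x y"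
  shows "computable_pfun n D R f"
proof -
  define P where "P x v \<longleftrightarrow> x \<in> PiE {1..n} D \<and> v \<in> R \<and> t2_yields M n x v" for x v
  define g where "g x = (if \<exists>v. P x v then Some (THE v. P x v) else None)" for x
  \<comment> \<open>A word needs a halting computation and a sequence an infinite one.\<close>
  have uniq: "P x v \<Longrightarrow> P x v' \<Longrightarrow> v = v'" for x v v'
    unfolding P_def using t2_yields_unique by blast
  have g: "g x = Some v \<longleftrightarrow> P x v" for x v
    unfolding g_def using uniq by (auto intro: theI the_equality split: if_splits)
  have "turing_computable n D R g"
    unfolding turing_computable_def t2_computes_def using assms(1) g by (auto simp: P_def)
  moreover have "f \<subseteq>\<^sub>m g"
    unfolding map_le_def using assms(2) g by (metis P_def domD)
  ultimately show ?thesis unfolding computable_pfun_def by blast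
qed

text \<open>
  Extending the approximation of an input by the next symbol read; the first blank completes a word.
\<close>

definition absorb :: "approx \<Rightarrow> nat \<Rightarrow> approx" where
  "absorb a s = (if snd a then a else if s = 0 then (fst a, True) else (fst a @ [s], False))"

lemma effective_absorb: "effective f \<Longrightarrow> effective g \<Longrightarrow> effective (\<lambda>x. absorb (f x) (g x))"
  unfolding absorb_def by (intro eff)

lemma absorb_approximates:
  assumes "approximates t a v" "\<not> snd a \<Longrightarrow> length (fst a) = t"
  shows "approximates (Suc t) (absorb a (sym_code (input_tape v (int t)))) v \<and>
    (\<not> snd (absorb a (sym_code (input_tape v (int t)))) \<longrightarrow>
      length (fst (absorb a (sym_code (input_tape v (int t))))) = Suc t)"
  using assms by (auto simp: absorb_def approximates_def sym_code_eq_0 nth_append less_Suc_eq)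

context gtm_simulation
begin

text \<open>
  The number of the stage, the approximations of the inputs, the number of letters written, and the
  last action.
\<close>

type_synonym state = "nat \<times> approx list \<times> nat \<times> nat"

text \<open>
  The list has a dummy entry at index \<open>0\<close>, so that the inputs have the same indices as their tapes.
\<close>

definition next_inputs :: "nat list \<times> state \<Rightarrow> approx list" where
  "next_inputs p = map (\<lambda>i. absorb (nthd ([], False) (fst (snd (snd p))) i) (nthd 0 (fst p) (i - 1)))
     [0..<Suc (inputs N)]"

definition stage_result :: "nat list \<times> state \<Rightarrow> approx" where
  "stage_result p = gresult (Suc (fst (snd p))) (nthd ([], False) (next_inputs p))"

definition stage :: "nat list \<times> state \<Rightarrow> state" where
  "stage p = (Suc (fst (snd p)), next_inputs p,
     (case (ztl ^^ fst (snd (snd (snd p)))) (fst (stage_result p)) of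
        [] \<Rightarrow> (fst (snd (snd (snd p))), if snd (stage_result p) then 1 else 0)
      | c # _ \<Rightarrow> (Suc (fst (snd (snd (snd p)))), c)))"

lemma effective_stage: "effective stage"
proof -
  have inputs: "effective next_inputs"
    unfolding next_inputs_def[abs_def] by (intro eff effective_absorb)
  have result: "effective stage_result"
    unfolding stage_result_def[abs_def] by (intro effective_gresult eff inputs)
  note result' = effective_comp[OF result]
  show ?thesis
    unfolding stage_def[abs_def] by (intro eff inputs result result')
qed

theorem gtm_fun_computable: "computable_pfun (inputs N) (spaces N) (spaces N 0) (gtm_fun N)"
proof -
  let ?k = "inputs N"
  define s0 :: state where "s0 = (0, [], 0, 0)"
  show ?thesis
  proof (rule online_machine[OF effective_stage
        effective_snd[OF effective_snd[OF effective_snd[OF effective_id]]], of ?k s0])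
    fix M :: "'s t2_machine"
    assume M: "wf_t2 ?k M"
      and going: "\<And>x S A T. S = online_state stage s0 (input_codes ?k x) \<Longrightarrow>
       A = (\<lambda>t. snd (snd (snd (S (Suc t))))) \<Longrightarrow> \<forall>t<T. A t \<noteq> 1 \<Longrightarrow>
       \<exists>\<tau>\<ge>T. t2_label (t2_run M ?k x \<tau>) \<noteq> t2_final M \<and> t2_out (t2_run M ?k x \<tau>) = online_output A T"
      and halting: "\<And>x S A T. S = online_state stage s0 (input_codes ?k x) \<Longrightarrow>
       A = (\<lambda>t. snd (snd (snd (S (Suc t))))) \<Longrightarrow> \<forall>t<T. A t \<noteq> 1 \<Longrightarrow> A T = 1 \<Longrightarrow>
       \<exists>\<tau>. t2_label (t2_run M ?k x \<tau>) = t2_final M \<and> t2_out (t2_run M ?k x \<tau>) = online_output A T"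
    show ?thesis
    proof (rule computable_pfunI[OF M])
      fix x y assume "gtm_fun N x = Some y"
      then have yields: "gtm_yields N x y" by (simp add: gtm_fun_eq_Some_iff)
      then obtain \<kappa> B where run: "\<kappa> 0 = IC N x" "\<And>t. t < B \<Longrightarrow> succ N (\<kappa> t) (\<kappa> (Suc t))"
        "accepting_config N (\<kappa> B) y" using gtm_yields_run[OF yields] by blast
      define S where "S = online_state stage s0 (input_codes ?k x)"
      define A where "A = (\<lambda>t. snd (snd (snd (S (Suc t)))))"
      define e where "e t = fst (snd (snd (S t)))" for t
      define a where "a t = nthd ([], False) (fst (snd (S t)))" for t
      \<comment> \<open>The result that determines state \<open>Suc t\<close>: the letters of round \<open>t\<close> have been absorbed before.\<close>
      define R where "R t = gresult (Suc t) (a (Suc t))" for t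
      have S_Suc: "S (Suc t) = stage (input_codes ?k x t, S t)" for t by (simp add: S_def)
      have time: "fst (S t) = t" for t
        by (induction t) (simp_all add: S_def s0_def stage_def)
      have ins: "fst (snd (S (Suc t))) = next_inputs (input_codes ?k x t, S t)" for t
        by (simp add: S_Suc stage_def)
      have res: "stage_result (input_codes ?k x t, S t) = R t" for t
        by (simp add: stage_result_def R_def a_def ins time)
      have inputs: "approximates t (a t i) (x i) \<and> (\<not> snd (a t i) \<longrightarrow> length (fst (a t i)) = t)"
        if i: "i \<in> {1..?k}" for t i
      proof (induction t)
        case 0
        then show ?case by (simp add: a_def S_def s0_def approximates_def)
      next
        case (Suc t)
        have "nthd 0 (input_codes ?k x t) (i - 1) = sym_code (input_tape (x i) (int t))"
          using i by (auto simp: input_codes_def nthd_def simp del: upt_Suc)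
        then have "a (Suc t) i = absorb (a t i) (sym_code (input_tape (x i) (int t)))"
          using i unfolding a_def ins next_inputs_def
          by (auto simp: nthd_def simp del: upt_Suc)
        then show ?case using absorb_approximates[of t "a t i" "x i"] Suc by simp
      qed
      have "ztl xs = tl xs" for xs :: "nat list" by (cases xs) (simp_all add: ztl_def)
      then have ztl_funpow: "(ztl ^^ n) xs = drop n xs" for n and xs :: "nat list"
        by (induction n) (simp_all add: drop_Suc tl_drop)
      have approx: "approximates m (a t i) (x i)" if "m \<le> t" "i \<in> {1..?k}" for m t i
        using inputs[OF that(2), of t] approximates_mono that(1) by blast
      have sound: "approximates 0 (R t) y" for t
        unfolding R_def by (rule gresult_sound[OF run]) (use approx in auto)
      have conv: "\<exists>t0. \<forall>t \<ge> t0. approximates m (R t) y" for m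
      proof -
        have "\<exists>T0. \<forall>T \<ge> T0. approximates m (gresult T (a T)) y"
          by (rule gresult_converges[OF run]) (use approx in blast)+
        then show ?thesis unfolding R_def by (meson le_SucI)
      qed
      have "e 0 = 0" by (simp add: e_def S_def s0_def)
      have step: "if e t < length (fst (R t)) then e (Suc t) = Suc (e t) \<and> A t = fst (R t) ! e t
          else e (Suc t) = e t \<and> A t = (if snd (R t) then 1 else 0)" for t
      proof (cases "e t < length (fst (R t))")
        case True
        then have "drop (e t) (fst (R t)) = fst (R t) ! e t # drop (Suc (e t)) (fst (R t))"
          by (simp add: Cons_nth_drop_Suc)
        then show ?thesis using True by (simp add: e_def A_def S_Suc stage_def res ztl_funpow)
      next
        case False
        then have "drop (e t) (fst (R t)) = []" by simp
        then show ?thesis using False by (simp add: e_def A_def S_Suc stage_def res ztl_funpow)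
      qed
      note out = output_of_approximations[OF sound conv \<open>e 0 = 0\<close> step]
      have "t2_yields M ?k x y"
      proof (cases y)
        case (Word w)
        then have ex: "\<exists>T. A T = 1" by (rule out(5))
        define T where "T = (LEAST T. A T = 1)"
        have "A T = 1" unfolding T_def using ex by (rule LeastI_ex)
        moreover have "\<forall>t<T. A t \<noteq> 1" unfolding T_def using not_less_Least by blast
        ultimately show ?thesis using halting[OF S_def A_def] out(3)[of T] Word by auto
      next
        case (Seq q)
        have nohalt: "A t \<noteq> 1" for t using out(3)[of t] Seq by auto
        have prefix: "online_output A t = map q [0..<e t]" for t
          using out(1)[of t] out(2)[of _ t] Seq by (intro nth_equalityI) auto
        have late: "\<exists>\<tau>\<ge>T. t2_label (t2_run M ?k x \<tau>) \<noteq> t2_final M \<and>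
            t2_out (t2_run M ?k x \<tau>) = map q [0..<e T]" for T
          using going[OF S_def A_def, of T] nohalt prefix by simp
        have "t2_label (t2_run M ?k x t) \<noteq> t2_final M" for t
          using late[of t] t2_run_final[of M ?k x t] by metis
        moreover have "t2_out (t2_run M ?k x t) = map q [0..<length (t2_out (t2_run M ?k x t))]" for t
        proof -
          obtain \<tau> where "\<tau> \<ge> t" "t2_out (t2_run M ?k x \<tau>) = map q [0..<e t]" using late[of t] by blast
          then obtain u where u: "map q [0..<e t] = t2_out (t2_run M ?k x t) @ u"
            using t2_out_mono[of t \<tau> M ?k x] by auto
          have "length (t2_out (t2_run M ?k x t)) \<le> e t"
            using arg_cong[OF u, of length] by simp
          then have "take (length (t2_out (t2_run M ?k x t))) (map q [0..<e t]) =
              map q [0..<length (t2_out (t2_run M ?k x t))]" by (simp add: take_map)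
          then show ?thesis using u by simp
        qed
        moreover have "\<exists>t. m \<le> length (t2_out (t2_run M ?k x t))" for m
        proof -
          obtain T where T: "m \<le> e T" using out(4) nohalt by blast
          obtain \<tau> where "t2_out (t2_run M ?k x \<tau>) = map q [0..<e T]" using late[of T] by blast
          then show ?thesis using T by (intro exI[of _ \<tau>]) simp
        qed
        ultimately show ?thesis using Seq by simp
      qed
      then show "x \<in> PiE {1..?k} (spaces N) \<and> y \<in> spaces N 0 \<and> t2_yields M ?k x y"
        using yields run(3) by (auto simp: gtm_yields_def accepting_config_def)
    qed
  qed
qed

end

text \<open>
  One Type-2 machine is chosen for each label that uses a function.
\<close>

theorem computable_gtm_fun:
  fixes N :: "('s::{finite, zero_neq_one}, 's val, 'g, 'l) gtm"
  assumes "wf_gtm N" and used: "\<forall>(n, D, R, f) \<in> used_functions N. computable_pfun n D R f"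
  shows "computable_pfun (inputs N) (spaces N) (spaces N 0) (gtm_fun N)"
proof -
  have "\<exists>M. \<forall>n ix f. calls (Stm N l) n ix f \<longrightarrow> wf_t2 n M \<and> (\<forall>x y. f x = Some y \<longrightarrow> t2_yields M n x y)"
    if l: "l \<in> labels N - {final N}" for l
  proof (cases "\<exists>n ix f. calls (Stm N l) n ix f")
    case True
    then obtain n ix f where c: "calls (Stm N l) n ix f" by blast
    have uniq: "n' = n \<and> ix' = ix \<and> f' = f" if "calls (Stm N l) n' ix' f'" for n' ix' f'
      using that c by (auto simp: calls_def)
    from c consider (assign) i l' where "Stm N l = Assign i n ix f l'"
      | (test) g l' l'' where "Stm N l = Test n ix g l' l''" "f = (\<lambda>x. map_option Word (g x))"
      unfolding calls_def by blast
    then have "\<exists>R. (n, \<lambda>j. spaces N (ix j), R, f) \<in> used_functions N"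
    proof cases
      case assign
      then have "(n, \<lambda>j. spaces N (ix j), spaces N i, f) \<in> used_functions N"
        using l unfolding used_functions_def by blast
      then show ?thesis by blast
    next
      case test
      then have "(n, \<lambda>j. spaces N (ix j), Words, f) \<in> used_functions N"
        using l unfolding used_functions_def by blast
      then show ?thesis by blast
    qed
    then obtain R where "computable_pfun n (\<lambda>j. spaces N (ix j)) R f" using used by blast
    then obtain g M where "f \<subseteq>\<^sub>m g" "wf_t2 n M" "t2_computes M n (\<lambda>j. spaces N (ix j)) R g"
      unfolding computable_pfun_def turing_computable_def by blast
    then have "wf_t2 n M" "\<forall>x y. f x = Some y \<longrightarrow> t2_yields M n x y"
      unfolding t2_computes_def map_le_def by (metis domI)+
    then show ?thesis using uniq by blast
  qed blast
  then obtain machine where "\<forall>l \<in> labels N - {final N}. \<forall>n ix f. calls (Stm N l) n ix f \<longrightarrow>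
      wf_t2 n (machine l) \<and> (\<forall>x y. f x = Some y \<longrightarrow> t2_yields (machine l) n x y)"
    by metis
  then interpret gtm_simulation N machine
    using assms(1) by unfold_locales blast+
  show ?thesis by (rule gtm_fun_computable)
qed

section \<open>Closure of continuity and computability under generalized Turing machines\<close>

theorem corollary5p8:
  fixes N :: "('s::{finite, zero_neq_one}, 's val, 'g, 'l) gtm"
  assumes "wf_gtm N"
    and "\<forall>i \<le> maxtape N. spaces N i \<in> {Words, Seqs}"
  shows "((\<forall>(n, D, R, f) \<in> used_functions N. continuous_pfun n D R f) \<longrightarrow>
            continuous_pfun (inputs N) (spaces N) (spaces N 0) (gtm_fun N)) \<and>
         ((\<forall>(n, D, R, f) \<in> used_functions N. computable_pfun n D R f) \<longrightarrow>
            computable_pfun (inputs N) (spaces N) (spaces N 0) (gtm_fun N))"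
proof (intro conjI impI)
  assume "\<forall>(n, D, R, f) \<in> used_functions N. continuous_pfun n D R f"
  then show "continuous_pfun (inputs N) (spaces N) (spaces N 0) (gtm_fun N)"
    by (rule continuous_gtm_fun[OF assms])
next
  assume "\<forall>(n, D, R, f) \<in> used_functions N. computable_pfun n D R f"
  then show "computable_pfun (inputs N) (spaces N) (spaces N 0) (gtm_fun N)"
    by (rule computable_gtm_fun[OF assms(1)])
qed

end
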